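(* Let $\mathbb{K}$ be a field, let $G$ be a graph on the vertex set $[n]=\{1,\ldots,n\}$, let $S=\mathbb{K}[x_1,\ldots,x_n,y_1,\ldots,y_n]$, and let $J_G\subseteq S$ be the binomial edge ideal of $G$. Let $\eta(G)$ be the maximum size of a clique disjoint edge set in $G$. Then $$\operatorname{reg} S/J_G\leq\eta(G).$$
   Context: All graphs are simple (undirected, no loops, no multiple edges). The binomial edge ideal of a graph $G$ on $[n]$ is the ideal $J_G$ of $S=\mathbb{K}[x_1,\ldots,x_n,y_1,\ldots,y_n]$ generated by all binomials $f_{ij}=x_iy_j-x_jy_i$ with $i<j$ and $\{i,j\}\in E(G)$. The Castelnuovo-Mumford regularity is $\operatorname{reg} S/J_G=\max\{j-i : \beta_{i,j}(S/J_G)\neq 0\}$, where $\beta_{i,j}(S/J_G)$ are the graded Betti numbers of $S/J_G$ over the standard graded polynomial ring $S$. A set $\mathcal{H}\subseteq E(G)$ is a clique disjoint edge set in $G$ if no two (distinct) elements of $\mathcal{H}$ belong to a common clique of $G$, i.e. there are no two distinct edges $e,e'\in\mathcal{H}$ and no set $C\subseteq V(G)$ of pairwise adjacent vertices with $e\cup e'\subseteq C$. Then $\eta(G)=\max\{|\mathcal{H}| : \mathcal{H}\text{ is a clique disjoint edge set in }G\}$. *)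

theory Defs
  imports
    "HOL-Library.Poly_Mapping"
    "HOL-Library.Extended_Real"
    "HOL-Algebra.QuotRing"
    "Jordan_Normal_Form.Matrix"
begin

datatype var = VarX nat | VarY nat

text \<open>Polynomials with coefficients in \<open>'k\<close> in the infinitely many variables \<open>VarX i\<close>, \<open>VarY i\<close>
  (\<open>i :: nat\<close>); the product is the convolution product of \<open>HOL-Library.Poly_Mapping\<close>.
  The ring \<open>S = K[x_1,...,x_n,y_1,...,y_n]\<close> is the subring \<open>poly_ring n\<close> below.\<close>

type_synonym 'k xypoly = "(var \<Rightarrow>\<^sub>0 nat) \<Rightarrow>\<^sub>0 'k"

definition xvar :: "nat \<Rightarrow> 'k::field xypoly" where
  "xvar i = Poly_Mapping.single (Poly_Mapping.single (VarX i) 1) 1"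

definition yvar :: "nat \<Rightarrow> 'k::field xypoly" where
  "yvar i = Poly_Mapping.single (Poly_Mapping.single (VarY i) 1) 1"

definition poly_ring :: "nat \<Rightarrow> 'k::field xypoly ring" where
  "poly_ring n =
    \<lparr>carrier = {p. \<forall>m\<in>Poly_Mapping.keys p. Poly_Mapping.keys m \<subseteq> VarX ` {1..n} \<union> VarY ` {1..n}},
     monoid.mult = (*), one = 1, zero = 0, add = (+)\<rparr>"

definition monom_degree :: "(var \<Rightarrow>\<^sub>0 nat) \<Rightarrow> nat" where
  "monom_degree m = (\<Sum>v\<in>Poly_Mapping.keys m. Poly_Mapping.lookup m v)"

text \<open>The zero polynomial is homogeneous of every degree, and it is the only polynomial
  homogeneous of a negative degree.\<close>

definition homogeneous :: "int \<Rightarrow> 'k::field xypoly \<Rightarrow> bool" where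
  "homogeneous d p \<longleftrightarrow> (\<forall>m\<in>Poly_Mapping.keys p. int (monom_degree m) = d)"


text \<open>A finitely generated graded free module \<open>S(-d_0) \<oplus> \<dots> \<oplus> S(-d_{r-1})\<close> is given by the list
  \<open>[d_0,...,d_{r-1}]\<close> of the degrees of its basis elements.\<close>

definition free_module :: "nat \<Rightarrow> int list \<Rightarrow> 'k::field xypoly vec set" where
  "free_module n ds =
    {v. dim_vec v = length ds \<and> (\<forall>k<length ds. v $ k \<in> carrier (poly_ring n))}"

text \<open>The matrix of a degree-preserving \<open>S\<close>-linear map from the graded free module with basis
  degrees \<open>ds\<close> to the one with basis degrees \<open>es\<close>.\<close>

definition graded_map ::
    "nat \<Rightarrow> int list \<Rightarrow> int list \<Rightarrow> 'k::field xypoly mat \<Rightarrow> bool" where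
  "graded_map n ds es A \<longleftrightarrow>
    A \<in> carrier_mat (length es) (length ds) \<and>
    (\<forall>a<length es. \<forall>b<length ds.
       A $$ (a, b) \<in> carrier (poly_ring n) \<and> homogeneous (ds ! b - es ! a) (A $$ (a, b)))"

text \<open>A minimal graded free resolution
  \<open>\<dots> \<rightarrow> F_2 \<rightarrow> F_1 \<rightarrow> F_0 \<rightarrow> S/I \<rightarrow> 0\<close> of \<open>S/I\<close>.  The basis degrees of \<open>F_i\<close> are \<open>gens i\<close>, and
  \<open>d (Suc i)\<close> is the matrix of \<open>F_{i+1} \<rightarrow> F_i\<close>.  The matrix \<open>d 0\<close> has one row and lifts the
  augmentation \<open>F_0 \<rightarrow> S/I\<close> to a map \<open>F_0 \<rightarrow> S\<close>.  Minimality, i.e. that the image of \<open>F_{i+1}\<close> lies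
  in \<open>(x_1,...,x_n,y_1,...,y_n) F_i\<close>, says that the entries of \<open>d (Suc i)\<close> have no constant term.\<close>

definition augmentation ::
    "nat \<Rightarrow> 'k::field xypoly set \<Rightarrow> 'k xypoly mat \<Rightarrow> 'k xypoly vec \<Rightarrow> 'k xypoly set" where
  "augmentation n I A v = I +>\<^bsub>poly_ring n\<^esub> ((A *\<^sub>v v) $ 0)"

definition minimal_graded_free_resolution ::
    "nat \<Rightarrow> 'k::field xypoly set \<Rightarrow> (nat \<Rightarrow> int list) \<Rightarrow> (nat \<Rightarrow> 'k xypoly mat) \<Rightarrow> bool" where
  "minimal_graded_free_resolution n I gens d \<longleftrightarrow>
    graded_map n (gens 0) [0] (d 0) \<and>
    (\<forall>i. graded_map n (gens (Suc i)) (gens i) (d (Suc i))) \<and>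
    augmentation n I (d 0) ` free_module n (gens 0) = carrier (poly_ring n Quot I) \<and>
    {v \<in> free_module n (gens 0). augmentation n I (d 0) v = \<zero>\<^bsub>poly_ring n Quot I\<^esub>}
      = (\<lambda>w. d 1 *\<^sub>v w) ` free_module n (gens 1) \<and>
    (\<forall>i. {v \<in> free_module n (gens (Suc i)). d (Suc i) *\<^sub>v v = 0\<^sub>v (length (gens i))}
      = (\<lambda>w. d (Suc (Suc i)) *\<^sub>v w) ` free_module n (gens (Suc (Suc i)))) \<and>
    (\<forall>i. \<forall>a<length (gens i). \<forall>b<length (gens (Suc i)).
       Poly_Mapping.lookup (d (Suc i) $$ (a, b)) 0 = 0)"

text \<open>\<open>\<beta>_{i,j}(S/I)\<close>: the number of basis elements of degree \<open>j\<close> of the \<open>i\<close>-th module in a minimal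
  graded free resolution of \<open>S/I\<close>.  For a homogeneous ideal such a resolution exists and is unique
  up to isomorphism, so the choice is immaterial.\<close>

definition graded_betti :: "nat \<Rightarrow> 'k::field xypoly set \<Rightarrow> nat \<Rightarrow> int \<Rightarrow> nat" where
  "graded_betti n I i j =
    (SOME b. \<exists>gens d. minimal_graded_free_resolution n I gens d \<and> b = count_list (gens i) j)"

text \<open>\<open>reg(S/I)\<close>.  The supremum is taken in the extended reals, so that it is defined without
  knowing in advance that the set is bounded; a finite supremum is a maximum, the set consisting
  of integers.\<close>

definition regularity :: "nat \<Rightarrow> 'k::field xypoly set \<Rightarrow> ereal" where
  "regularity n I =
    Sup {ereal (of_int (j - int i)) | i j. graded_betti n I i j \<noteq> 0}"


definition simple_graph :: "nat set \<Rightarrow> nat set set \<Rightarrow> bool" where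
  "simple_graph V E \<longleftrightarrow> finite V \<and> (\<forall>e\<in>E. e \<subseteq> V \<and> card e = 2)"

definition binomial_edge_ideal :: "nat \<Rightarrow> nat set set \<Rightarrow> 'k::field xypoly set" where
  "binomial_edge_ideal n E =
    genideal (poly_ring n) {xvar i * yvar j - xvar j * yvar i | i j. i < j \<and> {i, j} \<in> E}"

definition is_clique :: "nat set \<Rightarrow> nat set set \<Rightarrow> nat set \<Rightarrow> bool" where
  "is_clique V E C \<longleftrightarrow> C \<subseteq> V \<and> (\<forall>u\<in>C. \<forall>v\<in>C. u \<noteq> v \<longrightarrow> {u, v} \<in> E)"

definition clique_disjoint_edge_set :: "nat set \<Rightarrow> nat set set \<Rightarrow> nat set set \<Rightarrow> bool" where
  "clique_disjoint_edge_set V E H \<longleftrightarrow> H \<subseteq> E \<and>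
    \<not> (\<exists>e\<in>H. \<exists>e'\<in>H. e \<noteq> e' \<and> (\<exists>C. is_clique V E C \<and> e \<union> e' \<subseteq> C))"

definition eta :: "nat set \<Rightarrow> nat set set \<Rightarrow> nat" where
  "eta V E = Max {card H | H. clique_disjoint_edge_set V E H}"

end

theory Submission
  imports Defs
begin

text \<open>The regularity of \<open>S/I\<close> is read off from Koszul homology instead of from a resolution.  A Koszul chain
is a function \<open>z\<close> from sets of variables to polynomials, \<open>z T\<close> being the coefficient of the exterior
basis element \<open>e\<^sub>T\<close>.  Call \<open>S/I\<close> Koszul \<open>r\<close>-regular (\<open>koszul_reg\<close>) if every chain with coefficients of one
degree above \<open>r\<close> that is a cycle modulo \<open>I\<close> is a boundary modulo \<open>I\<close>.  Two facts suffice to bound this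
number.  The exact sequence \<open>0 \<rightarrow> S/(A \<inter> B) \<rightarrow> S/A \<oplus> S/B \<rightarrow> S/(A + B) \<rightarrow> 0\<close> bounds the regularity of
\<open>A \<inter> B\<close> by those of \<open>A\<close>, \<open>B\<close> and one more than that of \<open>A + B\<close> (\<open>koszul_reg_Int\<close>); and dividing out a
variable that is a nonzerodivisor does not lower the regularity (\<open>koszul_reg_lift\<close>), because
multiplication by a variable is null-homotopic on the Koszul complex.

The bound \<open>\<eta>\<close> is proved by induction on the number of vertices that have two nonadjacent
neighbours (\<open>koszul_reg_le_eta\<close>).  Let \<open>v\<close> be such a vertex and \<open>G\<^sub>v\<close> the graph in which the neighbours of
\<open>v\<close> have been made adjacent.  Then \<open>J\<^sub>G\<close> is the intersection of the ideal of \<open>G\<^sub>v\<close> and of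
\<open>(x\<^sub>v, y\<^sub>v) + J\<^bsub>G - v\<^esub>\<close> (\<open>ideal_eq_Int\<close>), and the sum of these two ideals is \<open>(x\<^sub>v, y\<^sub>v)\<close> plus the ideal of
\<open>G\<^sub>v - v\<close>.  Passing to \<open>G - v\<close> does not raise \<open>\<eta>\<close> and passing to \<open>G\<^sub>v\<close>, hence to \<open>G\<^sub>v - v\<close>, lowers it
(\<open>eta_complete_at\<close>); this pays for the extra one in the exact sequence.  If no such vertex is left,
\<open>G\<close> is a disjoint union of cliques.  Then \<open>x\<^sub>v\<close> is a nonzerodivisor, and \<open>J\<^sub>G + (x\<^sub>v)\<close> is once more an
intersection of ideals of smaller graphs (\<open>cluster_ideal_eq_Int\<close>), now together with some variables.
This is why the whole induction deals with ideals generated by a set \<open>W\<close> of variables and the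
binomials of a graph that does not touch \<open>W\<close>.

It remains to compare with minimal free resolutions.  Koszul regularity grows by at most one from a
module to its module of syzygies (\<open>module_reg_syzygies\<close>), and the generators in a minimal resolution have
degree at most the Koszul regularity of the module that they generate (\<open>minimal_degrees_le\<close>).  Hence
every generator of the \<open>i\<close>-th module in any minimal resolution has degree at most \<open>\<eta> + i\<close>.  As the
Betti numbers are defined by a choice of a minimal resolution, one has to exist.  The
regularity bound provides it: it forces every syzygy module to be generated in bounded degree, hence
by finitely many elements, so that a minimal generating set can be chosen at each step
(\<open>minimal_presentation\<close>).\<close>

section \<open>Polynomials and their homogeneous components\<close>

abbreviation "lookup \<equiv> Poly_Mapping.lookup"
abbreviation "keys \<equiv> Poly_Mapping.keys"
abbreviation "single \<equiv> Poly_Mapping.single"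

type_synonym monom = "var \<Rightarrow>\<^sub>0 nat"

lemma poly_sum_singles: "(p :: 'k::field xypoly) = (\<Sum>m\<in>keys p. single m (lookup p m))"
proof (rule poly_mapping_eqI)
  fix k
  have "lookup (\<Sum>m\<in>keys p. single m (lookup p m)) k
      = (\<Sum>m\<in>keys p. if m = k then lookup p m else 0)"
    unfolding lookup_sum by (rule sum.cong) (auto simp: lookup_single when_def)
  also have "\<dots> = lookup p k"
    by (auto simp: sum.delta' sum.delta not_in_keys_iff_lookup_eq_zero)
  finally show "lookup p k = lookup (\<Sum>m\<in>keys p. single m (lookup p m)) k" by simp
qed

text \<open>The variant of induction over the terms of \<open>p\<close> that keeps \<open>m \<in> keys p\<close> in the monomial case, so that it
can be used for polynomials in a restricted set of variables.\<close>

lemma poly_additive_induct [case_names zero single add]: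
  fixes p :: "'k::field xypoly"
  assumes "P 0" and s: "\<And>m c. m \<in> keys p \<Longrightarrow> P (single m c)"
    and a: "\<And>q r. P q \<Longrightarrow> P r \<Longrightarrow> P (q + r)"
  shows "P p"
proof -
  have "P (\<Sum>m\<in>A. single m (lookup p m))" if "finite A" "A \<subseteq> keys p" for A
    using that by (induction A rule: finite_induct) (auto intro: assms)
  from this[of "keys p"] show ?thesis using poly_sum_singles[of p] by simp
qed

text \<open>Homogeneous components and the substitution \<open>x\<^sub>v = y\<^sub>v = 0\<close> are both instances of discarding monomials.\<close>

definition mfilter :: "(monom \<Rightarrow> bool) \<Rightarrow> 'k::field xypoly \<Rightarrow> 'k xypoly" where
  "mfilter Q p = Abs_poly_mapping (\<lambda>m. if Q m then lookup p m else 0)"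

lemma lookup_mfilter: "lookup (mfilter Q p) m = (if Q m then lookup p m else 0)"
proof -
  have "finite {m. (if Q m then lookup p m else 0) \<noteq> 0}"
    by (rule finite_subset[OF _ finite_keys[of p]]) (auto simp: in_keys_iff)
  then show ?thesis unfolding mfilter_def by simp
qed

lemma mfilter_simps [simp]:
  "mfilter Q 0 = 0" "mfilter Q (p + q) = mfilter Q p + mfilter Q q" "mfilter Q (p - q) = mfilter Q p - mfilter Q q"
  "mfilter Q (- p) = - mfilter Q p"
  "mfilter Q (single m c) = (if Q m then single m c else 0)"
  by (auto intro!: poly_mapping_eqI simp: lookup_mfilter lookup_add lookup_minus lookup_single when_def)

lemma mfilter_sum: "mfilter Q (sum f A) = (\<Sum>a\<in>A. mfilter Q (f a))"
  by (induction A rule: infinite_finite_induct) auto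

lemma keys_mfilter: "keys (mfilter Q p) = {m\<in>keys p. Q m}"
  by (auto simp: in_keys_iff lookup_mfilter split: if_splits)

lemma mfilter_single_mult:
  assumes "\<And>m'. Q (m + m') \<longleftrightarrow> Q' m'"
  shows "mfilter Q (single m c * p) = single m c * mfilter Q' p"
proof (induction p rule: poly_additive_induct)
  case (single m' c')
  then show ?case by (simp add: mult_single assms)
qed (auto simp: algebra_simps)

text \<open>These linear functionals, for \<open>Q\<close> a congruence class of monomials, detect membership in a toric
ideal.\<close>

definition coeff_sum :: "(monom \<Rightarrow> bool) \<Rightarrow> 'k::field xypoly \<Rightarrow> 'k" where
  "coeff_sum Q p = (\<Sum>m\<in>keys p. if Q m then lookup p m else 0)"

lemma coeff_sum_superset:
  assumes "finite A" "keys p \<subseteq> A"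
  shows "coeff_sum Q p = (\<Sum>m\<in>A. if Q m then lookup p m else 0)"
  unfolding coeff_sum_def by (rule sum.mono_neutral_left) (use assms in \<open>auto simp: in_keys_iff\<close>)

lemma coeff_sum_add: "coeff_sum Q (p + q) = coeff_sum Q p + coeff_sum Q q"
proof -
  let ?A = "keys p \<union> keys q"
  have "coeff_sum Q (p + q) = (\<Sum>m\<in>?A. if Q m then lookup (p + q) m else 0)"
    by (rule coeff_sum_superset) (use keys_add[of p q] in auto)
  moreover have "coeff_sum Q p = (\<Sum>m\<in>?A. if Q m then lookup p m else 0)"
    "coeff_sum Q q = (\<Sum>m\<in>?A. if Q m then lookup q m else 0)"
    by (rule coeff_sum_superset; auto)+
  ultimately show ?thesis
    by (simp add: sum.distrib[symmetric] lookup_add if_distrib cong: if_cong)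
qed

lemma coeff_sum_simps [simp]:
  "coeff_sum Q 0 = 0" "coeff_sum Q (single m c) = (if Q m then c else 0)"
  by (auto simp: coeff_sum_def)

lemma coeff_sum_diff: "coeff_sum Q (p - q) = coeff_sum Q p - coeff_sum Q q"
  using coeff_sum_add[of Q "p - q" q] by (simp add: algebra_simps)

lemma coeff_sum_single_mult:
  assumes "\<And>m'. Q (m + m') \<longleftrightarrow> Q' m'"
  shows "coeff_sum Q (single m c * p) = c * coeff_sum Q' p"
proof (induction p rule: poly_additive_induct)
  case (single m' c')
  then show ?case by (simp add: mult_single assms)
qed (auto simp: algebra_simps coeff_sum_add)

lemma monom_degree_superset:
  assumes "finite A" "keys m \<subseteq> A" shows "monom_degree m = (\<Sum>v\<in>A. lookup m v)"
  unfolding monom_degree_def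
  by (rule sum.mono_neutral_left) (use assms in \<open>auto simp: in_keys_iff\<close>)

lemma monom_degree_add [simp]: "monom_degree (m + m') = monom_degree m + monom_degree m'"
proof -
  let ?A = "keys m \<union> keys m'"
  have "monom_degree (m + m') = (\<Sum>v\<in>?A. lookup (m + m') v)"
    by (rule monom_degree_superset) (use keys_add[of m m'] in auto)
  moreover have "monom_degree m = (\<Sum>v\<in>?A. lookup m v)" "monom_degree m' = (\<Sum>v\<in>?A. lookup m' v)"
    by (rule monom_degree_superset; auto)+
  ultimately show ?thesis by (simp add: lookup_add sum.distrib)
qed

lemma monom_degree_single [simp]: "monom_degree (single v k) = k"
  by (simp add: monom_degree_def)

lemma monom_degree_eq_0_iff [simp]: "monom_degree m = 0 \<longleftrightarrow> m = 0"
proof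
  assume "monom_degree m = 0"
  then have "\<forall>v. lookup m v = 0"
    by (auto simp: monom_degree_def in_keys_iff) 
  then show "m = 0" by (intro poly_mapping_eqI) auto
qed (simp add: monom_degree_def)

definition hom_comp :: "int \<Rightarrow> 'k::field xypoly \<Rightarrow> 'k xypoly" where
  "hom_comp d = mfilter (\<lambda>m. int (monom_degree m) = d)"

lemma hom_comp_simps [simp]:
  "hom_comp d 0 = 0" "hom_comp d (p + q) = hom_comp d p + hom_comp d q" "hom_comp d (p - q) = hom_comp d p - hom_comp d q"
  "hom_comp d (- p) = - hom_comp d p"
  by (auto simp: hom_comp_def)

lemma hom_comp_sum: "hom_comp d (sum f A) = (\<Sum>a\<in>A. hom_comp d (f a))"
  by (simp add: hom_comp_def mfilter_sum)

lemma homogeneous_hom_comp [simp]: "homogeneous d (hom_comp d p)"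
  by (auto simp: homogeneous_def hom_comp_def keys_mfilter)

lemma homogeneous_iff_hom_comp: "homogeneous d p \<longleftrightarrow> hom_comp d p = p"
proof
  assume h: "homogeneous d p"
  show "hom_comp d p = p"
    by (rule poly_mapping_eqI) (use h in \<open>auto simp: hom_comp_def lookup_mfilter homogeneous_def in_keys_iff\<close>)
qed (metis homogeneous_hom_comp)

lemma hom_comp_homogeneous: "homogeneous e p \<Longrightarrow> hom_comp d p = (if d = e then p else 0)"
  by (rule poly_mapping_eqI) (auto simp: hom_comp_def lookup_mfilter homogeneous_def in_keys_iff)

lemma homogeneous_simps [simp]: "homogeneous d 0"
  by (auto simp: homogeneous_def)

lemma homogeneous_diff: "homogeneous d p \<Longrightarrow> homogeneous d q \<Longrightarrow> homogeneous d (p - q)"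
  by (simp add: homogeneous_iff_hom_comp)

lemma homogeneous_single: "homogeneous d (single m c) \<longleftrightarrow> c = 0 \<or> int (monom_degree m) = d"
  by (auto simp: homogeneous_def)

lemma homogeneous_mult:
  assumes "homogeneous d p" "homogeneous e q" shows "homogeneous (d + e) (p * q)"
  using keys_mult[of p q] assms unfolding homogeneous_def by fastforce

lemma hom_comp_mult_homogeneous:
  assumes "homogeneous e g" shows "hom_comp d (p * g) = hom_comp (d - e) p * g"
proof (induction p rule: poly_additive_induct)
  case (single m c)
  have "homogeneous (int (monom_degree m) + e) (single m c * g)"
    by (rule homogeneous_mult) (auto simp: homogeneous_single assms)
  then have "hom_comp d (single m c * g) = (if d = int (monom_degree m) + e then single m c * g else 0)"
    by (rule hom_comp_homogeneous)
  moreover have "hom_comp (d - e) (single m c) = (if int (monom_degree m) = d - e then single m c else 0)"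
    by (simp add: hom_comp_def)
  ultimately show ?case by auto
qed (auto simp: algebra_simps)

lemma homogeneous_degree_0_eq_constant:
  assumes "homogeneous 0 p" shows "p = single 0 (lookup p 0)"
  by (rule poly_mapping_eqI) (use assms in \<open>auto simp: homogeneous_def lookup_single when_def in_keys_iff\<close>)

lemma homogeneous_negative: "homogeneous d p \<Longrightarrow> d < 0 \<Longrightarrow> p = 0"
  by (rule poly_mapping_eqI) (auto simp: homogeneous_def in_keys_iff)

lemma homogeneous_no_constant: "homogeneous d p \<Longrightarrow> d \<noteq> 0 \<Longrightarrow> lookup p 0 = 0"
  by (auto simp: homogeneous_def in_keys_iff)

definition indet :: "var \<Rightarrow> 'k::field xypoly" where "indet v = single (single v 1) 1"

lemma xvar_indet: "xvar i = indet (VarX i)" and yvar_indet: "yvar i = indet (VarY i)"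
  by (auto simp: xvar_def yvar_def indet_def)

lemma homogeneous_indet [simp]: "homogeneous 1 (indet v)"
  by (simp add: indet_def homogeneous_single)

lemma hom_comp_indet_mult: "hom_comp d (indet v * p) = indet v * hom_comp (d - 1) p"
  using hom_comp_mult_homogeneous[OF homogeneous_indet, of d p v] by (simp add: mult.commute)

lemma lookup_0_mult: "lookup (p * q) 0 = lookup p 0 * lookup (q :: 'k::field xypoly) 0"
proof (induction p rule: poly_additive_induct)
  case (single m c)
  show ?case
  proof (induction q rule: poly_additive_induct)
    case (single m' c')
    have "m + m' = 0 \<longleftrightarrow> m = 0 \<and> m' = 0"
      by (metis add_is_0 monom_degree_add monom_degree_eq_0_iff)
    then show ?case by (auto simp: mult_single lookup_single when_def)
  qed (auto simp: algebra_simps lookup_add)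
qed (auto simp: algebra_simps lookup_add)

lemma lookup_0_indet [simp]: "lookup (indet v) 0 = 0"
  using homogeneous_no_constant[OF homogeneous_indet] by auto

text \<open>The polynomial ring \<open>K[V]\<close> as a subring of the ring in all variables.\<close>

definition polys :: "var set \<Rightarrow> 'k::field xypoly set" where
  "polys V = {p. \<forall>m\<in>keys p. keys m \<subseteq> V}"

lemma polys_closed [simp]:
  "0 \<in> polys V" "1 \<in> polys V" "p \<in> polys V \<Longrightarrow> - p \<in> polys V"
  "p \<in> polys V \<Longrightarrow> q \<in> polys V \<Longrightarrow> p + q \<in> polys V"
  "p \<in> polys V \<Longrightarrow> q \<in> polys V \<Longrightarrow> p - q \<in> polys V"
  "p \<in> polys V \<Longrightarrow> q \<in> polys V \<Longrightarrow> p * q \<in> polys V"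
  "single 0 c \<in> polys V"
proof -
  show "p + q \<in> polys V" if "p \<in> polys V" "q \<in> polys V" for p q
    using that keys_add[of p q] unfolding polys_def by blast
  show "p - q \<in> polys V" if "p \<in> polys V" "q \<in> polys V" for p q
    using that keys_diff[of p q] unfolding polys_def by blast
  show "p * q \<in> polys V" if "p \<in> polys V" "q \<in> polys V" for p q
  proof -
    have "keys m \<subseteq> V" if m: "m \<in> keys (p * q)" for m
    proof -
      obtain a b where "m = a + b" "a \<in> keys p" "b \<in> keys q" using keys_mult[of p q] m by blast
      then show ?thesis using \<open>p \<in> polys V\<close> \<open>q \<in> polys V\<close> keys_add[of a b] unfolding polys_def by blast
    qed
    then show ?thesis unfolding polys_def by blast
  qed
qed (auto simp: polys_def)

lemma polys_sum [simp]: "(\<And>a. a \<in> A \<Longrightarrow> f a \<in> polys V) \<Longrightarrow> sum f A \<in> polys V"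
  by (induction A rule: infinite_finite_induct) auto

lemma polys_mfilter [simp]: "p \<in> polys V \<Longrightarrow> mfilter Q p \<in> polys V"
  by (auto simp: polys_def keys_mfilter)

lemma polys_hom_comp [simp]: "p \<in> polys V \<Longrightarrow> hom_comp d p \<in> polys V"
  by (simp add: hom_comp_def)

lemma polys_single [simp]: "keys m \<subseteq> V \<Longrightarrow> single m c \<in> polys V"
  by (auto simp: polys_def)

lemma polys_indet [simp]: "v \<in> V \<Longrightarrow> indet v \<in> polys V"
  by (auto simp: indet_def polys_def)

section \<open>Ideals\<close>

inductive_set gen_ideal :: "var set \<Rightarrow> 'k::field xypoly set \<Rightarrow> 'k xypoly set" for V G where
  gen_ideal_0: "0 \<in> gen_ideal V G"
| gen_ideal_step: "p \<in> polys V \<Longrightarrow> g \<in> G \<Longrightarrow> q \<in> gen_ideal V G \<Longrightarrow> p * g + q \<in> gen_ideal V G"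

lemma gen_ideal_mult_gen: "p \<in> polys V \<Longrightarrow> g \<in> G \<Longrightarrow> p * g \<in> gen_ideal V G"
  using gen_ideal_step[OF _ _ gen_ideal_0] by fastforce

lemma gen_ideal_gen: "g \<in> G \<Longrightarrow> g \<in> gen_ideal V G"
  using gen_ideal_mult_gen[of 1 V g G] by simp

lemma gen_ideal_add: "a \<in> gen_ideal V G \<Longrightarrow> b \<in> gen_ideal V G \<Longrightarrow> a + b \<in> gen_ideal V G"
  by (induction rule: gen_ideal.induct) (auto simp: add.assoc intro: gen_ideal.intros)

lemma gen_ideal_mult: "a \<in> gen_ideal V G \<Longrightarrow> p \<in> polys V \<Longrightarrow> p * a \<in> gen_ideal V G"
proof (induction rule: gen_ideal.induct)
  case (gen_ideal_step q g r)
  then have "(p * q) * g + p * r \<in> gen_ideal V G" by (intro gen_ideal.gen_ideal_step) auto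
  then show ?case by (simp add: algebra_simps)
qed (auto intro: gen_ideal.intros)

lemma gen_ideal_uminus: "a \<in> gen_ideal V G \<Longrightarrow> - a \<in> gen_ideal V G"
  using gen_ideal_mult[of a V G "- 1"] by simp

lemma gen_ideal_diff: "a \<in> gen_ideal V G \<Longrightarrow> b \<in> gen_ideal V G \<Longrightarrow> a - b \<in> gen_ideal V G"
  using gen_ideal_add[OF _ gen_ideal_uminus, of a V G b] by simp

lemma gen_ideal_least: 
  assumes "G \<subseteq> gen_ideal V G'" shows "gen_ideal V G \<subseteq> gen_ideal V G'"
proof
  fix a assume "a \<in> gen_ideal V G"
  then show "a \<in> gen_ideal V G'"
    by (induction rule: gen_ideal.induct) (use assms in \<open>auto intro: gen_ideal_0 gen_ideal_add gen_ideal_mult\<close>)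
qed

lemma gen_ideal_mono: "G \<subseteq> G' \<Longrightarrow> gen_ideal V G \<subseteq> gen_ideal V G'"
  by (rule gen_ideal_least) (auto intro: gen_ideal_gen)

lemma gen_ideal_Un:
  assumes "a \<in> gen_ideal V (G \<union> G')"
  shows "\<exists>b\<in>gen_ideal V G. \<exists>c\<in>gen_ideal V G'. a = b + c"
  using assms
proof (induction rule: gen_ideal.induct)
  case gen_ideal_0
  then show ?case by (intro bexI[of _ 0]) (auto intro: gen_ideal.gen_ideal_0)
next
  case (gen_ideal_step p g q)
  then obtain b c where bc: "b \<in> gen_ideal V G" "c \<in> gen_ideal V G'" "q = b + c" by auto
  show ?case
  proof (cases "g \<in> G")
    case True
    then have "p * g + b \<in> gen_ideal V G" using bc gen_ideal_step by (intro gen_ideal.gen_ideal_step) auto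
    moreover have "p * g + q = (p * g + b) + c" using bc by simp
    ultimately show ?thesis using bc by blast
  next
    case False
    then have "p * g + c \<in> gen_ideal V G'" using bc gen_ideal_step by (intro gen_ideal.gen_ideal_step) auto
    moreover have "p * g + q = b + (p * g + c)" using bc by simp
    ultimately show ?thesis using bc by blast
  qed
qed

lemma gen_ideal_polys: "G \<subseteq> polys V \<Longrightarrow> gen_ideal V G \<subseteq> polys V"
proof
  fix a assume "G \<subseteq> polys V" "a \<in> gen_ideal V G"
  from this(2,1) show "a \<in> polys V" by (induction rule: gen_ideal.induct) auto
qed

text \<open>Only closure properties of ideals of \<open>K[V]\<close> are used in arguments with chains; intersections, which
come without generators, are covered as well.\<close>

definition graded_ideal :: "var set \<Rightarrow> 'k::field xypoly set \<Rightarrow> bool" where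
  "graded_ideal V I \<longleftrightarrow> I \<subseteq> polys V \<and> 0 \<in> I \<and> (\<forall>a\<in>I. \<forall>b\<in>I. a + b \<in> I)
     \<and> (\<forall>a\<in>I. \<forall>p\<in>polys V. p * a \<in> I) \<and> (\<forall>a\<in>I. \<forall>d. hom_comp d a \<in> I)"

lemma graded_idealD:
  assumes "graded_ideal V I"
  shows "I \<subseteq> polys V" "0 \<in> I" "a \<in> I \<Longrightarrow> b \<in> I \<Longrightarrow> a + b \<in> I" "a \<in> I \<Longrightarrow> p \<in> polys V \<Longrightarrow> p * a \<in> I"
    "a \<in> I \<Longrightarrow> hom_comp d a \<in> I" "a \<in> I \<Longrightarrow> - a \<in> I" "a \<in> I \<Longrightarrow> b \<in> I \<Longrightarrow> a - b \<in> I"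
proof -
  show m: "- a \<in> I" if "a \<in> I" for a
  proof -
    have "- 1 * a \<in> I" using assms that unfolding graded_ideal_def by (metis polys_closed(2,3))
    then show ?thesis by simp
  qed
  show "a - b \<in> I" if "a \<in> I" "b \<in> I" for a b
    using m[of b] that assms unfolding graded_ideal_def by (metis add_uminus_conv_diff)
qed (use assms in \<open>auto simp: graded_ideal_def\<close>)

lemma graded_ideal_sum: "graded_ideal V I \<Longrightarrow> (\<And>a. a \<in> A \<Longrightarrow> f a \<in> I) \<Longrightarrow> sum f A \<in> I"
  by (induction A rule: infinite_finite_induct) (auto intro: graded_idealD)

lemma graded_ideal_gen_ideal:
  assumes "G \<subseteq> polys V" "\<And>g. g \<in> G \<Longrightarrow> \<exists>e. homogeneous e g"
  shows "graded_ideal V (gen_ideal V G)"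
proof -
  have "hom_comp d a \<in> gen_ideal V G" if "a \<in> gen_ideal V G" for a d
    using that
  proof (induction rule: gen_ideal.induct)
    case (gen_ideal_step p g q)
    obtain e where "homogeneous e g" using assms(2) gen_ideal_step by blast
    then show ?case using gen_ideal_step by (auto simp: hom_comp_mult_homogeneous intro!: gen_ideal.gen_ideal_step)
  qed (simp add: gen_ideal_0)
  then show ?thesis unfolding graded_ideal_def
    using gen_ideal_polys[OF assms(1)] by (auto intro: gen_ideal_0 gen_ideal_add gen_ideal_mult)
qed

lemma graded_ideal_Int: "graded_ideal V I \<Longrightarrow> graded_ideal V J \<Longrightarrow> graded_ideal V (I \<inter> J)"
  by (auto simp: graded_ideal_def)

section \<open>Koszul chains\<close>

text \<open>Any injective numbering will do; it orders the factors of \<open>e\<^sub>T\<close> and so determines the signs.\<close>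

primrec var_code :: "var \<Rightarrow> nat" where
  "var_code (VarX i) = 2 * i"
| "var_code (VarY i) = 2 * i + 1"

lemma var_code_inj: "var_code v = var_code u \<longleftrightarrow> v = u"
  by (cases v; cases u) (simp_all, presburger+)

definition ksign :: "var \<Rightarrow> var set \<Rightarrow> 'k::field xypoly" where
  "ksign v T = (- 1) ^ card {u\<in>T. var_code u < var_code v}"

text \<open>The Koszul differential: it sends \<open>f e\<^sub>T\<close> to the sum of \<open>\<plusminus> v f e\<^bsub>T - {v}\<^esub>\<close> over \<open>v \<in> T\<close>, so that the coefficient
at \<open>T\<close> collects the contributions of all \<open>T \<union> {v}\<close>.\<close>

definition bd :: "var set \<Rightarrow> (var set \<Rightarrow> 'k::field xypoly) \<Rightarrow> var set \<Rightarrow> 'k xypoly" where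
  "bd V z T = (\<Sum>v\<in>V - T. ksign v T * (indet v * z (insert v T)))"

definition wedge :: "var \<Rightarrow> (var set \<Rightarrow> 'k::field xypoly) \<Rightarrow> var set \<Rightarrow> 'k xypoly" where
  "wedge x z T = (if x \<in> T then ksign x T * z (T - {x}) else 0)"

lemma ksign_cases: "ksign v T = 1 \<or> ksign v T = - 1"
  by (simp add: ksign_def minus_one_power_iff)

lemma ksign_square: "ksign v T * (ksign v T * p) = p"
  using ksign_cases[of v T] by (metis mult_1 mult_minus1 minus_minus)

lemma ksign_closed:
  assumes "graded_ideal V I" "p \<in> I" shows "ksign v T * p \<in> I"
  using ksign_cases[of v T] graded_idealD(6)[OF assms(1)] assms(2) by (metis mult_1 mult_minus1)

lemma polys_ksign [simp]:
  assumes "p \<in> polys V" shows "ksign v T * p \<in> polys V"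
proof -
  have "ksign v T * p = p \<or> ksign v T * p = - p" using ksign_cases[of v T] by (metis mult_1 mult_minus1)
  then show ?thesis using assms by auto
qed

lemma hom_comp_ksign: "hom_comp d (ksign v T * p) = ksign v T * hom_comp d p"
  using ksign_cases[of v T] by (metis mult_1 mult_minus1 hom_comp_simps(4))

lemma ksign_insert:
  assumes "finite T" "u \<notin> T"
  shows "ksign v (insert u T) = (if var_code u < var_code v then - ksign v T else ksign v T)"
proof (cases "var_code u < var_code v")
  case True
  then have "{w\<in>insert u T. var_code w < var_code v} = insert u {w\<in>T. var_code w < var_code v}"
    by auto
  then show ?thesis using True assms by (simp add: ksign_def)
next
  case False
  then have "{w\<in>insert u T. var_code w < var_code v} = {w\<in>T. var_code w < var_code v}"
    by auto
  then show ?thesis using False by (simp add: ksign_def)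
qed

lemma ksign_insert_self [simp]: "ksign v (insert v T) = ksign v T"
proof -
  have "{w\<in>insert v T. var_code w < var_code v} = {w\<in>T. var_code w < var_code v}" by auto
  then show ?thesis by (simp add: ksign_def)
qed

text \<open>The sign rule behind \<open>e\<^sub>u \<and> e\<^sub>v = - e\<^sub>v \<and> e\<^sub>u\<close>.\<close>

lemma ksign_swap:
  assumes "finite T" "u \<notin> T" "v \<notin> T" "u \<noteq> v"
  shows "ksign v T * ksign u (insert v T) = - (ksign u T * ksign v (insert u T))"
proof -
  have "var_code u \<noteq> var_code v" using assms var_code_inj by simp
  then consider "var_code u < var_code v" "\<not> var_code v < var_code u"
    | "var_code v < var_code u" "\<not> var_code u < var_code v" by linarith
  then show ?thesis
    by cases (simp_all add: ksign_insert[OF assms(1,2)] ksign_insert[OF assms(1,3)] mult.commute)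
qed

text \<open>The usual argument that the sum equals its own negative fails in characteristic two, so the terms are
cancelled in pairs by induction.\<close>

lemma antisymmetric_sum_zero:
  fixes F :: "'a \<Rightarrow> 'a \<Rightarrow> 'b::ab_group_add"
  assumes "finite A" "\<And>v u. v \<in> A \<Longrightarrow> u \<in> A \<Longrightarrow> v \<noteq> u \<Longrightarrow> F v u = - F u v"
  shows "(\<Sum>v\<in>A. \<Sum>u\<in>A - {v}. F v u) = 0"
  using assms
proof (induction A rule: finite_induct)
  case (insert a A)
  have "(\<Sum>u\<in>insert a A - {v}. F v u) = F v a + (\<Sum>u\<in>A - {v}. F v u)" if "v \<in> A" for v
  proof -
    have "insert a A - {v} = insert a (A - {v})" using that insert.hyps by auto
    then show ?thesis using insert.hyps by simp
  qed
  moreover have "insert a A - {a} = A" using insert.hyps by auto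
  moreover have "(\<Sum>v\<in>A. F v a) = - (\<Sum>u\<in>A. F a u)"
    unfolding sum_negf[symmetric]
    by (rule sum.cong[OF refl], rule insert.prems) (use insert.hyps in auto)
  moreover have "(\<Sum>v\<in>A. \<Sum>u\<in>A - {v}. F v u) = 0"
    by (rule insert.IH) (rule insert.prems, auto)
  ultimately show ?case using insert.hyps by (simp add: sum.distrib)
qed simp

lemma bd_cong: 
  assumes "\<And>S. S \<subseteq> V \<Longrightarrow> z S = z' S" "T \<subseteq> V" shows "bd V z T = bd V z' T"
  unfolding bd_def by (rule sum.cong) (use assms in auto)

lemma bd_add: "bd V (\<lambda>T. z T + z' T) T = bd V z T + bd V z' T"
  by (simp add: bd_def sum.distrib algebra_simps)

lemma bd_zero [simp]: "bd V (\<lambda>T. 0) T = 0"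
  by (simp add: bd_def)

lemma bd_diff: "bd V (\<lambda>T. z T - z' T) T = bd V z T - bd V z' T"
  by (simp add: bd_def sum_subtractf algebra_simps)

lemma bd_mult: "bd V (\<lambda>T. p * z T) T = p * bd V z T"
  by (simp add: bd_def sum_distrib_left algebra_simps)

lemma bd_sum: "bd V (\<lambda>T. \<Sum>a\<in>A. f a T) T = (\<Sum>a\<in>A. bd V (f a) T)"
  by (induction A rule: infinite_finite_induct) (auto simp: bd_add)

lemma bd_closed:
  assumes "graded_ideal V I" "\<And>S. S \<subseteq> V \<Longrightarrow> z S \<in> I" "T \<subseteq> V"
  shows "bd V z T \<in> I"
  unfolding bd_def
  by (intro graded_ideal_sum[OF assms(1)] ksign_closed[OF assms(1)] graded_idealD(4)[OF assms(1)] assms(2))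
     (use assms(3) in auto)

lemma bd_polys:
  assumes "\<And>S. S \<subseteq> V \<Longrightarrow> z S \<in> polys V" "T \<subseteq> V"
  shows "bd V z T \<in> polys V"
  unfolding bd_def by (intro polys_sum polys_ksign polys_closed(6) polys_indet assms(1)) (use assms(2) in auto)

lemma hom_comp_bd: "hom_comp d (bd V z T) = bd V (\<lambda>T. hom_comp (d - 1) (z T)) T"
  by (simp add: bd_def hom_comp_sum hom_comp_ksign hom_comp_indet_mult)

lemma bd_bd:
  assumes "finite V" "T \<subseteq> V" shows "bd V (bd V z) T = 0"
proof -
  have finT: "finite T" using assms finite_subset by blast
  have "bd V (bd V z) T = (\<Sum>v\<in>V - T. \<Sum>u\<in>V - T - {v}.
      ksign v T * (indet v * (ksign u (insert v T) * (indet u * z (insert u (insert v T))))))"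
    unfolding bd_def sum_distrib_left
    by (rule sum.cong[OF refl], rule sum.cong) auto
  also have "\<dots> = 0"
  proof (rule antisymmetric_sum_zero)
    fix v u assume "v \<in> V - T" "u \<in> V - T" "v \<noteq> u"
    then have s: "ksign v T * ksign u (insert v T) = - (ksign u T * ksign v (insert u T) :: 'a xypoly)"
      by (intro ksign_swap[OF finT]) auto
    let ?p = "indet v * indet u * z (insert u (insert v T))"
    have "ksign v T * (indet v * (ksign u (insert v T) * (indet u * z (insert u (insert v T)))))
        = (ksign v T * ksign u (insert v T)) * ?p" by (simp add: algebra_simps)
    also have "\<dots> = - (ksign u T * (indet u * (ksign v (insert u T) * (indet v * z (insert v (insert u T))))))"
      unfolding s by (simp add: algebra_simps insert_commute)
    finally show "ksign v T * (indet v * (ksign u (insert v T) * (indet u * z (insert u (insert v T)))))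
      = - (ksign u T * (indet u * (ksign v (insert u T) * (indet v * z (insert v (insert u T))))))" .
  qed (use assms in auto)
  finally show ?thesis .
qed

text \<open>Multiplication by a variable is null-homotopic on the Koszul complex; the homotopy is
  exterior multiplication with the corresponding basis vector.\<close>

lemma bd_wedge:
  assumes "finite V" "T \<subseteq> V" "x \<in> V"
  shows "bd V (wedge x z) T + wedge x (bd V z) T = indet x * z T"
proof -
  have finT: "finite T" using assms finite_subset by blast
  show ?thesis
  proof (cases "x \<in> T")
    case False
    have "bd V (wedge x z) T = (\<Sum>v\<in>V - T. if v = x then indet x * z T else 0)"
      unfolding bd_def
      by (rule sum.cong) (use False in \<open>auto simp: wedge_def ksign_square mult.left_commute[of "ksign x T"]\<close>)
    then show ?thesis using False assms by (simp add: wedge_def)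
  next
    case True
    define S where "S = T - {x}"
    have S: "T = insert x S" "x \<notin> S" "finite S" using True finT by (auto simp: S_def)
    have "wedge x (bd V z) T = ksign x S * (\<Sum>v\<in>insert x (V - T). ksign v S * (indet v * z (insert v S)))"
    proof -
      have VS: "V - S = insert x (V - T)" using S assms by auto
      have "wedge x (bd V z) T = ksign x (insert x S) * bd V z S"
        using True by (simp only: wedge_def if_True S_def[symmetric] S(1)[symmetric])
      then show ?thesis by (simp only: bd_def VS ksign_insert_self)
    qed
    also have "\<dots> = indet x * z T + (\<Sum>v\<in>V - T. ksign x S * (ksign v S * (indet v * z (insert v S))))"
    proof -
      have "x \<notin> V - T" "finite (V - T)" using True assms(1) by auto
      then show ?thesis
        by (simp only: sum.insert distrib_left sum_distrib_left ksign_square S(1)[symmetric] not_False_eq_True)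
    qed
    also have "(\<Sum>v\<in>V - T. ksign x S * (ksign v S * (indet v * z (insert v S))))
        = (\<Sum>v\<in>V - T. - (ksign v T * (indet v * wedge x z (insert v T))))"
    proof (rule sum.cong)
      fix v assume v: "v \<in> V - T"
      have s: "ksign x S * ksign v (insert x S) = - (ksign v S * ksign x (insert v S) :: 'a xypoly)"
        by (rule ksign_swap) (use v S in auto)
      have "wedge x z (insert v T) = ksign x (insert v S) * z (insert v S)"
      proof -
        have "insert v T - {x} = insert v S" using v S by auto
        moreover have "ksign x (insert v T) = (ksign x (insert v S) :: 'a xypoly)"
          unfolding S(1) insert_commute[of v x S] by (rule ksign_insert_self)
        ultimately show ?thesis using S by (simp add: wedge_def)
      qed
      then have w: "ksign v T * (indet v * wedge x z (insert v T))
          = (ksign v T * ksign x (insert v S)) * (indet v * z (insert v S))" by (simp add: algebra_simps)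
      have s2: "ksign v T * ksign x (insert v S) = - (ksign x S * ksign v S :: 'a xypoly)"
        using ksign_cases[of x S] ksign_cases[of v S] var_code_inj[of x v] v S
        by (auto simp: ksign_insert)
      show "ksign x S * (ksign v S * (indet v * z (insert v S))) = - (ksign v T * (indet v * wedge x z (insert v T)))"
        unfolding w s2 by (simp add: algebra_simps)
    qed simp
    finally have "wedge x (bd V z) T = indet x * z T - bd V (wedge x z) T"
      by (simp only: bd_def[of V "wedge x z"] sum_negf add_uminus_conv_diff)
    then show ?thesis by (metis add.commute diff_add_cancel)
  qed
qed

section \<open>Koszul regularity of a quotient\<close>

text \<open>Koszul homology of \<open>S/I\<close> vanishes in coefficient degree above \<open>r\<close>.  All exterior degrees are treated
at once: the components of a cycle in the single exterior degrees are cycles.  In terms of Betti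
numbers, \<open>\<beta>\<^sub>i\<^sub>j\<close> is the dimension of the homology at exterior degree \<open>i\<close> and coefficient degree \<open>j - i\<close>.\<close>

definition koszul_reg :: "var set \<Rightarrow> 'k::field xypoly set \<Rightarrow> int \<Rightarrow> bool" where
  "koszul_reg V I r \<longleftrightarrow> (\<forall>d z. r < d \<longrightarrow> (\<forall>T. z T \<in> polys V \<and> homogeneous d (z T)) \<longrightarrow> (\<forall>T\<subseteq>V. bd V z T \<in> I) \<longrightarrow>
     (\<exists>w. (\<forall>T. w T \<in> polys V \<and> homogeneous (d - 1) (w T)) \<and> (\<forall>T\<subseteq>V. z T - bd V w T \<in> I)))"

lemma koszul_reg_mono: "koszul_reg V I r \<Longrightarrow> r \<le> r' \<Longrightarrow> koszul_reg V I r'"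
  unfolding koszul_reg_def by force

text \<open>For a homogeneous ideal a bounding chain may be replaced by its component of the right degree.\<close>

lemma koszul_regI:
  assumes I: "graded_ideal V I"
    and *: "\<And>d z. r < d \<Longrightarrow> (\<And>T. z T \<in> polys V) \<Longrightarrow> (\<And>T. homogeneous d (z T)) \<Longrightarrow> (\<And>T. T \<subseteq> V \<Longrightarrow> bd V z T \<in> I)
      \<Longrightarrow> \<exists>w. (\<forall>T\<subseteq>V. w T \<in> polys V) \<and> (\<forall>T\<subseteq>V. z T - bd V w T \<in> I)"
  shows "koszul_reg V I r"
  unfolding koszul_reg_def
proof (intro allI impI)
  fix d z assume d: "r < d" and z: "\<forall>T. z T \<in> polys V \<and> homogeneous d (z T)" and b: "\<forall>T\<subseteq>V. bd V z T \<in> I"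
  obtain w where w: "\<And>T. T \<subseteq> V \<Longrightarrow> w T \<in> polys V" "\<And>T. T \<subseteq> V \<Longrightarrow> z T - bd V w T \<in> I"
    using *[of d z] d z b by blast
  define w' where "w' T = (if T \<subseteq> V then hom_comp (d - 1) (w T) else 0)" for T
  have "z T - bd V w' T \<in> I" if T: "T \<subseteq> V" for T
  proof -
    have "bd V w' T = hom_comp d (bd V w T)"
      unfolding hom_comp_bd by (rule bd_cong[OF _ T]) (simp add: w'_def)
    then have "z T - bd V w' T = hom_comp d (z T - bd V w T)"
      using z by (simp add: homogeneous_iff_hom_comp)
    then show ?thesis using graded_idealD(5)[OF I w(2)[OF T]] by simp
  qed
  then show "\<exists>w. (\<forall>T. w T \<in> polys V \<and> homogeneous (d - 1) (w T)) \<and> (\<forall>T\<subseteq>V. z T - bd V w T \<in> I)"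
    by (intro exI[of _ w']) (auto simp: w'_def w)
qed

lemma koszul_regE:
  assumes "koszul_reg V I r" "r < d" "\<And>T. z T \<in> polys V" "\<And>T. homogeneous d (z T)" "\<And>T. T \<subseteq> V \<Longrightarrow> bd V z T \<in> I"
  shows "\<exists>w. (\<forall>T. w T \<in> polys V) \<and> (\<forall>T. homogeneous (d - 1) (w T)) \<and> (\<forall>T\<subseteq>V. z T - bd V w T \<in> I)"
  using assms unfolding koszul_reg_def by metis

text \<open>The part of the long exact homology sequence of \<open>0 \<rightarrow> S/(A \<inter> B) \<rightarrow> S/A \<oplus> S/B \<rightarrow> S/C \<rightarrow> 0\<close> with
\<open>C = A + B\<close> that is needed, as a diagram chase: a cycle bounds \<open>a\<close> modulo \<open>A\<close> and \<open>b\<close> modulo \<open>B\<close>, and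
\<open>a - b\<close> is a cycle modulo \<open>C\<close> of degree one less.\<close>

lemma koszul_reg_Int:
  assumes V: "finite V" and A: "graded_ideal V A" and B: "graded_ideal V B" and C: "graded_ideal V C"
    and AC: "A \<subseteq> C" and BC: "B \<subseteq> C" and sum: "\<And>c. c \<in> C \<Longrightarrow> \<exists>a\<in>A. \<exists>b\<in>B. c = a + b"
    and kA: "koszul_reg V A r" and kB: "koszul_reg V B r" and kC: "koszul_reg V C (r - 1)"
  shows "koszul_reg V (A \<inter> B) r"
proof (rule koszul_regI[OF graded_ideal_Int[OF A B]])
  fix d z assume d: "r < d" and z: "\<And>T. z T \<in> polys V" "\<And>T. homogeneous d (z T)"
    and bz: "\<And>T. T \<subseteq> V \<Longrightarrow> bd V z T \<in> A \<inter> B"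
  obtain a where a: "\<And>T. a T \<in> polys V" "\<And>T. homogeneous (d - 1) (a T)" "\<And>T. T \<subseteq> V \<Longrightarrow> z T - bd V a T \<in> A"
    using koszul_regE[OF kA d z IntD1[OF bz]] by blast
  obtain b where b: "\<And>T. b T \<in> polys V" "\<And>T. homogeneous (d - 1) (b T)" "\<And>T. T \<subseteq> V \<Longrightarrow> z T - bd V b T \<in> B"
    using koszul_regE[OF kB d z IntD2[OF bz]] by blast
  have "bd V (\<lambda>T. a T - b T) T \<in> C" if "T \<subseteq> V" for T
  proof -
    have "bd V (\<lambda>T. a T - b T) T = (z T - bd V b T) - (z T - bd V a T)" by (simp add: bd_diff)
    also have "\<dots> \<in> C"
      using graded_idealD(7)[OF C] subsetD[OF BC b(3)[OF that]] subsetD[OF AC a(3)[OF that]] by blast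
    finally show ?thesis .
  qed
  then obtain c where c: "\<And>T. c T \<in> polys V" "\<And>T. T \<subseteq> V \<Longrightarrow> (a T - b T) - bd V c T \<in> C"
    using koszul_regE[OF kC, of "d - 1" "\<lambda>T. a T - b T"] d polys_closed(5)[OF a(1) b(1)]
      homogeneous_diff[OF a(2) b(2)] by auto
  have "\<forall>T. T \<subseteq> V \<longrightarrow> (\<exists>\<alpha>. \<alpha> \<in> A \<and> (\<exists>\<beta>. \<beta> \<in> B \<and> (a T - b T) - bd V c T = \<alpha> + \<beta>))"
    using sum[OF c(2)] by blast
  then obtain \<alpha> where "\<forall>T. T \<subseteq> V \<longrightarrow> \<alpha> T \<in> A \<and> (\<exists>\<beta>. \<beta> \<in> B \<and> (a T - b T) - bd V c T = \<alpha> T + \<beta>)"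
    by metis
  then obtain \<beta> where \<alpha>: "\<And>T. T \<subseteq> V \<Longrightarrow> \<alpha> T \<in> A" and \<beta>: "\<And>T. T \<subseteq> V \<Longrightarrow> \<beta> T \<in> B"
    and eq: "\<And>T. T \<subseteq> V \<Longrightarrow> (a T - b T) - bd V c T = \<alpha> T + \<beta> T" by metis
  \<comment> \<open>The common lift: it agrees with \<open>a\<close> modulo \<open>A\<close> and with \<open>b\<close> modulo \<open>B\<close>, up to a boundary.\<close>
  define w where "w = (\<lambda>T. a T - \<alpha> T - bd V c T)"
  have w2: "w T = b T + \<beta> T" if "T \<subseteq> V" for T
    using eq[OF that] by (simp add: w_def algebra_simps)
  have "z T - bd V w T \<in> A" if T: "T \<subseteq> V" for T
  proof -
    have "bd V w T = bd V a T - bd V \<alpha> T"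
      using bd_bd[OF V T, of c] by (simp add: w_def bd_diff)
    then have "z T - bd V w T = (z T - bd V a T) + bd V \<alpha> T" by simp
    also have "\<dots> \<in> A"
      by (rule graded_idealD(3)[OF A a(3)[OF T] bd_closed[OF A _ T]]) (rule \<alpha>)
    finally show ?thesis .
  qed
  moreover have "z T - bd V w T \<in> B" if T: "T \<subseteq> V" for T
  proof -
    have "bd V w T = bd V (\<lambda>T. b T + \<beta> T) T" by (rule bd_cong[OF _ T]) (rule w2)
    then have "z T - bd V w T = (z T - bd V b T) - bd V \<beta> T" by (simp add: bd_add)
    also have "\<dots> \<in> B"
      by (rule graded_idealD(7)[OF B b(3)[OF T] bd_closed[OF B _ T]]) (rule \<beta>)
    finally show ?thesis .
  qed
  moreover have "w T \<in> polys V" if "T \<subseteq> V" for T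
    using w2[OF that] b(1) \<beta>[OF that] graded_idealD(1)[OF B] by auto
  ultimately show "\<exists>w. (\<forall>T\<subseteq>V. w T \<in> polys V) \<and> (\<forall>T\<subseteq>V. z T - bd V w T \<in> A \<inter> B)"
    by blast
qed

text \<open>A cycle modulo \<open>I\<close> bounds modulo \<open>I + (x)\<close>, hence is homologous to \<open>x u\<close> for some chain \<open>u\<close>, which is a
cycle modulo \<open>I\<close> because \<open>x\<close> is a nonzerodivisor.  Multiples \<open>x u\<close> of cycles are boundaries.\<close>

lemma koszul_reg_lift:
  assumes V: "finite V" and I: "graded_ideal V I" and J: "graded_ideal V J" and x: "x \<in> V"
    and reg: "\<And>p. p \<in> polys V \<Longrightarrow> indet x * p \<in> I \<Longrightarrow> p \<in> I"
    and IJ: "I \<subseteq> J" and JI: "\<And>c. c \<in> J \<Longrightarrow> \<exists>p\<in>polys V. c - indet x * p \<in> I"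
    and kJ: "koszul_reg V J r"
  shows "koszul_reg V I r"
proof (rule koszul_regI[OF I])
  fix d z assume d: "r < d" and z: "\<And>T. z T \<in> polys V" "\<And>T. homogeneous d (z T)"
    and bz: "\<And>T. T \<subseteq> V \<Longrightarrow> bd V z T \<in> I"
  obtain w where w: "\<And>T. w T \<in> polys V" "\<And>T. T \<subseteq> V \<Longrightarrow> z T - bd V w T \<in> J"
    using koszul_regE[OF kJ d z subsetD[OF IJ bz]] by blast
  have "\<forall>T. T \<subseteq> V \<longrightarrow> (\<exists>p. p \<in> polys V \<and> z T - bd V w T - indet x * p \<in> I)"
    using JI[OF w(2)] by blast
  then obtain u where u: "\<And>T. T \<subseteq> V \<Longrightarrow> u T \<in> polys V" "\<And>T. T \<subseteq> V \<Longrightarrow> z T - bd V w T - indet x * u T \<in> I"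
    by metis
  have bu: "bd V u T \<in> I" if T: "T \<subseteq> V" for T
  proof (rule reg)
    show "bd V u T \<in> polys V" by (rule bd_polys[OF u(1) T])
    have "bd V (\<lambda>T. z T - bd V w T - indet x * u T) T \<in> I" by (rule bd_closed[OF I u(2) T])
    then have "bd V z T - indet x * bd V u T \<in> I"
      using bd_bd[OF V T, of w] by (simp add: bd_diff bd_mult)
    then have "bd V z T - (bd V z T - indet x * bd V u T) \<in> I"
      by (rule graded_idealD(7)[OF I bz[OF T]])
    then show "indet x * bd V u T \<in> I" by simp
  qed
  then have wd: "wedge x (bd V u) T \<in> I" if "T \<subseteq> V" for T
    using that graded_idealD(2)[OF I] by (auto simp: wedge_def intro!: ksign_closed[OF I] bu)
  define w' where "w' = (\<lambda>T. w T + wedge x u T)"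
  have "z T - bd V w' T \<in> I" if T: "T \<subseteq> V" for T
  proof -
    have "indet x * u T - bd V (wedge x u) T = wedge x (bd V u) T"
      using bd_wedge[OF V T x, of u] by (simp add: algebra_simps)
    moreover have "z T - bd V w' T = (z T - bd V w T - indet x * u T) + (indet x * u T - bd V (wedge x u) T)"
      by (simp add: w'_def bd_add)
    ultimately have "z T - bd V w' T = (z T - bd V w T - indet x * u T) + wedge x (bd V u) T" by simp
    then show ?thesis using graded_idealD(3)[OF I u(2)[OF T] wd[OF T]] by (simp only:)
  qed
  moreover have "w' T \<in> polys V" if "T \<subseteq> V" for T
  proof -
    have "T - {x} \<subseteq> V" using that by blast
    then show ?thesis using w(1) u(1) by (simp add: w'_def wedge_def)
  qed
  ultimately show "\<exists>w. (\<forall>T\<subseteq>V. w T \<in> polys V) \<and> (\<forall>T\<subseteq>V. z T - bd V w T \<in> I)" by blast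
qed

text \<open>The residue field is concentrated in degree zero.\<close>

lemma koszul_reg_maximal:
  assumes I: "graded_ideal V I" and m: "\<And>p. p \<in> polys V \<Longrightarrow> lookup p 0 = 0 \<Longrightarrow> p \<in> I"
  shows "koszul_reg V I 0"
proof (rule koszul_regI[OF I])
  fix d and z :: "var set \<Rightarrow> 'a xypoly"
  assume "0 < d" "\<And>T. z T \<in> polys V" "\<And>T. homogeneous d (z T)"
  then have "z T \<in> I" for T using m homogeneous_no_constant[of d "z T"] by auto
  then show "\<exists>w. (\<forall>T\<subseteq>V. w T \<in> polys V) \<and> (\<forall>T\<subseteq>V. z T - bd V w T \<in> I)"
    by (intro exI[of _ "\<lambda>_. 0"]) auto
qed

section \<open>Binomial edge ideals with additional variables\<close>

text \<open>Both \<open>edge_binom i j\<close> and its negative \<open>edge_binom j i\<close> belong to the edge \<open>{i, j}\<close>; keeping both spares an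
order on the vertices.\<close>

definition edge_binom :: "nat \<Rightarrow> nat \<Rightarrow> 'k::field xypoly" where
  "edge_binom i j = xvar i * yvar j - xvar j * yvar i"

definition edge_gens :: "var set \<Rightarrow> nat set set \<Rightarrow> 'k::field xypoly set" where
  "edge_gens W E = indet ` W \<union> {edge_binom i j | i j. {i, j} \<in> E}"

lemma single_factor:
  assumes "v \<in> keys m"
  shows "single m c = single (m - single v 1) c * indet v" "keys (m - single v 1) \<subseteq> keys (m :: monom)"
proof -
  have "m = (m - single v 1) + single v 1"
    by (rule poly_mapping_eqI)
       (use assms in \<open>auto simp: lookup_add lookup_minus lookup_single when_def in_keys_iff\<close>)
  then show "single m c = single (m - single v 1) c * indet v"
    by (simp add: indet_def mult_single)
qed (auto simp: in_keys_iff lookup_minus)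

abbreviation edge_ideal :: "var set \<Rightarrow> var set \<Rightarrow> nat set set \<Rightarrow> 'k::field xypoly set" where
  "edge_ideal V W E \<equiv> gen_ideal V (edge_gens W E)"

text \<open>The graph \<open>E\<close> lives on vertices whose two variables are in \<open>V\<close> and do not belong to the ideal of
variables generated by \<open>W\<close>.\<close>

definition admissible :: "var set \<Rightarrow> var set \<Rightarrow> nat set set \<Rightarrow> bool" where
  "admissible V W E \<longleftrightarrow> finite V \<and> W \<subseteq> V \<and> (\<forall>e\<in>E. card e = 2)
     \<and> (\<forall>e\<in>E. \<forall>i\<in>e. VarX i \<in> V - W \<and> VarY i \<in> V - W)"

lemma admissibleD:
  assumes "admissible V W E"
  shows "finite V" "W \<subseteq> V" "{i, j} \<in> E \<Longrightarrow> i \<noteq> j"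
    "{i, j} \<in> E \<Longrightarrow> VarX i \<in> V - W \<and> VarY i \<in> V - W \<and> VarX j \<in> V - W \<and> VarY j \<in> V - W"
  using assms unfolding admissible_def by force+

lemma edge_binom_single: "edge_binom i j = single (single (VarX i) 1 + single (VarY j) 1) 1
    - single (single (VarX j) 1 + single (VarY i) 1) 1"
  by (simp add: edge_binom_def xvar_def yvar_def mult_single)

lemma homogeneous_edge_binom: "homogeneous 2 (edge_binom i j)"
  unfolding edge_binom_single by (intro homogeneous_diff) (simp_all add: homogeneous_single)

lemma polys_edge_binom: "VarX i \<in> V \<Longrightarrow> VarY i \<in> V \<Longrightarrow> VarX j \<in> V \<Longrightarrow> VarY j \<in> V \<Longrightarrow> edge_binom i j \<in> polys V"
  by (simp add: edge_binom_def xvar_indet yvar_indet)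

lemma edge_gens_homogeneous: "g \<in> edge_gens W E \<Longrightarrow> \<exists>e. homogeneous e g"
  unfolding edge_gens_def using homogeneous_indet homogeneous_edge_binom by blast

lemma edge_gens_polys:
  assumes "W \<subseteq> V" "\<And>i j. {i, j} \<in> E \<Longrightarrow> VarX i \<in> V \<and> VarY i \<in> V"
  shows "edge_gens W E \<subseteq> polys V"
proof -
  have "edge_binom i j \<in> polys V" if "{i, j} \<in> E" for i j
    using assms(2)[of i j] assms(2)[of j i] that by (auto simp: insert_commute intro: polys_edge_binom)
  then show ?thesis using assms(1) unfolding edge_gens_def by auto
qed

lemma graded_ideal_edge_gens:
  assumes "admissible V W E" "W' \<subseteq> V" shows "graded_ideal V (edge_ideal V W' E)"
  by (intro graded_ideal_gen_ideal edge_gens_polys edge_gens_homogeneous) (use assms admissibleD(4)[OF assms(1)] in auto)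

lemma edge_gens_mono: "W \<subseteq> W' \<Longrightarrow> E \<subseteq> E' \<Longrightarrow> edge_gens W E \<subseteq> edge_gens W' E'"
  unfolding edge_gens_def by blast

subsection \<open>Disjoint unions of cliques: variables are nonzerodivisors\<close>

text \<open>Adjacency together with equality is an equivalence relation, that is, the graph is a disjoint union
of cliques.\<close>

definition cluster :: "nat set set \<Rightarrow> bool" where
  "cluster E \<longleftrightarrow> (\<forall>u v w. {u, v} \<in> E \<longrightarrow> {v, w} \<in> E \<longrightarrow> u \<noteq> w \<longrightarrow> {u, w} \<in> E)"

definition closed_nbh :: "nat set set \<Rightarrow> nat \<Rightarrow> nat set" where
  "closed_nbh E i = {j. j = i \<or> {i, j} \<in> E}"

text \<open>For a clique, the binomials generate the kernel of \<open>x\<^sub>i \<mapsto> s t\<^sub>i, y\<^sub>i \<mapsto> t\<^sub>i\<close>.  Two monomials have the same image under the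
product of these maps over all cliques iff, for each vertex, the total exponent of \<open>x\<^sub>i\<close> and \<open>y\<^sub>i\<close> agrees
and, for each clique, the total exponent of the variables \<open>x\<^sub>i\<close> agrees.  At an isolated vertex both
exponents agree.\<close>

definition congruent_mod :: "nat set set \<Rightarrow> monom \<Rightarrow> monom \<Rightarrow> bool" where
  "congruent_mod E m m' \<longleftrightarrow>
     (\<forall>i. lookup m (VarX i) + lookup m (VarY i) = lookup m' (VarX i) + lookup m' (VarY i)) \<and>
     (\<forall>i. (\<Sum>j\<in>closed_nbh E i. lookup m (VarX j)) = (\<Sum>j\<in>closed_nbh E i. lookup m' (VarX j)))"

lemma congruent_mod_trans: "congruent_mod E m m' \<Longrightarrow> congruent_mod E m' k \<longleftrightarrow> congruent_mod E m k"
  by (auto simp: congruent_mod_def)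

lemma congruent_mod_refl: "congruent_mod E m m"
  by (auto simp: congruent_mod_def)

lemma congruent_mod_shift: "congruent_mod E (u + m) (u + m') \<longleftrightarrow> congruent_mod E m m'"
  by (auto simp: congruent_mod_def lookup_add sum.distrib)

lemma finite_vertices: "finite V \<Longrightarrow> finite (VarX -` V)"
  by (rule finite_vimageI) (auto simp: inj_def)

lemma finite_closed_nbh:
  assumes "admissible V W E" shows "finite (closed_nbh E i)"
proof -
  have "closed_nbh E i \<subseteq> insert i (VarX -` V)" using admissibleD(4)[OF assms] by (auto simp: closed_nbh_def)
  moreover have "finite (VarX -` V)" using admissibleD(1)[OF assms] by (rule finite_vertices)
  ultimately show ?thesis using finite_subset by blast
qed

lemma congruent_mod_swap:
  assumes "admissible V W E" "cluster E" "{i, j} \<in> E"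
  shows "congruent_mod E (single (VarX i) 1 + single (VarY j) 1) (single (VarX j) 1 + single (VarY i) 1)"
proof -
  have "b \<in> closed_nbh E l" if "a \<in> closed_nbh E l" "{a, b} \<in> E" for a b l
    using assms(2) that unfolding cluster_def closed_nbh_def by blast
  then have "i \<in> closed_nbh E l \<longleftrightarrow> j \<in> closed_nbh E l" for l
    using assms(3) by (metis insert_commute)
  then have "(\<Sum>k\<in>closed_nbh E l. if i = k then Suc 0 else 0) = (\<Sum>k\<in>closed_nbh E l. if j = k then Suc 0 else 0)" for l
    using finite_closed_nbh[OF assms(1)] by (simp add: sum.delta sum.delta')
  then show ?thesis
    by (auto simp: congruent_mod_def lookup_add lookup_single when_def)
qed

definition avoids :: "var set \<Rightarrow> monom \<Rightarrow> bool" where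
  "avoids W m \<longleftrightarrow> (\<forall>w\<in>W. lookup m w = 0)"

text \<open>The two monomials of an edge binomial are congruent, and congruence is preserved by multiplication, so
each multiple of a binomial contributes one coefficient with both signs to a single class.\<close>

lemma coeff_sum_edge_gens_zero:
  assumes adm: "admissible V W E" and cl: "cluster E" and f: "f \<in> edge_ideal V W E"
  shows "coeff_sum (\<lambda>m. congruent_mod E m m0 \<and> avoids W m) f = 0"
  using f
proof (induction rule: gen_ideal.induct)
  case (gen_ideal_step p g q)
  let ?Q = "\<lambda>m. congruent_mod E m m0 \<and> avoids W m"
  have "coeff_sum ?Q (p * g) = 0"
  proof (induction p rule: poly_additive_induct)
    case (single m c)
    have eq: "coeff_sum ?Q (single m c * g) = c * coeff_sum (\<lambda>k. ?Q (m + k)) g"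
      by (rule coeff_sum_single_mult) simp
    from \<open>g \<in> edge_gens W E\<close> consider w where "w \<in> W" "g = indet w" | i j where "{i, j} \<in> E" "g = edge_binom i j"
      unfolding edge_gens_def by blast
    then show ?case
    proof cases
      case 1
      then have "\<not> avoids W (m + single w 1)" by (auto simp: avoids_def lookup_add intro!: bexI[of _ w])
      then show ?thesis unfolding eq using 1 by (simp add: indet_def)
    next
      case 2
      let ?a = "single (VarX i) 1 + single (VarY j) (1::nat)" and ?b = "single (VarX j) 1 + single (VarY i) (1::nat)"
      have "congruent_mod E (m + ?a) m0 \<longleftrightarrow> congruent_mod E (m + ?b) m0"
        using congruent_mod_trans[of E "m + ?a" "m + ?b" m0] congruent_mod_swap[OF adm cl 2(1)]
        by (simp only: congruent_mod_shift)
      moreover have "avoids W (m + ?a) \<longleftrightarrow> avoids W (m + ?b)"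
        using admissibleD(4)[OF adm 2(1)] by (auto simp: avoids_def lookup_add lookup_single when_def)
      ultimately show ?thesis unfolding eq using 2 by (simp add: edge_binom_single coeff_sum_diff)
    qed
  qed (auto simp: coeff_sum_add algebra_simps)
  then show ?case using gen_ideal_step by (simp add: coeff_sum_add)
qed simp

text \<open>While \<open>m\<close> and \<open>m'\<close> differ, some clique contains a vertex \<open>i\<close> where \<open>m\<close> has a larger \<open>x\<close>-exponent than
\<open>m'\<close> and a vertex \<open>j\<close> where it has a smaller one.  Then \<open>x\<^sub>i y\<^sub>j\<close> divides \<open>m\<close> and can be replaced
by \<open>x\<^sub>j y\<^sub>i\<close>, at the cost of a multiple of an edge binomial.\<close>

lemma congruent_imp_diff_mem:
  assumes adm: "admissible V W E" and cl: "cluster E"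
    and "congruent_mod E m m'" "keys m \<subseteq> V" "keys m' \<subseteq> V"
  shows "single m c - single m' c \<in> edge_ideal V W E"
proof -
  define J where "J = VarX -` V"
  have finJ: "finite J" unfolding J_def
    using admissibleD(1)[OF adm] by (rule finite_vertices)
  show ?thesis using assms(3,4)
  proof (induction "\<Sum>j\<in>J. lookup m (VarX j) - lookup m' (VarX j)" arbitrary: m rule: less_induct)
    case less
    have cong: "(\<Sum>j\<in>closed_nbh E i. lookup m (VarX j)) = (\<Sum>j\<in>closed_nbh E i. lookup m' (VarX j))"
      "lookup m (VarX i) + lookup m (VarY i) = lookup m' (VarX i) + lookup m' (VarY i)" for i
      using less.prems by (auto simp: congruent_mod_def)
    show ?case
    proof (cases "\<forall>i. lookup m (VarX i) \<le> lookup m' (VarX i)")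
      case True
      have x: "lookup m (VarX i) = lookup m' (VarX i)" for i
        by (rule sum_mono_inv[OF cong(1)[of i]]) (use True finite_closed_nbh[OF adm] in \<open>auto simp: closed_nbh_def\<close>)
      have "m = m'"
      proof (rule poly_mapping_eqI)
        fix v show "lookup m v = lookup m' v"
          using x cong(2) by (cases v) (simp, metis add_left_cancel)
      qed
      then show ?thesis by (simp add: gen_ideal_0)
    next
      case False
      then obtain i where i: "lookup m (VarX i) > lookup m' (VarX i)" using not_le by blast
      have "\<exists>j\<in>closed_nbh E i. lookup m (VarX j) < lookup m' (VarX j)"
      proof (rule ccontr)
        assume "\<not> ?thesis"
        then have "lookup m' (VarX i) = lookup m (VarX i)"
          by (intro sum_mono_inv[OF cong(1)[of i, symmetric]]) (use finite_closed_nbh[OF adm] in \<open>auto simp: closed_nbh_def not_less\<close>)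
        then show False using i by simp
      qed
      then obtain j where j: "j \<in> closed_nbh E i" "lookup m (VarX j) < lookup m' (VarX j)" by blast
      then have ij: "{i, j} \<in> E" "i \<noteq> j" using i by (auto simp: closed_nbh_def)
      have V: "VarX i \<in> V" "VarY i \<in> V" "VarX j \<in> V" "VarY j \<in> V"
        using admissibleD(4)[OF adm ij(1)] by auto
      have yj: "lookup m (VarY j) > 0" using cong(2)[of j] j by linarith
      define m0 where "m0 = m - (single (VarX i) 1 + single (VarY j) 1)"
      define a where "a = single (VarX i) 1 + single (VarY j) (1::nat)"
      define b where "b = single (VarX j) 1 + single (VarY i) (1::nat)"
      have m: "m = m0 + a"
        by (rule poly_mapping_eqI)
           (use i yj in \<open>auto simp: m0_def a_def lookup_add lookup_minus lookup_single when_def\<close>)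
      have m0V: "keys m0 \<subseteq> V"
        using less.prems(2) by (auto simp: m0_def in_keys_iff lookup_minus)
      have cong1: "congruent_mod E (m0 + b) m'"
        using congruent_mod_trans[of E m "m0 + b" m'] congruent_mod_swap[OF adm cl ij(1)] less.prems(1)
        unfolding m a_def[symmetric] b_def[symmetric] by (simp only: congruent_mod_shift)
      have keys1: "keys (m0 + b) \<subseteq> V"
        using keys_add[of m0 b] m0V keys_add[of "single (VarX j) 1" "single (VarY i) (1::nat)"] V
        by (auto simp: b_def split: if_splits)
      have lookup_b: "lookup (m0 + b) (VarX k)
          = (if k = i then lookup m (VarX i) - 1 else if k = j then lookup m (VarX j) + 1 else lookup m (VarX k))" for k
        using ij(2) by (auto simp: m a_def b_def lookup_add lookup_single when_def)
      have "(\<Sum>k\<in>J. lookup (m0 + b) (VarX k) - lookup m' (VarX k)) < (\<Sum>k\<in>J. lookup m (VarX k) - lookup m' (VarX k))"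
      proof (rule sum_strict_mono_ex1[OF finJ])
        show "\<forall>k\<in>J. lookup (m0 + b) (VarX k) - lookup m' (VarX k) \<le> lookup m (VarX k) - lookup m' (VarX k)"
          unfolding lookup_b using j(2) by auto
        show "\<exists>k\<in>J. lookup (m0 + b) (VarX k) - lookup m' (VarX k) < lookup m (VarX k) - lookup m' (VarX k)"
          unfolding lookup_b using i V by (intro bexI[of _ i]) (auto simp: J_def)
      qed
      then have "single (m0 + b) c - single m' c \<in> edge_ideal V W E"
        by (rule less.hyps) (fact cong1 keys1)+
      moreover have "single m c - single (m0 + b) c = single m0 c * edge_binom i j"
        by (simp add: m edge_binom_single a_def b_def algebra_simps mult_single)
      moreover have "single m0 c * edge_binom i j \<in> edge_ideal V W E"
        by (rule gen_ideal_mult_gen) (use m0V ij in \<open>auto simp: edge_gens_def\<close>)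
      moreover have "single m c - single m' c
          = (single m c - single (m0 + b) c) + (single (m0 + b) c - single m' c)" by simp
      ultimately show ?thesis using gen_ideal_add by metis
    qed
  qed
qed

text \<open>Cancel one monomial of \<open>f\<close> after the other: either it contains a variable from \<open>W\<close>, or, its class sum
being zero, \<open>f\<close> has a further monomial in the same class to which its coefficient can be moved.\<close>

lemma coeff_sum_zero_imp_mem:
  assumes adm: "admissible V W E" and cl: "cluster E" and f: "f \<in> polys V"
    and "\<And>m0. coeff_sum (\<lambda>m. congruent_mod E m m0 \<and> avoids W m) f = 0"
  shows "f \<in> edge_ideal V W E"
  using f assms(4)
proof (induction "card (keys f)" arbitrary: f rule: less_induct)
  case less
  show ?case
  proof (cases "f = 0")
    case False
    then obtain m where m: "m \<in> keys f" by (meson all_not_in_conv keys_eq_empty)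
    define c where "c = lookup f m"
    have mV: "keys m \<subseteq> V" using less.prems(1) m by (auto simp: polys_def)
    have "\<exists>l. l \<in> edge_ideal V W E \<and> keys (f - l) \<subseteq> keys f - {m} \<and> l \<in> polys V"
    proof (cases "avoids W m")
      case False
      then obtain w where w: "w \<in> W" "lookup m w > 0" by (auto simp: avoids_def)
      then have w': "w \<in> keys m" by (simp add: in_keys_iff)
      have "single (m - single w 1) c * indet w \<in> edge_ideal V W E"
        by (rule gen_ideal_mult_gen) (use single_factor(2)[OF w'] mV w in \<open>auto simp: edge_gens_def\<close>)
      then have "single m c \<in> edge_ideal V W E" by (simp only: single_factor(1)[OF w', symmetric])
      moreover have "keys (f - single m c) \<subseteq> keys f - {m}"
        by (auto simp: in_keys_iff lookup_minus c_def lookup_single when_def split: if_splits)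
      ultimately show ?thesis using mV by (intro exI[of _ "single m c"]) simp
    next
      case True
      have "\<exists>m'\<in>keys f. m' \<noteq> m \<and> congruent_mod E m' m"
      proof (rule ccontr)
        assume "\<not> ?thesis"
        then have "coeff_sum (\<lambda>k. congruent_mod E k m \<and> avoids W k) f = (\<Sum>k\<in>keys f. if k = m then c else 0)"
          unfolding coeff_sum_def using True by (intro sum.cong) (auto simp: c_def congruent_mod_refl)
        also have "\<dots> = c" using m by simp
        finally show False using less.prems(2)[of m] m by (simp add: c_def in_keys_iff)
      qed
      then obtain m' where m': "m' \<in> keys f" "m' \<noteq> m" "congruent_mod E m' m" by blast
      have m'V: "keys m' \<subseteq> V" using less.prems(1) m' by (auto simp: polys_def)
      have "congruent_mod E m m'" using m'(3) by (auto simp: congruent_mod_def)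
      then have "single m c - single m' c \<in> edge_ideal V W E"
        by (rule congruent_imp_diff_mem[OF adm cl _ mV m'V])
      moreover have "keys (f - (single m c - single m' c)) \<subseteq> keys f - {m}"
        using m' by (auto simp: in_keys_iff lookup_minus c_def lookup_single when_def split: if_splits)
      ultimately show ?thesis using mV m'V by (intro exI[of _ "single m c - single m' c"]) simp
    qed
    then obtain l where l: "l \<in> edge_ideal V W E" "keys (f - l) \<subseteq> keys f - {m}" "l \<in> polys V" by blast
    have "f - l \<in> edge_ideal V W E"
    proof (rule less.hyps)
      show "card (keys (f - l)) < card (keys f)"
        by (rule psubset_card_mono) (use l(2) m in auto)
      show "coeff_sum (\<lambda>m. congruent_mod E m m0 \<and> avoids W m) (f - l) = 0" for m0
        using less.prems(2) coeff_sum_edge_gens_zero[OF adm cl l(1)] by (simp add: coeff_sum_diff)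
    qed (use l less.prems in auto)
    from gen_ideal_add[OF this l(1)] show ?thesis by simp
  qed (simp add: gen_ideal_0)
qed

text \<open>Multiplication by a variable is injective on congruence classes and does not mix them, so the class
sums of \<open>f\<close> are among those of \<open>u f\<close>.\<close>

lemma cluster_variable_regular:
  assumes adm: "admissible V W E" and cl: "cluster E" and f: "f \<in> polys V"
    and u: "u \<notin> W" and uf: "indet u * f \<in> edge_ideal V W E"
  shows "f \<in> edge_ideal V W E"
proof (rule coeff_sum_zero_imp_mem[OF adm cl f])
  fix m0
  have "coeff_sum (\<lambda>m. congruent_mod E m (single u 1 + m0) \<and> avoids W m) (indet u * f)
      = 1 * coeff_sum (\<lambda>m. congruent_mod E m m0 \<and> avoids W m) f"
    unfolding indet_def
  proof (rule coeff_sum_single_mult)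
    fix m'
    have "avoids W (single u 1 + m') \<longleftrightarrow> avoids W m'"
      using u by (auto simp: avoids_def lookup_add lookup_single when_def)
    then show "(congruent_mod E (single u 1 + m') (single u 1 + m0) \<and> avoids W (single u 1 + m'))
        \<longleftrightarrow> (congruent_mod E m' m0 \<and> avoids W m')"
      by (simp add: congruent_mod_shift)
  qed
  then show "coeff_sum (\<lambda>m. congruent_mod E m m0 \<and> avoids W m) f = 0"
    using coeff_sum_edge_gens_zero[OF adm cl uf] by simp
qed

section \<open>Clique disjoint edge sets\<close>

text \<open>Removing the vertices \<open>S\<close> from the graph; they remain as isolated vertices.\<close>

definition edges_off :: "nat set \<Rightarrow> nat set set \<Rightarrow> nat set set" where
  "edges_off S E = {e\<in>E. e \<inter> S = {}}"

definition complete_at :: "nat set set \<Rightarrow> nat \<Rightarrow> nat set set" where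
  "complete_at E v = E \<union> {{u, w} | u w. {v, u} \<in> E \<and> {v, w} \<in> E \<and> u \<noteq> w}"

text \<open>The vertices that lie in more than one maximal clique.\<close>

definition nonfree :: "nat set set \<Rightarrow> nat set" where
  "nonfree E = {v. \<exists>u w. {u, v} \<in> E \<and> {v, w} \<in> E \<and> u \<noteq> w \<and> {u, w} \<notin> E}"

lemma cluster_iff_nonfree: "cluster E \<longleftrightarrow> nonfree E = {}"
  unfolding cluster_def nonfree_def by blast

lemma edges_off_edge: "{i, j} \<in> edges_off S E \<longleftrightarrow> {i, j} \<in> E \<and> i \<notin> S \<and> j \<notin> S"
  unfolding edges_off_def by auto

lemma complete_at_edge:
  "{i, j} \<in> complete_at E v \<longleftrightarrow> {i, j} \<in> E \<or> ({v, i} \<in> E \<and> {v, j} \<in> E \<and> i \<noteq> j)"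
  unfolding complete_at_def by (auto simp: doubleton_eq_iff)

lemma cluster_edges_off: "cluster E \<Longrightarrow> cluster (edges_off S E)"
  unfolding cluster_def edges_off_edge by blast

lemma nonfree_edges_off: "nonfree (edges_off S E) \<subseteq> nonfree E - S"
  unfolding nonfree_def edges_off_edge by blast

text \<open>Completing the neighbourhood of \<open>v\<close> makes \<open>v\<close> free, and a neighbour \<open>x\<close> of \<open>v\<close> that was free had all
its neighbours in the closed neighbourhood of \<open>v\<close>, which is now a clique.\<close>

lemma nonfree_complete_at:
  "nonfree (complete_at E v) \<subseteq> nonfree E - {v}"
proof
  fix x assume "x \<in> nonfree (complete_at E v)"
  then obtain a b where ab: "{a, x} \<in> complete_at E v" "{x, b} \<in> complete_at E v" "a \<noteq> b"
    "{a, b} \<notin> complete_at E v" unfolding nonfree_def by blast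
  have 1: "x \<noteq> v"
  proof
    assume "x = v"
    then have "{v, a} \<in> E" "{v, b} \<in> E" using ab(1,2) unfolding complete_at_edge by (auto simp: insert_commute)
    then show False using ab(3,4) unfolding complete_at_edge by auto
  qed
  have "x \<in> nonfree E"
  proof (rule ccontr)
    assume "x \<notin> nonfree E"
    then have f: "{p, x} \<in> E \<Longrightarrow> {x, q} \<in> E \<Longrightarrow> p \<noteq> q \<Longrightarrow> {p, q} \<in> E" for p q
      unfolding nonfree_def by blast
    have f': "{v, x} \<in> E \<Longrightarrow> {x, q} \<in> E \<Longrightarrow> v \<noteq> q \<Longrightarrow> {v, q} \<in> E" for q using f[of v q] .
    show False using ab(1,2,3,4) f[of a b] f'[of a] f'[of b] unfolding complete_at_edge
      by (metis insert_commute)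
  qed
  then show "x \<in> nonfree E - {v}" using 1 by blast
qed

lemma eta_ge:
  assumes "finite E" "clique_disjoint_edge_set U E H" shows "card H \<le> eta U E"
proof -
  have "{card H | H. clique_disjoint_edge_set U E H} \<subseteq> card ` Pow E"
    unfolding clique_disjoint_edge_set_def by auto
  then have "finite {card H | H. clique_disjoint_edge_set U E H}"
    using assms(1) finite_subset by blast
  then show ?thesis unfolding eta_def using assms(2) by (intro Max_ge) auto
qed

lemma eta_attained:
  assumes "finite E" shows "\<exists>H. clique_disjoint_edge_set U E H \<and> card H = eta U E"
proof -
  have sub: "{card H | H. clique_disjoint_edge_set U E H} \<subseteq> card ` Pow E"
    unfolding clique_disjoint_edge_set_def by auto
  have "clique_disjoint_edge_set U E {}" by (simp add: clique_disjoint_edge_set_def)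
  then have "{card H | H. clique_disjoint_edge_set U E H} \<noteq> {}" by blast
  moreover have "finite {card H | H. clique_disjoint_edge_set U E H}"
    using sub assms finite_subset by blast
  ultimately have "eta U E \<in> {card H | H. clique_disjoint_edge_set U E H}"
    unfolding eta_def by (intro Max_in)
  then show ?thesis by auto
qed

text \<open>A clique containing two edges that avoid \<open>S\<close> still contains them after the vertices in \<open>S\<close> are removed
from it.\<close>

lemma clique_disjoint_edges_off:
  assumes "clique_disjoint_edge_set U (edges_off S E) H" shows "clique_disjoint_edge_set U E H"
proof -
  have False if e: "e \<in> H" "e' \<in> H" "e \<noteq> e'" and C: "is_clique U E C" "e \<union> e' \<subseteq> C" for e e' C
  proof -
    have "H \<subseteq> edges_off S E" using assms by (simp add: clique_disjoint_edge_set_def)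
    then have "e \<union> e' \<subseteq> C - S" using e C(2) by (auto simp: edges_off_def)
    moreover have "is_clique U (edges_off S E) (C - S)"
      using C(1) unfolding is_clique_def edges_off_edge by blast
    ultimately show False using assms e unfolding clique_disjoint_edge_set_def by blast
  qed
  moreover have "H \<subseteq> E" using assms by (auto simp: clique_disjoint_edge_set_def edges_off_def)
  ultimately show ?thesis unfolding clique_disjoint_edge_set_def by blast
qed

lemma eta_edges_off: 
  assumes "finite E" shows "eta U (edges_off S E) \<le> eta U E"
proof -
  have "finite (edges_off S E)" using assms by (simp add: edges_off_def)
  then show ?thesis using eta_attained[of "edges_off S E" U] clique_disjoint_edges_off eta_ge[OF assms] by metis
qed

text \<open>The edge \<open>{v, i}\<close> can be added, since a clique containing it lies in the closed neighbourhood of \<open>v\<close>.\<close>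

lemma eta_edges_off_closed_nbh:
  assumes fin: "finite E" and two: "\<And>e. e \<in> E \<Longrightarrow> card e = 2" and vi: "{v, i} \<in> E"
  shows "eta U (edges_off (closed_nbh E v) E) + 1 \<le> eta U E"
proof -
  have finO: "finite (edges_off (closed_nbh E v) E)" using fin by (simp add: edges_off_def)
  then obtain H where H: "clique_disjoint_edge_set U (edges_off (closed_nbh E v) E) H" "card H = eta U (edges_off (closed_nbh E v) E)"
    using eta_attained by blast
  have Hoff: "H \<subseteq> edges_off (closed_nbh E v) E" using H(1) by (simp add: clique_disjoint_edge_set_def)
  have new: "{v, i} \<notin> H" using Hoff by (auto simp: edges_off_def closed_nbh_def)
  have key: False if "e \<in> H" "is_clique U E C" "e \<subseteq> C" "v \<in> C" for e C
  proof -
    have "e \<in> E" "e \<inter> closed_nbh E v = {}" using that(1) Hoff by (auto simp: edges_off_def)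
    moreover from this obtain a where "a \<in> e" using two[of e] by fastforce
    ultimately have "a \<noteq> v" "{v, a} \<notin> E" "a \<in> C" using that by (auto simp: closed_nbh_def)
    then show False using that unfolding is_clique_def by metis
  qed
  have "clique_disjoint_edge_set U E (insert {v, i} H)"
    using clique_disjoint_edges_off[OF H(1)] vi key unfolding clique_disjoint_edge_set_def
    by (metis Un_subset_iff insertE insert_subset)
  moreover have "finite H" using Hoff finO finite_subset by blast
  ultimately show ?thesis using eta_ge[OF fin] H(2) new by fastforce
qed

text \<open>In the graph completed at \<open>v\<close>, the closed neighbourhood of \<open>v\<close> is a clique, so a clique disjoint
  edge set has at most one edge inside it.  That edge can be traded for two edges of \<open>E\<close> from \<open>v\<close> to
  nonadjacent neighbours.\<close>

lemma eta_complete_at: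
  assumes fin: "finite E" and two: "\<And>e. e \<in> E \<Longrightarrow> card e = 2 \<and> e \<subseteq> U" and v: "v \<in> nonfree E"
  shows "eta U (complete_at E v) + 1 \<le> eta U E"
proof -
  define N where "N = {u. {v, u} \<in> E}"
  have NU: "insert v N \<subseteq> U" using two v by (auto simp: N_def nonfree_def)
  have finN: "finite N"
  proof -
    have "N \<subseteq> \<Union>E" by (auto simp: N_def)
    moreover have "finite e" if "e \<in> E" for e using two[OF that] by (metis card.infinite zero_neq_numeral)
    then have "finite (\<Union>E)" using fin by (intro finite_Union)
    ultimately show ?thesis using finite_subset by blast
  qed
  have "complete_at E v \<subseteq> E \<union> Pow N" by (auto simp: complete_at_def N_def)
  then have finC: "finite (complete_at E v)" using fin finN finite_subset by blast
  obtain H where H: "clique_disjoint_edge_set U (complete_at E v) H" "card H = eta U (complete_at E v)"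
    using eta_attained[OF finC] by blast
  have HC: "H \<subseteq> complete_at E v" and finH: "finite H"
    using H(1) finC finite_subset by (auto simp: clique_disjoint_edge_set_def)
  \<comment> \<open>The edges that also belong to \<open>E\<close> and do not contain \<open>v\<close>.\<close>
  define R where "R = {e\<in>H. \<not> e \<subseteq> insert v N}"
  have K: "is_clique U (complete_at E v) (insert v N)"
    using NU unfolding is_clique_def complete_at_edge by (auto simp: N_def insert_commute)
  have "card (H - R) \<le> 1"
  proof (rule ccontr)
    assume "\<not> ?thesis"
    then obtain e e' where "e \<in> H - R" "e' \<in> H - R" "e \<noteq> e'"
      by (metis card_le_Suc0_iff_eq finH finite_Diff One_nat_def)
    moreover from this have "e \<union> e' \<subseteq> insert v N" unfolding R_def by blast
    ultimately show False using H(1) K unfolding clique_disjoint_edge_set_def by blast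
  qed
  moreover have "card H = card R + card (H - R)"
    using card_Diff_subset[of R H] card_mono[of H R] finH finite_subset[of R H] by (auto simp: R_def)
  ultimately have cR: "card H \<le> card R + 1" by simp
  have RE: "R \<subseteq> E"
    using HC by (auto simp: R_def complete_at_def N_def)
  obtain u w where uw: "{v, u} \<in> E" "{v, w} \<in> E" "u \<noteq> w" "{u, w} \<notin> E"
  proof -
    obtain u w where "{u, v} \<in> E" "{v, w} \<in> E" "u \<noteq> w" "{u, w} \<notin> E"
      using v unfolding nonfree_def by blast
    then show ?thesis using that[of u w] insert_commute[of u v "{}"] by metis
  qed
  define H' where "H' = R \<union> {{v, u}, {v, w}}"
  have cl: "is_clique U (complete_at E v) C" if "is_clique U E C" for C
    using that unfolding is_clique_def complete_at_edge by blast
  have key: False if "e \<in> R" "is_clique U E C" "e \<subseteq> C" "v \<in> C" for e C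
  proof -
    have "e \<subseteq> insert v N" using that unfolding is_clique_def N_def by auto
    then show False using that by (simp add: R_def)
  qed
  have kR: False if "e \<in> R" "e' \<in> R" "e \<noteq> e'" "is_clique U E C" "e \<union> e' \<subseteq> C" for e e' C
    using that H(1) cl[of C] unfolding clique_disjoint_edge_set_def R_def by blast
  have kuw: False if "is_clique U E C" "{v, u} \<union> {v, w} \<subseteq> C" for C
    using that uw unfolding is_clique_def by auto
  have "clique_disjoint_edge_set U E H'"
    unfolding clique_disjoint_edge_set_def
  proof (intro conjI notI)
    show "H' \<subseteq> E" using RE uw by (auto simp: H'_def)
    assume "\<exists>e\<in>H'. \<exists>e'\<in>H'. e \<noteq> e' \<and> (\<exists>C. is_clique U E C \<and> e \<union> e' \<subseteq> C)"
    then obtain e e' C where e: "e \<in> H'" "e' \<in> H'" "e \<noteq> e'" "is_clique U E C" "e \<union> e' \<subseteq> C" by blast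
    then have C: "e \<subseteq> C" "e' \<subseteq> C" by auto
    show False
    proof (cases "e \<in> R"; cases "e' \<in> R")
      assume "e \<in> R" "e' \<in> R" then show False using kR e by blast
    next
      assume "e \<in> R" "e' \<notin> R"
      then have "v \<in> C" using e(2) C by (auto simp: H'_def)
      then show False using key[OF \<open>e \<in> R\<close> e(4) C(1)] by blast
    next
      assume "e \<notin> R" "e' \<in> R"
      then have "v \<in> C" using e(1) C by (auto simp: H'_def)
      then show False using key[OF \<open>e' \<in> R\<close> e(4) C(2)] by blast
    next
      assume "e \<notin> R" "e' \<notin> R"
      then have "{v, u} \<union> {v, w} \<subseteq> C" using e(1,2,3) C by (auto simp: H'_def)
      then show False using kuw e(4) by blast
    qed
  qed
  then have "card H' \<le> eta U E" by (rule eta_ge[OF fin])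
  moreover have "card H' = card R + 2"
  proof -
    have "{v, u} \<notin> R" "{v, w} \<notin> R" using uw by (auto simp: R_def N_def)
    moreover have "{v, u} \<noteq> {v, w}" using uw by (auto simp: doubleton_eq_iff)
    moreover have "finite R" using RE fin finite_subset by blast
    ultimately show ?thesis by (simp add: H'_def)
  qed
  ultimately show ?thesis using cR H(2) by simp
qed

section \<open>The ideals of smaller graphs\<close>

lemma gen_ideal_insert:
  assumes "c \<in> gen_ideal V (insert g G)" shows "\<exists>p\<in>polys V. c - p * g \<in> gen_ideal V G"
  using assms
proof (induction rule: gen_ideal.induct)
  case gen_ideal_0
  then show ?case by (intro bexI[of _ 0]) (auto intro: gen_ideal.gen_ideal_0)
next
  case (gen_ideal_step p h q)
  then obtain r where r: "r \<in> polys V" "q - r * g \<in> gen_ideal V G" by blast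
  show ?case
  proof (cases "h = g")
    case True
    then show ?thesis using r gen_ideal_step(1) by (intro bexI[of _ "p + r"]) (auto simp: algebra_simps)
  next
    case False
    then have "p * h + (q - r * g) \<in> gen_ideal V G" using gen_ideal_step r by (intro gen_ideal.gen_ideal_step) auto
    then show ?thesis using r by (intro bexI[of _ r]) (auto simp: algebra_simps)
  qed
qed

lemma edge_gens_insert: "edge_gens (insert x W) E = insert (indet x) (edge_gens W E)"
  by (auto simp: edge_gens_def)

lemma gen_ideal_mult_into:
  assumes "\<And>g. g \<in> G \<Longrightarrow> x * g \<in> gen_ideal V G'" "q \<in> gen_ideal V G" shows "x * q \<in> gen_ideal V G'"
  using assms(2)
proof (induction rule: gen_ideal.induct)
  case (gen_ideal_step p g q)
  have "p * (x * g) + x * q \<in> gen_ideal V G'"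
    by (rule gen_ideal_add[OF gen_ideal_mult[OF assms(1)[OF gen_ideal_step(2)] gen_ideal_step(1)] gen_ideal_step(4)])
  then show ?case by (simp add: algebra_simps)
qed (simp add: gen_ideal_0)

lemma edge_binom_swap: "edge_binom i j = - edge_binom j i"
  by (simp add: edge_binom_def)

lemma indet_mem: "w \<in> W \<Longrightarrow> indet w \<in> edge_ideal V W E"
  by (rule gen_ideal_gen) (auto simp: edge_gens_def)

lemma edge_binom_mem: "{i, j} \<in> E \<Longrightarrow> edge_binom i j \<in> edge_ideal V W E"
  by (rule gen_ideal_gen) (auto simp: edge_gens_def)

lemma edge_binom_mem_XX:
  assumes "VarX i \<in> W" "VarX j \<in> W" "VarY i \<in> V" "VarY j \<in> V"
  shows "edge_binom i j \<in> edge_ideal V W E"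
proof -
  have "indet (VarY j) * indet (VarX i) - indet (VarY i) * indet (VarX j) \<in> edge_ideal V W E"
    by (intro gen_ideal_diff gen_ideal_mult indet_mem polys_indet assms)
  then show ?thesis by (simp add: edge_binom_def xvar_indet yvar_indet mult.commute)
qed

lemma edge_binom_mem_XY:
  assumes "VarX i \<in> W" "VarY i \<in> W" "VarX j \<in> V" "VarY j \<in> V"
  shows "edge_binom i j \<in> edge_ideal V W E"
proof -
  have "indet (VarY j) * indet (VarX i) - indet (VarX j) * indet (VarY i) \<in> edge_ideal V W E"
    by (intro gen_ideal_diff gen_ideal_mult indet_mem polys_indet assms)
  then show ?thesis by (simp add: edge_binom_def xvar_indet yvar_indet mult.commute)
qed

lemma admissible_edges_off:
  assumes "admissible V W E" "W' \<subseteq> V" "\<And>i. VarX i \<in> W' \<or> VarY i \<in> W' \<Longrightarrow> i \<in> S \<or> VarX i \<in> W \<or> VarY i \<in> W"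
  shows "admissible V W' (edges_off S E)"
  using assms unfolding admissible_def edges_off_def by blast

lemma admissible_complete_at:
  assumes "admissible V W E" shows "admissible V W (complete_at E v)"
proof -
  have "card e = 2 \<and> (\<forall>i\<in>e. VarX i \<in> V - W \<and> VarY i \<in> V - W)" if e: "e \<in> complete_at E v" for e
  proof (cases "e \<in> E")
    case True then show ?thesis using assms unfolding admissible_def by blast
  next
    case False
    then obtain u w where "e = {u, w}" "{v, u} \<in> E" "{v, w} \<in> E" "u \<noteq> w"
      using e unfolding complete_at_def by blast
    then show ?thesis using admissibleD(4)[OF assms] by auto
  qed
  then show ?thesis using assms unfolding admissible_def by blast
qed

lemma admissible_edge:
  assumes "admissible V W E" "e \<in> E" shows "\<exists>i j. e = {i, j} \<and> i \<noteq> j"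
proof -
  have "card e = 2" using assms unfolding admissible_def by blast
  then show ?thesis by (auto simp: card_2_iff)
qed

lemma edge_gens_cases:
  assumes "g \<in> edge_gens W E"
  obtains (indet) w where "w \<in> W" "g = indet w" | (edge_binom) i j where "{i, j} \<in> E" "g = edge_binom i j"
  using assms unfolding edge_gens_def by blast

text \<open>Once \<open>x\<^sub>v\<close> and \<open>y\<^sub>v\<close> are in the ideal, the binomials of the edges at \<open>v\<close> are redundant.\<close>

lemma gen_ideal_edges_off_vertex:
  assumes adm: "admissible V W E" and v: "VarX v \<in> W'" "VarY v \<in> W'"
  shows "edge_ideal V W' E \<subseteq> edge_ideal V W' (edges_off {v} E)"
proof (rule gen_ideal_least, rule subsetI)
  fix g :: "'a xypoly" assume "g \<in> edge_gens W' E"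
  then show "g \<in> edge_ideal V W' (edges_off {v} E)"
  proof (cases rule: edge_gens_cases)
    case (indet w) then show ?thesis by (auto intro: indet_mem)
  next
    case (edge_binom i j)
    have V: "VarX i \<in> V" "VarY i \<in> V" "VarX j \<in> V" "VarY j \<in> V" using admissibleD(4)[OF adm edge_binom(1)] by auto
    show ?thesis
    proof (cases "v = i \<or> v = j")
      case True
      then have "edge_binom i j \<in> edge_ideal V W' (edges_off {v} E) \<or> edge_binom j i \<in> edge_ideal V W' (edges_off {v} E)"
      proof
        assume "v = i"
        then show ?thesis using edge_binom_mem_XY[of i W' j V] V v by blast
      next
        assume "v = j"
        then show ?thesis using edge_binom_mem_XY[of j W' i V] V v by blast
      qed
      then show ?thesis using edge_binom(2) edge_binom_swap[of i j] gen_ideal_uminus by metis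
    next
      case False then show ?thesis using edge_binom by (auto intro!: edge_binom_mem simp: edges_off_edge)
    qed
  qed
qed

subsection \<open>Cliques\<close>

text \<open>Let \<open>N\<close> be the neighbourhood of \<open>v\<close>.  Modulo \<open>x\<^sub>v\<close> the binomials at \<open>v\<close> become the products \<open>x\<^sub>i y\<^sub>v\<close> with \<open>i \<in> N\<close>, so
either \<open>y\<^sub>v\<close> or all \<open>x\<^sub>i\<close> vanish; in the second case the other binomials of the clique
vanish as well.  For the nontrivial inclusion, an element of the first ideal is \<open>q y\<^sub>v\<close> modulo the left hand side; if
it is in the second ideal then so is \<open>q\<close>, because \<open>y\<^sub>v\<close> is a nonzerodivisor there, and \<open>y\<^sub>v\<close> multiplies
every generator of the second ideal into the left hand side.\<close>

lemma cluster_ideal_eq_Int: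
  assumes adm: "admissible V W E" and cl: "cluster E" and vi0: "{v, i0} \<in> E"
  defines "WB \<equiv> insert (VarX v) (W \<union> VarX ` {i. {v, i} \<in> E})"
  shows "edge_ideal V (insert (VarX v) W) E
    = edge_ideal V (insert (VarX v) (insert (VarY v) W)) (edges_off {v} E) \<inter> edge_ideal V WB (edges_off (closed_nbh E v) E)"
    (is "?T = ?A \<inter> ?B")
proof
  have nb: "b \<in> closed_nbh E v" if "a \<in> closed_nbh E v" "{a, b} \<in> E" for a b
    using cl that unfolding cluster_def closed_nbh_def by blast
  have X: "VarX a \<in> WB" "VarX a \<in> V" "VarY a \<in> V" if "a \<in> closed_nbh E v" for a
    using that admissibleD(4)[OF adm] vi0 unfolding closed_nbh_def WB_def by auto
  have vV: "VarX v \<in> V" "VarY v \<in> V" "VarX v \<notin> W" "VarY v \<notin> W" using admissibleD(4)[OF adm vi0] by auto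
  have TA: "?T \<subseteq> ?A"
  proof -
    have "?T \<subseteq> edge_ideal V (insert (VarX v) (insert (VarY v) W)) E"
      by (intro gen_ideal_mono edge_gens_mono) auto
    also have "\<dots> \<subseteq> ?A" by (rule gen_ideal_edges_off_vertex[OF adm]) auto
    finally show ?thesis .
  qed
  have TB: "?T \<subseteq> ?B"
  proof (rule gen_ideal_least, rule subsetI)
    fix g :: "'a xypoly" assume "g \<in> edge_gens (insert (VarX v) W) E"
    then show "g \<in> ?B"
    proof (cases rule: edge_gens_cases)
      case (indet w) then show ?thesis by (auto intro: indet_mem simp: WB_def)
    next
      case (edge_binom i j)
      show ?thesis
      proof (cases "i \<in> closed_nbh E v \<or> j \<in> closed_nbh E v")
        case True
        then have "i \<in> closed_nbh E v" "j \<in> closed_nbh E v" using nb edge_binom(1) by (metis insert_commute)+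
        then show ?thesis using edge_binom(2) X by (auto intro: edge_binom_mem_XX)
      next
        case False then show ?thesis using edge_binom by (auto intro!: edge_binom_mem simp: edges_off_edge)
      qed
    qed
  qed
  show "?T \<subseteq> ?A \<inter> ?B" using TA TB by blast
  show "?A \<inter> ?B \<subseteq> ?T"
  proof
    fix f assume f: "f \<in> ?A \<inter> ?B"
    then have "f \<in> gen_ideal V (insert (indet (VarY v)) (edge_gens (insert (VarX v) W) (edges_off {v} E)))"
      by (simp add: edge_gens_insert insert_commute)
    then obtain q where q: "q \<in> polys V" "f - q * indet (VarY v) \<in> edge_ideal V (insert (VarX v) W) (edges_off {v} E)"
      using gen_ideal_insert by blast
    moreover have "edge_ideal V (insert (VarX v) W) (edges_off {v} E) \<subseteq> ?T"
      by (intro gen_ideal_mono edge_gens_mono) (auto simp: edges_off_def)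
    ultimately have fq: "f - q * indet (VarY v) \<in> ?T" by blast
    then have "f - (f - q * indet (VarY v)) \<in> ?B" using f TB by (blast intro: gen_ideal_diff)
    then have yq: "indet (VarY v) * q \<in> ?B" by (simp add: mult.commute)
    have "q \<in> ?B"
    proof (rule cluster_variable_regular[OF _ _ q(1) _ yq])
      show "admissible V WB (edges_off (closed_nbh E v) E)"
      proof (rule admissible_edges_off[OF adm])
        show "WB \<subseteq> V" using X vV admissibleD(2,4)[OF adm] by (auto simp: WB_def)
      qed (auto simp: WB_def closed_nbh_def)
      show "VarY v \<notin> WB" using vV by (auto simp: WB_def)
    qed (rule cluster_edges_off[OF cl])
    then have "indet (VarY v) * q \<in> ?T"
    proof (rule gen_ideal_mult_into[rotated])
      fix g :: "'a xypoly" assume "g \<in> edge_gens WB (edges_off (closed_nbh E v) E)"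
      then show "indet (VarY v) * g \<in> ?T"
      proof (cases rule: edge_gens_cases)
        case (indet w)
        show ?thesis
        proof (cases "w \<in> insert (VarX v) W")
          case True then show ?thesis using indet vV by (auto intro!: gen_ideal_mult indet_mem)
        next
          case False
          then obtain i where i: "w = VarX i" "{v, i} \<in> E" using indet by (auto simp: WB_def)
          have iV: "VarY i \<in> V" using admissibleD(4)[OF adm i(2)] by auto
          have "indet (VarY i) * indet (VarX v) - edge_binom v i \<in> ?T"
            by (intro gen_ideal_diff gen_ideal_mult indet_mem edge_binom_mem polys_indet iV i) auto
          then show ?thesis using indet i by (simp add: edge_binom_def xvar_indet yvar_indet algebra_simps)
        qed
      next
        case (edge_binom i j)
        then show ?thesis using vV by (auto intro!: gen_ideal_mult edge_binom_mem simp: edges_off_edge)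
      qed
    qed
    then have "(f - q * indet (VarY v)) + indet (VarY v) * q \<in> ?T" using fq by (intro gen_ideal_add)
    then show "f \<in> ?T" by (simp add: algebra_simps)
  qed
qed

subsection \<open>Vertices with nonadjacent neighbours\<close>

definition free_of :: "nat \<Rightarrow> monom \<Rightarrow> bool" where
  "free_of v m \<longleftrightarrow> lookup m (VarX v) = 0 \<and> lookup m (VarY v) = 0"

lemma free_of_add [simp]: "free_of v (m + m') \<longleftrightarrow> free_of v m \<and> free_of v m'"
  by (auto simp: free_of_def lookup_add)

lemma mfilter_edge_binom_mult:
  assumes "i \<noteq> v" "j \<noteq> v" shows "mfilter (free_of v) (p * edge_binom i j) = mfilter (free_of v) p * edge_binom i j"
proof -
  have s: "mfilter (free_of v) (single (single (VarX a) 1 + single (VarY b) 1) 1 * p)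
      = single (single (VarX a) 1 + single (VarY b) 1) 1 * mfilter (free_of v) p" if "a \<noteq> v" "b \<noteq> v" for a b
    by (rule mfilter_single_mult) (use that in \<open>auto simp: free_of_def lookup_add lookup_single when_def\<close>)
  have e: "p * edge_binom i j = single (single (VarX i) 1 + single (VarY j) 1) 1 * p
    - single (single (VarX j) 1 + single (VarY i) 1) 1 * p" for p
    by (simp add: edge_binom_single algebra_simps)
  show ?thesis unfolding e using s[of i j] s[of j i] assms by simp
qed

text \<open>Setting \<open>x\<^sub>v = y\<^sub>v = 0\<close> maps the ideal \<open>(x\<^sub>v, y\<^sub>v) + J\<^bsub>G - v\<^esub>\<close> into \<open>J\<^bsub>G - v\<^esub>\<close>.\<close>

lemma mfilter_edges_off_mem:
  assumes "b \<in> edge_ideal V (insert (VarX v) (insert (VarY v) W)) (edges_off {v} E)"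
  shows "mfilter (free_of v) b \<in> edge_ideal V W E"
  using assms
proof (induction rule: gen_ideal.induct)
  case (gen_ideal_step p g q)
  from gen_ideal_step(2) have "mfilter (free_of v) (p * g) \<in> edge_ideal V W E"
  proof (cases rule: edge_gens_cases)
    case (indet w)
    show ?thesis
    proof (cases "w = VarX v \<or> w = VarY v")
      case True
      have "mfilter (free_of v) (single (single w 1) 1 * p) = single (single w 1) 1 * mfilter (\<lambda>_. False) p"
        by (rule mfilter_single_mult) (use True in \<open>auto simp: free_of_def lookup_add\<close>)
      moreover have "mfilter (\<lambda>_. False) p = 0" by (rule poly_mapping_eqI) (simp add: lookup_mfilter)
      ultimately have "mfilter (free_of v) (p * g) = 0" using indet by (simp add: indet_def mult.commute)
      then show ?thesis by (simp add: gen_ideal_0)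
    next
      case False
      have "mfilter (free_of v) (single (single w 1) 1 * p) = single (single w 1) 1 * mfilter (free_of v) p"
        by (rule mfilter_single_mult) (use False in \<open>auto simp: free_of_def lookup_add lookup_single when_def\<close>)
      then have "mfilter (free_of v) (p * g) = mfilter (free_of v) p * g"
        using indet by (simp add: indet_def mult.commute)
      then show ?thesis using indet False gen_ideal_step(1) by (auto intro!: gen_ideal_mult indet_mem)
    qed
  next
    case (edge_binom i j)
    then show ?thesis using gen_ideal_step(1) by (auto simp: edges_off_edge mfilter_edge_binom_mult intro!: gen_ideal_mult edge_binom_mem)
  qed
  then show ?case using gen_ideal_step by (auto intro: gen_ideal_add)
qed (simp add: gen_ideal_0)

text \<open>Every new generator of the ideal of the completed graph is multiplied into the ideal of the
  original graph by the two variables of the completed vertex.\<close>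

lemma indet_mult_new_edge_binom:
  assumes adm: "admissible V W E" and u: "{v, u} \<in> E" and w: "{v, w} \<in> E" and x: "x = VarX v \<or> x = VarY v"
  shows "indet x * edge_binom u w \<in> edge_ideal V W E"
proof -
  have V: "VarX u \<in> V" "VarY u \<in> V" "VarX w \<in> V" "VarY w \<in> V"
    using admissibleD(4)[OF adm u] admissibleD(4)[OF adm w] by auto
  have "indet (VarX u) * edge_binom v w - indet (VarX w) * edge_binom v u \<in> edge_ideal V W E"
    "indet (VarY u) * edge_binom v w - indet (VarY w) * edge_binom v u \<in> edge_ideal V W E"
    by (intro gen_ideal_diff gen_ideal_mult edge_binom_mem u w polys_indet V)+
  then show ?thesis using x by (auto simp: edge_binom_def xvar_indet yvar_indet algebra_simps)
qed

text \<open>Hence a combination of new binomials can be changed modulo \<open>J\<^sub>G\<close> into one whose coefficients are free of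
\<open>x\<^sub>v\<close> and \<open>y\<^sub>v\<close>.\<close>

lemma new_diff_mfilter_mem:
  assumes adm: "admissible V W E" and h: "h \<in> gen_ideal V {edge_binom u w | u w. {v, u} \<in> E \<and> {v, w} \<in> E}"
  shows "h - mfilter (free_of v) h \<in> edge_ideal V W E"
  using h
proof (induction rule: gen_ideal.induct)
  case (gen_ideal_step p g q)
  then obtain u w where uw: "{v, u} \<in> E" "{v, w} \<in> E" and g: "g = edge_binom u w" by blast
  have ne: "u \<noteq> v" "w \<noteq> v" using uw admissibleD(3)[OF adm] by auto
  have "(p - mfilter (free_of v) p) * g \<in> edge_ideal V W E"
  proof (induction p rule: poly_additive_induct)
    case (single m c)
    show ?case
    proof (cases "free_of v m")
      case False
      then obtain x where x: "x = VarX v \<or> x = VarY v" "x \<in> keys m" by (auto simp: free_of_def in_keys_iff)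
      have "keys m \<subseteq> V" using gen_ideal_step(1) single by (auto simp: polys_def)
      then have "single (m - single x 1) c * (indet x * edge_binom u w) \<in> edge_ideal V W E"
        using single_factor(2)[OF x(2)] by (intro gen_ideal_mult indet_mult_new_edge_binom[OF adm uw x(1)] polys_single) auto
      then have "(single (m - single x 1) c * indet x) * edge_binom u w \<in> edge_ideal V W E" by (simp only: mult.assoc)
      then have "single m c * edge_binom u w \<in> edge_ideal V W E" by (simp only: single_factor(1)[OF x(2), symmetric])
      then show ?thesis using False g by simp
    qed (simp add: gen_ideal_0)
  next
    case (add q r)
    then show ?case using gen_ideal_add[OF add] by (simp add: algebra_simps)
  qed (simp add: gen_ideal_0)
  then have "(p - mfilter (free_of v) p) * g + (q - mfilter (free_of v) q) \<in> edge_ideal V W E"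
    using gen_ideal_step by (intro gen_ideal_add)
  moreover have "mfilter (free_of v) (p * g) = mfilter (free_of v) p * g" unfolding g using ne by (intro mfilter_edge_binom_mult)
  ultimately show ?case by (simp add: algebra_simps)
qed (simp add: gen_ideal_0)

text \<open>Write an element of the intersection as \<open>g + h\<close> with \<open>g \<in> J\<^sub>G\<close> and \<open>h\<close> a combination of the binomials of
the new edges.  Modulo \<open>J\<^sub>G\<close> we may assume that \<open>h\<close> is free of \<open>x\<^sub>v\<close> and \<open>y\<^sub>v\<close>.  As \<open>h\<close> lies in
\<open>(x\<^sub>v, y\<^sub>v) + J\<^bsub>G - v\<^esub>\<close>, setting \<open>x\<^sub>v = y\<^sub>v = 0\<close> shows that \<open>h \<in> J\<^bsub>G - v\<^esub>\<close>, and this is part of \<open>J\<^sub>G\<close>.\<close>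

lemma ideal_eq_Int:
  assumes adm: "admissible V W E"
  shows "edge_ideal V W E = edge_ideal V W (complete_at E v)
    \<inter> edge_ideal V (insert (VarX v) (insert (VarY v) W)) (edges_off {v} E)" (is "?I = ?A \<inter> ?B")
proof
  have IB: "?I \<subseteq> ?B"
  proof -
    have "?I \<subseteq> edge_ideal V (insert (VarX v) (insert (VarY v) W)) E"
      by (intro gen_ideal_mono edge_gens_mono) auto
    also have "\<dots> \<subseteq> ?B" by (rule gen_ideal_edges_off_vertex[OF adm]) auto
    finally show ?thesis .
  qed
  moreover have "?I \<subseteq> ?A" by (intro gen_ideal_mono edge_gens_mono) (auto simp: complete_at_def)
  ultimately show "?I \<subseteq> ?A \<inter> ?B" by blast
  show "?A \<inter> ?B \<subseteq> ?I"
  proof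
    fix f assume f: "f \<in> ?A \<inter> ?B"
    let ?new = "{edge_binom u w | u w. {v, u} \<in> E \<and> {v, w} \<in> E}"
    have "edge_gens W (complete_at E v) \<subseteq> edge_gens W E \<union> ?new"
      unfolding edge_gens_def complete_at_edge by blast
    then have "?A \<subseteq> gen_ideal V (edge_gens W E \<union> ?new)" by (rule gen_ideal_mono)
    then obtain g h where gh: "g \<in> ?I" "h \<in> gen_ideal V ?new" "f = g + h" using f gen_ideal_Un by blast
    have "f - g \<in> ?B" using f gh IB by (intro gen_ideal_diff) auto
    then have "mfilter (free_of v) h \<in> ?I" using mfilter_edges_off_mem gh by simp
    then have "(h - mfilter (free_of v) h) + mfilter (free_of v) h \<in> ?I"
      using new_diff_mfilter_mem[OF adm gh(2)] by (intro gen_ideal_add)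
    then show "f \<in> ?I" using gh by (auto intro: gen_ideal_add)
  qed
qed

section \<open>Koszul regularity of binomial edge ideals\<close>

text \<open>Dividing out the remaining variables one at a time leads to the residue field.  For \<open>W = {}\<close> this is the
exactness of the Koszul complex of the polynomial ring.\<close>

lemma koszul_reg_variables:
  assumes "finite V" "W \<subseteq> V"
  shows "koszul_reg V (edge_ideal V W {}) 0"
  using assms(2)
proof (induction "card (V - W)" arbitrary: W rule: less_induct)
  case less
  have adm: "admissible V W {}" using assms(1) less.prems by (simp add: admissible_def)
  have I: "graded_ideal V (edge_ideal V W' {})" if "W' \<subseteq> V" for W'
    by (rule graded_ideal_edge_gens[OF adm that])
  show ?case
  proof (cases "W = V")
    case True
    show ?thesis
    proof (rule koszul_reg_maximal[OF I[OF less.prems]])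
      fix p :: "'a xypoly" assume p: "p \<in> polys V" "lookup p 0 = 0"
      show "p \<in> edge_ideal V W {}"
      proof (induction p rule: poly_additive_induct)
        case (single m c)
        then have "m \<noteq> 0" "keys m \<subseteq> V" using p by (auto simp: polys_def in_keys_iff)
        then obtain v where v: "v \<in> keys m" "v \<in> V" by (metis all_not_in_conv keys_eq_empty subsetD)
        have "single (m - single v 1) c * indet v \<in> edge_ideal V W {}"
          using v True \<open>keys m \<subseteq> V\<close> single_factor(2)[OF v(1)] by (intro gen_ideal_mult indet_mem polys_single) auto
        then show ?case by (simp only: single_factor(1)[OF v(1), symmetric])
      qed (auto intro: gen_ideal_0 gen_ideal_add)
    qed
  next
    case False
    then obtain x where x: "x \<in> V" "x \<notin> W" using less.prems by blast
    show ?thesis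
    proof (rule koszul_reg_lift[OF assms(1) I[OF less.prems] I[of "insert x W"] x(1)])
      show "koszul_reg V (gen_ideal V (edge_gens (insert x W) {} :: 'a xypoly set)) 0"
      proof (rule less.hyps)
        show "card (V - insert x W) < card (V - W)"
          by (rule psubset_card_mono) (use x assms(1) in auto)
      qed (use x less.prems in auto)
      show "gen_ideal V (edge_gens W {} :: 'a xypoly set) \<subseteq> edge_ideal V (insert x W) {}"
        by (intro gen_ideal_mono edge_gens_mono) auto
      show "p \<in> edge_ideal V W {}" if "p \<in> polys V" "indet x * p \<in> edge_ideal V W {}" for p :: "'a xypoly"
        by (rule cluster_variable_regular[OF adm _ that(1) x(2) that(2)]) (simp add: cluster_def)
      show "\<exists>p\<in>polys V. c - indet x * p \<in> edge_ideal V W {}" if "c \<in> edge_ideal V (insert x W) {}" for c :: "'a xypoly"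
        using gen_ideal_insert[of c V "indet x" "edge_gens W {}"] that by (simp add: edge_gens_insert mult.commute)
    qed (use x less.prems in auto)
  qed
qed

lemma admissible_finite:
  assumes "admissible V W E" shows "finite E"
proof -
  have "E \<subseteq> Pow (VarX -` V)" using assms unfolding admissible_def by blast
  moreover have "finite (VarX -` V)" using admissibleD(1)[OF assms] by (rule finite_vertices)
  ultimately show ?thesis using finite_subset by blast
qed

text \<open>With \<open>T = J\<^sub>G + (x\<^sub>v)\<close>, \<open>T = A \<inter> B\<close> and \<open>C = A + B\<close>: the graph belonging to \<open>B\<close> and \<open>C\<close> has lost
the whole clique of \<open>v\<close>, so that each of its clique disjoint edge sets can be enlarged by an edge at \<open>v\<close>.\<close>

lemma koszul_reg_cluster:
  assumes "admissible V W E" "cluster E"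
  shows "koszul_reg V (edge_ideal V W E) (int (eta U E))"
  using assms
proof (induction "card E" arbitrary: W E rule: less_induct)
  case less
  note adm = less.prems(1) and cl = less.prems(2)
  note finE = admissible_finite[OF adm] and finV = admissibleD(1)[OF adm]
  show ?case
  proof (cases "E = {}")
    case True
    then show ?thesis using koszul_reg_mono[OF koszul_reg_variables[OF finV admissibleD(2)[OF adm]], of "int (eta U E)"] by simp
  next
    case False
    then obtain v i0 where vi0: "{v, i0} \<in> E" using admissible_edge[OF adm] by blast
    have V: "VarX v \<in> V" "VarY v \<in> V" "VarX v \<notin> W" using admissibleD(4)[OF adm vi0] by auto
    define WA where "WA = insert (VarX v) (insert (VarY v) W)"
    define WB where "WB = insert (VarX v) (W \<union> VarX ` {i. {v, i} \<in> E})"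
    define A B C T where "A = (edge_ideal V WA (edges_off {v} E) :: 'a xypoly set)"
      and "B = (edge_ideal V WB (edges_off (closed_nbh E v) E) :: 'a xypoly set)"
      and "C = (edge_ideal V (insert (VarY v) WB) (edges_off (closed_nbh E v) E) :: 'a xypoly set)"
      and "T = (edge_ideal V (insert (VarX v) W) E :: 'a xypoly set)"
    have sub: "WA \<subseteq> V" "WB \<subseteq> V" "insert (VarY v) WB \<subseteq> V" "insert (VarX v) W \<subseteq> V"
      using V admissibleD(2,4)[OF adm] by (auto simp: WA_def WB_def)
    have admA: "admissible V WA (edges_off {v} E)"
      by (rule admissible_edges_off[OF adm sub(1)]) (auto simp: WA_def)
    have admB: "admissible V WB (edges_off (closed_nbh E v) E)"
      by (rule admissible_edges_off[OF adm sub(2)]) (auto simp: WB_def closed_nbh_def)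
    have admC: "admissible V (insert (VarY v) WB) (edges_off (closed_nbh E v) E)"
      by (rule admissible_edges_off[OF adm sub(3)]) (auto simp: WB_def closed_nbh_def)
    have card: "card (edges_off S E) < card E" if "v \<in> S" for S
    proof (rule psubset_card_mono[OF finE])
      have "{v, i0} \<notin> edges_off S E" using that by (simp add: edges_off_edge)
      moreover have "edges_off S E \<subseteq> E" by (auto simp: edges_off_def)
      ultimately show "edges_off S E \<subset> E" using vi0 by blast
    qed
    have gA: "graded_ideal V A" and gB: "graded_ideal V B" and gC: "graded_ideal V C" and gT: "graded_ideal V T"
      unfolding A_def B_def C_def T_def
      using graded_ideal_edge_gens[OF admA sub(1)] graded_ideal_edge_gens[OF admB sub(2)]
        graded_ideal_edge_gens[OF admC sub(3)] graded_ideal_edge_gens[OF adm sub(4)] by auto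
    have "koszul_reg V (A \<inter> B) (int (eta U E))"
    proof (rule koszul_reg_Int[OF finV gA gB gC])
      have "koszul_reg V A (int (eta U (edges_off {v} E)))" unfolding A_def
        by (rule less.hyps[OF card admA cluster_edges_off[OF cl]]) simp
      then show "koszul_reg V A (int (eta U E))"
        by (rule koszul_reg_mono) (use eta_edges_off[OF finE] in simp)
      have "koszul_reg V B (int (eta U (edges_off (closed_nbh E v) E)))" unfolding B_def
        by (rule less.hyps[OF card admB cluster_edges_off[OF cl]]) (simp add: closed_nbh_def)
      then show "koszul_reg V B (int (eta U E))"
        by (rule koszul_reg_mono) (use eta_edges_off[OF finE] in simp)
      have "koszul_reg V C (int (eta U (edges_off (closed_nbh E v) E)))" unfolding C_def
        by (rule less.hyps[OF card admC cluster_edges_off[OF cl]]) (simp add: closed_nbh_def)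
      then show "koszul_reg V C (int (eta U E) - 1)"
        by (rule koszul_reg_mono) (use eta_edges_off_closed_nbh[OF finE _ vi0, of U] adm in \<open>fastforce simp: admissible_def\<close>)
      show "B \<subseteq> C" unfolding B_def C_def by (intro gen_ideal_mono edge_gens_mono) auto
      show "A \<subseteq> C" unfolding A_def C_def
      proof (rule gen_ideal_least, rule subsetI)
        fix g :: "'a xypoly" assume "g \<in> edge_gens WA (edges_off {v} E)"
        then show "g \<in> edge_ideal V (insert (VarY v) WB) (edges_off (closed_nbh E v) E)"
        proof (cases rule: edge_gens_cases)
          case (indet w) then show ?thesis by (auto intro: indet_mem simp: WA_def WB_def)
        next
          case (edge_binom i j)
          then have ij: "{i, j} \<in> E" "i \<noteq> v" "j \<noteq> v" by (auto simp: edges_off_edge)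
          show ?thesis
          proof (cases "i \<in> closed_nbh E v \<or> j \<in> closed_nbh E v")
            case True
            have nb: "b \<in> closed_nbh E v" if "a \<in> closed_nbh E v" "{a, b} \<in> E" for a b
              using cl that unfolding cluster_def closed_nbh_def by blast
            have "{j, i} \<in> E" using ij(1) by (simp add: insert_commute)
            then have "i \<in> closed_nbh E v" "j \<in> closed_nbh E v" using True nb ij(1) by blast+
            then have "{v, i} \<in> E" "{v, j} \<in> E" using ij by (auto simp: closed_nbh_def)
            then show ?thesis unfolding edge_binom(2)
              using admissibleD(4)[OF adm ij(1)] by (intro edge_binom_mem_XX) (auto simp: WB_def)
          next
            case False then show ?thesis using edge_binom ij by (auto intro!: edge_binom_mem simp: edges_off_edge)
          qed
        qed
      qed
      show "\<exists>a\<in>A. \<exists>b\<in>B. c = a + b" if "c \<in> C" for c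
      proof -
        have "edge_gens (insert (VarY v) WB) (edges_off (closed_nbh E v) E)
            \<subseteq> (edge_gens WA (edges_off {v} E) \<union> edge_gens WB (edges_off (closed_nbh E v) E) :: 'a xypoly set)"
          by (auto simp: edge_gens_def WA_def)
        then show ?thesis using that gen_ideal_Un gen_ideal_mono unfolding A_def B_def C_def by blast
      qed
    qed
    moreover have "T = A \<inter> B"
      unfolding A_def B_def T_def WA_def WB_def by (rule cluster_ideal_eq_Int[OF adm cl vi0])
    ultimately have kT: "koszul_reg V T (int (eta U E))" by simp
    show ?thesis
    proof (rule koszul_reg_lift[OF finV graded_ideal_edge_gens[OF adm admissibleD(2)[OF adm]] gT V(1) _ _ _ kT])
      show "gen_ideal V (edge_gens W E :: 'a xypoly set) \<subseteq> T" unfolding T_def by (intro gen_ideal_mono edge_gens_mono) auto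
      show "p \<in> edge_ideal V W E" if "p \<in> polys V" "indet (VarX v) * p \<in> edge_ideal V W E" for p :: "'a xypoly"
        by (rule cluster_variable_regular[OF adm cl that(1) V(3) that(2)])
      show "\<exists>p\<in>polys V. c - indet (VarX v) * p \<in> edge_ideal V W E" if "c \<in> T" for c :: "'a xypoly"
        using gen_ideal_insert[of c V "indet (VarX v)" "edge_gens W E"] that by (simp add: T_def edge_gens_insert mult.commute)
    qed
  qed
qed

theorem koszul_reg_le_eta:
  assumes "admissible V W E" "\<Union>E \<subseteq> U"
  shows "koszul_reg V (edge_ideal V W E) (int (eta U E))"
  using assms
proof (induction "card (nonfree E)" arbitrary: W E rule: less_induct)
  case less
  note adm = less.prems(1) and EU = less.prems(2)
  note finE = admissible_finite[OF adm] and finV = admissibleD(1)[OF adm]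
  show ?case
  proof (cases "nonfree E = {}")
    case True
    then show ?thesis using koszul_reg_cluster[OF adm] cluster_iff_nonfree by blast
  next
    case False
    then obtain v where v: "v \<in> nonfree E" by blast
    then obtain i0 where vi0: "{v, i0} \<in> E" unfolding nonfree_def by blast
    have V: "VarX v \<in> V" "VarY v \<in> V" using admissibleD(4)[OF adm vi0] by auto
    have finN: "finite (nonfree E)"
    proof -
      have "nonfree E \<subseteq> VarX -` V" using admissibleD(4)[OF adm] unfolding nonfree_def by blast
      moreover have "finite (VarX -` V)" using finV by (rule finite_vertices)
      ultimately show ?thesis using finite_subset by blast
    qed
    let ?W = "insert (VarX v) (insert (VarY v) W)" and ?E = "complete_at E v"
    have sub: "W \<subseteq> V" "?W \<subseteq> V" using V admissibleD(2)[OF adm] by auto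
    have admA: "admissible V W ?E" by (rule admissible_complete_at[OF adm])
    have admB: "admissible V ?W (edges_off {v} E)" by (rule admissible_edges_off[OF adm sub(2)]) auto
    have admC: "admissible V ?W (edges_off {v} ?E)" by (rule admissible_edges_off[OF admA sub(2)]) auto
    note finC = admissible_finite[OF admA]
    have U: "\<Union>?E \<subseteq> U" "\<Union>(edges_off {v} E) \<subseteq> U" "\<Union>(edges_off {v} ?E) \<subseteq> U"
      using EU by (auto simp: complete_at_def edges_off_def)
    have less_card: "card (nonfree E') < card (nonfree E)" if "nonfree E' \<subseteq> nonfree E - {v}" for E'
      by (rule psubset_card_mono[OF finN]) (use v that in auto)
    have lessA: "card (nonfree ?E) < card (nonfree E)"
      and lessB: "card (nonfree (edges_off {v} E)) < card (nonfree E)"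
      and lessC: "card (nonfree (edges_off {v} ?E)) < card (nonfree E)"
      using less_card nonfree_complete_at nonfree_edges_off by (metis, metis, (metis Diff_subset order_trans))
    have two: "card e = 2 \<and> e \<subseteq> U" if "e \<in> E" for e using adm EU that unfolding admissible_def by blast
    have eta: "eta U ?E + 1 \<le> eta U E" by (rule eta_complete_at[OF finE two v])
    show ?thesis unfolding ideal_eq_Int[OF adm, of v]
    proof (rule koszul_reg_Int[OF finV graded_ideal_edge_gens[OF admA sub(1)] graded_ideal_edge_gens[OF admB sub(2)]
          graded_ideal_edge_gens[OF admC sub(2)]])
      show "koszul_reg V (gen_ideal V (edge_gens W ?E :: 'a xypoly set)) (int (eta U E))"
        by (rule koszul_reg_mono[OF less.hyps[OF lessA admA U(1)]]) (use eta in simp)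
      show "koszul_reg V (gen_ideal V (edge_gens ?W (edges_off {v} E) :: 'a xypoly set)) (int (eta U E))"
        by (rule koszul_reg_mono[OF less.hyps[OF lessB admB U(2)]]) (use eta_edges_off[OF finE] in simp)
      show "koszul_reg V (gen_ideal V (edge_gens ?W (edges_off {v} ?E) :: 'a xypoly set)) (int (eta U E) - 1)"
        by (rule koszul_reg_mono[OF less.hyps[OF lessC admC U(3)]])
           (use eta eta_edges_off[OF finC, of U "{v}"] in linarith)
      show "gen_ideal V (edge_gens ?W (edges_off {v} E) :: 'a xypoly set) \<subseteq> edge_ideal V ?W (edges_off {v} ?E)"
        by (intro gen_ideal_mono edge_gens_mono) (auto simp: edges_off_def complete_at_def)
      show "gen_ideal V (edge_gens W ?E :: 'a xypoly set) \<subseteq> edge_ideal V ?W (edges_off {v} ?E)"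
      proof -
        have "gen_ideal V (edge_gens W ?E :: 'a xypoly set) \<subseteq> edge_ideal V ?W ?E" by (intro gen_ideal_mono edge_gens_mono) auto
        also have "\<dots> \<subseteq> edge_ideal V ?W (edges_off {v} ?E)" by (rule gen_ideal_edges_off_vertex[OF admA]) auto
        finally show ?thesis .
      qed
      show "\<exists>a\<in>edge_ideal V W ?E. \<exists>b\<in>edge_ideal V ?W (edges_off {v} E). c = a + b"
        if "c \<in> edge_ideal V ?W (edges_off {v} ?E)" for c :: "'a xypoly"
      proof -
        have "edge_gens ?W (edges_off {v} ?E) \<subseteq> (edge_gens W ?E \<union> edge_gens ?W (edges_off {v} E) :: 'a xypoly set)"
          by (auto simp: edge_gens_def edges_off_edge)
        then show ?thesis using that gen_ideal_Un gen_ideal_mono by blast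
      qed
    qed
  qed
qed

section \<open>Graded submodules of free modules\<close>

text \<open>Vectors of length \<open>k\<close> over \<open>K[V]\<close> are functions that vanish from \<open>k\<close> on, so that equality of vectors is
equality of functions.\<close>

definition vecs :: "var set \<Rightarrow> nat \<Rightarrow> (nat \<Rightarrow> 'k::field xypoly) set" where
  "vecs V k = {f. (\<forall>a<k. f a \<in> polys V) \<and> (\<forall>a\<ge>k. f a = 0)}"

abbreviation free_on :: "var set \<Rightarrow> int list \<Rightarrow> (nat \<Rightarrow> 'k::field xypoly) set" where
  "free_on V ds \<equiv> vecs V (length ds)"

definition vhomog :: "int list \<Rightarrow> int \<Rightarrow> (nat \<Rightarrow> 'k::field xypoly) \<Rightarrow> bool" where
  "vhomog ds D f \<longleftrightarrow> (\<forall>a<length ds. homogeneous (D - ds ! a) (f a))"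

definition vec_comp :: "int list \<Rightarrow> int \<Rightarrow> (nat \<Rightarrow> 'k::field xypoly) \<Rightarrow> nat \<Rightarrow> 'k xypoly" where
  "vec_comp ds D f = (\<lambda>a. if a < length ds then hom_comp (D - ds ! a) (f a) else 0)"

definition graded_submodule :: "var set \<Rightarrow> int list \<Rightarrow> (nat \<Rightarrow> 'k::field xypoly) set \<Rightarrow> bool" where
  "graded_submodule V ds M \<longleftrightarrow> M \<subseteq> free_on V ds \<and> (\<lambda>_. 0) \<in> M
     \<and> (\<forall>f\<in>M. \<forall>g\<in>M. (\<lambda>a. f a + g a) \<in> M) \<and> (\<forall>f\<in>M. \<forall>p\<in>polys V. (\<lambda>a. p * f a) \<in> M)
     \<and> (\<forall>f\<in>M. \<forall>D. vec_comp ds D f \<in> M)"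

lemma graded_submoduleD:
  assumes "graded_submodule V ds M"
  shows "M \<subseteq> free_on V ds" "(\<lambda>_. 0) \<in> M" "f \<in> M \<Longrightarrow> g \<in> M \<Longrightarrow> (\<lambda>a. f a + g a) \<in> M"
    "f \<in> M \<Longrightarrow> p \<in> polys V \<Longrightarrow> (\<lambda>a. p * f a) \<in> M" "f \<in> M \<Longrightarrow> vec_comp ds D f \<in> M"
    "f \<in> M \<Longrightarrow> g \<in> M \<Longrightarrow> (\<lambda>a. f a - g a) \<in> M"
proof -
  show "(\<lambda>a. f a - g a) \<in> M" if "f \<in> M" "g \<in> M"
  proof -
    have m: "\<And>f p. f \<in> M \<Longrightarrow> p \<in> polys V \<Longrightarrow> (\<lambda>a. p * f a) \<in> M"
      and s: "\<And>f g. f \<in> M \<Longrightarrow> g \<in> M \<Longrightarrow> (\<lambda>a. f a + g a) \<in> M" using assms by (auto simp: graded_submodule_def)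
    show ?thesis using s[OF that(1) m[OF that(2), of "- 1"]] by simp
  qed
qed (use assms in \<open>auto simp: graded_submodule_def\<close>)

lemma graded_submodule_sum: 
  assumes "graded_submodule V ds M" "\<And>x. x \<in> X \<Longrightarrow> F x \<in> M" shows "(\<lambda>a. \<Sum>x\<in>X. F x a) \<in> M"
  using assms(2)
proof (induction X rule: infinite_finite_induct)
  case (insert x X)
  then show ?case using graded_submoduleD(3)[OF assms(1), of "F x" "\<lambda>a. \<Sum>x\<in>X. F x a"] by simp
qed (use graded_submoduleD(2)[OF assms(1)] in auto)

lemma vecs_closed [simp]:
  "(\<lambda>_. 0) \<in> vecs V k" "f \<in> vecs V k \<Longrightarrow> g \<in> vecs V k \<Longrightarrow> (\<lambda>a. f a + g a) \<in> vecs V k"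
  "f \<in> vecs V k \<Longrightarrow> g \<in> vecs V k \<Longrightarrow> (\<lambda>a. f a - g a) \<in> vecs V k"
  "f \<in> vecs V k \<Longrightarrow> p \<in> polys V \<Longrightarrow> (\<lambda>a. p * f a) \<in> vecs V k"
  by (auto simp: vecs_def)

lemma vecs_polys: "f \<in> vecs V k \<Longrightarrow> f a \<in> polys V"
  by (cases "a < k") (auto simp: vecs_def)

lemma vec_comp_vecs: "f \<in> free_on V ds \<Longrightarrow> vec_comp ds D f \<in> free_on V ds"
  by (auto simp: vecs_def vec_comp_def)

lemma vhomog_vec_comp: "vhomog ds D (vec_comp ds D f)"
  by (simp add: vhomog_def vec_comp_def)

lemma vec_comp_vhomog: "f \<in> free_on V ds \<Longrightarrow> vhomog ds D f \<Longrightarrow> vec_comp ds D f = f"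
  by (rule ext) (auto simp: vecs_def vhomog_def vec_comp_def homogeneous_iff_hom_comp)

lemma graded_submodule_vecs: "graded_submodule V ds (free_on V ds)"
  by (auto simp: graded_submodule_def vec_comp_vecs)

lemma graded_submodule_zero: "graded_submodule V ds {\<lambda>_. 0}"
  by (auto simp: graded_submodule_def vec_comp_def)

definition basis_vec :: "nat \<Rightarrow> nat \<Rightarrow> 'k::field xypoly" where
  "basis_vec b = (\<lambda>a. if a = b then 1 else 0)"

lemma basis_vec_vecs: "b < k \<Longrightarrow> basis_vec b \<in> vecs V k"
  by (auto simp: basis_vec_def vecs_def)

subsection \<open>Graded maps\<close>

definition mat_app :: "nat \<Rightarrow> (nat \<Rightarrow> nat \<Rightarrow> 'k::field xypoly) \<Rightarrow> (nat \<Rightarrow> 'k xypoly) \<Rightarrow> nat \<Rightarrow> 'k xypoly" where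
  "mat_app k A v = (\<lambda>a. \<Sum>b<k. A a b * v b)"

abbreviation map_on :: "int list \<Rightarrow> (nat \<Rightarrow> nat \<Rightarrow> 'k::field xypoly) \<Rightarrow> (nat \<Rightarrow> 'k xypoly) \<Rightarrow> nat \<Rightarrow> 'k xypoly" where
  "map_on ds \<equiv> mat_app (length ds)"

definition graded_matrix :: "var set \<Rightarrow> int list \<Rightarrow> int list \<Rightarrow> (nat \<Rightarrow> nat \<Rightarrow> 'k::field xypoly) \<Rightarrow> bool" where
  "graded_matrix V ds es A \<longleftrightarrow>
     (\<forall>a<length es. \<forall>b<length ds. A a b \<in> polys V \<and> homogeneous (ds ! b - es ! a) (A a b)) \<and>
     (\<forall>a\<ge>length es. \<forall>b. A a b = 0)"

lemma mat_app_vecs: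
  assumes "graded_matrix V ds es A" "v \<in> free_on V ds" shows "map_on ds A v \<in> free_on V es"
  using assms unfolding vecs_def graded_matrix_def mat_app_def by (auto intro!: polys_sum polys_closed(6))

lemma mat_app_add: "mat_app k A (\<lambda>a. v a + w a) = (\<lambda>a. mat_app k A v a + mat_app k A w a)"
  by (rule ext) (simp add: mat_app_def sum.distrib algebra_simps)

lemma mat_app_diff: "mat_app k A (\<lambda>a. v a - w a) = (\<lambda>a. mat_app k A v a - mat_app k A w a)"
  by (rule ext) (simp add: mat_app_def sum_subtractf algebra_simps)

lemma mat_app_scale: "mat_app k A (\<lambda>a. p * v a) = (\<lambda>a. p * mat_app k A v a)"
  by (rule ext) (simp add: mat_app_def sum_distrib_left algebra_simps)

lemma mat_app_zero: "mat_app k A (\<lambda>a. 0) = (\<lambda>a. 0)"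
  by (rule ext) (simp add: mat_app_def)

lemma mat_app_basis_vec: "b < k \<Longrightarrow> mat_app k A (basis_vec b) = (\<lambda>a. A a b)"
  by (rule ext) (simp add: mat_app_def basis_vec_def if_distrib[of "\<lambda>x. _ * x"] sum.delta cong: if_cong)

lemma mat_app_vec_comp:
  assumes "graded_matrix V ds es A"
  shows "map_on ds A (vec_comp ds D v) = vec_comp es D (map_on ds A v)"
proof (rule ext)
  fix a
  show "map_on ds A (vec_comp ds D v) a = vec_comp es D (map_on ds A v) a"
  proof (cases "a < length es")
    case True
    have "hom_comp (D - es ! a) (A a b * v b) = A a b * hom_comp (D - ds ! b) (v b)" if "b < length ds" for b
    proof -
      have "hom_comp (D - es ! a) (v b * A a b) = hom_comp (D - es ! a - (ds ! b - es ! a)) (v b) * A a b"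
        by (rule hom_comp_mult_homogeneous) (use assms True that in \<open>auto simp: graded_matrix_def\<close>)
      then show ?thesis by (simp add: mult.commute)
    qed
    then show ?thesis using True by (simp add: mat_app_def vec_comp_def hom_comp_sum)
  next
    case False
    then show ?thesis using assms by (simp add: mat_app_def vec_comp_def graded_matrix_def)
  qed
qed

lemma mat_app_vhomog:
  assumes "graded_matrix V ds es A" "v \<in> free_on V ds" "vhomog ds D v"
  shows "vhomog es D (map_on ds A v)"
  using mat_app_vec_comp[OF assms(1), of D v] vec_comp_vhomog[OF assms(2,3)] vhomog_vec_comp by metis

lemma graded_submodule_preimage:
  assumes A: "graded_matrix V ds es A" and N: "graded_submodule V es N"
  shows "graded_submodule V ds {v \<in> free_on V ds. map_on ds A v \<in> N}"
  unfolding graded_submodule_def using graded_submoduleD[OF N]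
  by (auto simp: mat_app_add mat_app_scale mat_app_zero mat_app_vec_comp[OF A] vec_comp_vecs)

text \<open>The Koszul differential on chains with values in a free module.\<close>

definition vbd :: "var set \<Rightarrow> (var set \<Rightarrow> nat \<Rightarrow> 'k::field xypoly) \<Rightarrow> var set \<Rightarrow> nat \<Rightarrow> 'k xypoly" where
  "vbd V z T = (\<lambda>a. bd V (\<lambda>T. z T a) T)"

lemma vbd_diff: "vbd V (\<lambda>T a. z T a - w T a) T = (\<lambda>a. vbd V z T a - vbd V w T a)"
  by (rule ext) (simp add: vbd_def bd_diff)

lemma vbd_vbd: "finite V \<Longrightarrow> T \<subseteq> V \<Longrightarrow> vbd V (vbd V z) T = (\<lambda>_. 0)"
proof (rule ext)
  fix a assume "finite V" "T \<subseteq> V"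
  then have "bd V (bd V (\<lambda>T. z T a)) T = 0" by (rule bd_bd)
  then show "vbd V (vbd V z) T a = 0" by (simp add: vbd_def)
qed

lemma vbd_closed:
  assumes "graded_submodule V ds M" "\<And>S. S \<subseteq> V \<Longrightarrow> z S \<in> M" "T \<subseteq> V" shows "vbd V z T \<in> M"
proof -
  have "(\<lambda>a. \<Sum>v\<in>V - T. ksign v T * (indet v * z (insert v T) a)) \<in> M"
  proof (rule graded_submodule_sum[OF assms(1)])
    fix v assume v: "v \<in> V - T"
    have "(\<lambda>a. (ksign v T * indet v) * z (insert v T) a) \<in> M"
      by (rule graded_submoduleD(4)[OF assms(1)]) (use v assms(2,3) in auto)
    then show "(\<lambda>a. ksign v T * (indet v * z (insert v T) a)) \<in> M" by (simp only: mult.assoc)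
  qed
  then show ?thesis by (simp add: vbd_def bd_def)
qed

lemma mat_app_vbd: "mat_app k A (vbd V z T) = vbd V (\<lambda>T. mat_app k A (z T)) T"
proof (rule ext)
  fix a
  show "mat_app k A (vbd V z T) a = vbd V (\<lambda>T. mat_app k A (z T)) T a"
    by (simp add: mat_app_def vbd_def bd_sum bd_mult)
qed

lemma vec_comp_vbd: "vec_comp ds D (vbd V z T) = vbd V (\<lambda>T. vec_comp ds (D - 1) (z T)) T"
  by (rule ext) (simp add: vec_comp_def vbd_def hom_comp_bd algebra_simps)

lemma lookup_0_vbd: "lookup (vbd V z T a) 0 = 0"
  by (simp add: vbd_def bd_def lookup_sum lookup_0_mult)

text \<open>Componentwise this is the exactness of the Koszul complex of the polynomial ring in positive degrees.\<close>

lemma koszul_exact: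
  assumes V: "finite V" and z: "\<And>T. z T \<in> free_on V ds" "\<And>T. vhomog ds D (z T)"
    and D: "\<And>a. a < length ds \<Longrightarrow> ds ! a < D" and bz: "\<And>T. T \<subseteq> V \<Longrightarrow> vbd V z T = (\<lambda>_. 0)"
  shows "\<exists>w. (\<forall>T. w T \<in> free_on V ds) \<and> (\<forall>T. vhomog ds (D - 1) (w T)) \<and> (\<forall>T\<subseteq>V. vbd V w T = z T)"
proof -
  have e: "c = 0" if "c \<in> gen_ideal V {}" for c :: "'a xypoly"
    using that by (cases rule: gen_ideal.cases) auto
  have k: "koszul_reg V (gen_ideal V ({} :: 'a xypoly set)) 0"
    using koszul_reg_variables[OF V, of "{}"] by (simp add: edge_gens_def)
  have "\<exists>w. (\<forall>T. w T \<in> polys V) \<and> (\<forall>T. homogeneous (D - ds ! a - 1) (w T)) \<and> (\<forall>T\<subseteq>V. z T a - bd V w T \<in> gen_ideal V {})"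
    if a: "a < length ds" for a
  proof (rule koszul_regE[OF k])
    show "bd V (\<lambda>T. z T a) T \<in> gen_ideal V {}" if "T \<subseteq> V" for T
      using fun_cong[OF bz[OF that], of a] by (simp add: vbd_def gen_ideal_0)
  qed (use D[OF a] z a in \<open>auto simp: vecs_def vhomog_def\<close>)
  then obtain w where w: "\<And>a T. a < length ds \<Longrightarrow> w a T \<in> polys V"
    "\<And>a T. a < length ds \<Longrightarrow> homogeneous (D - ds ! a - 1) (w a T)"
    "\<And>a T. a < length ds \<Longrightarrow> T \<subseteq> V \<Longrightarrow> z T a - bd V (w a) T \<in> gen_ideal V {}"
    by metis
  define w' where "w' T = (\<lambda>a. if a < length ds then w a T else 0)" for T
  have "vbd V w' T = z T" if "T \<subseteq> V" for T
  proof (rule ext)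
    fix a
    show "vbd V w' T a = z T a"
    proof (cases "a < length ds")
      case True
      then show ?thesis using e[OF w(3)[OF True that]] by (simp add: vbd_def w'_def)
    next
      case False
      then show ?thesis using z(1)[of T] by (simp add: vbd_def w'_def vecs_def)
    qed
  qed
  moreover have "w' T \<in> free_on V ds" for T using w(1) by (simp add: w'_def vecs_def)
  moreover have "vhomog ds (D - 1) (w' T)" for T
  proof -
    have "homogeneous (D - 1 - ds ! a) (w a T)" if "a < length ds" for a
    proof -
      have "D - 1 - ds ! a = D - ds ! a - 1" by simp
      then show ?thesis using w(2)[OF that, of T] by (simp only:)
    qed
    then show ?thesis by (auto simp: w'_def vhomog_def)
  qed
  ultimately show ?thesis by blast
qed

section \<open>Regularity along a resolution\<close>

text \<open>The analogue of \<open>koszul_reg\<close> for the subquotient \<open>M/N\<close> of the free module with basis degrees \<open>es\<close>.  The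
two cases that occur are \<open>S/I\<close> and syzygy modules, for which \<open>N\<close> is zero.\<close>

definition module_reg :: "var set \<Rightarrow> int list \<Rightarrow> (nat \<Rightarrow> 'k::field xypoly) set \<Rightarrow> (nat \<Rightarrow> 'k xypoly) set \<Rightarrow> int \<Rightarrow> bool" where
  "module_reg V es M N r \<longleftrightarrow> (\<forall>D z. r < D \<longrightarrow> (\<forall>T. z T \<in> M \<and> vhomog es D (z T)) \<longrightarrow> (\<forall>T\<subseteq>V. vbd V z T \<in> N) \<longrightarrow>
     (\<exists>w. (\<forall>T\<subseteq>V. w T \<in> M) \<and> (\<forall>T\<subseteq>V. (\<lambda>a. z T a - vbd V w T a) \<in> N)))"

lemma module_regD:
  assumes "module_reg V es M N r" "r < D" "\<And>T. z T \<in> M" "\<And>T. vhomog es D (z T)" "\<And>T. T \<subseteq> V \<Longrightarrow> vbd V z T \<in> N"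
  shows "\<exists>w. (\<forall>T\<subseteq>V. w T \<in> M) \<and> (\<forall>T\<subseteq>V. (\<lambda>a. z T a - vbd V w T a) \<in> N)"
  using assms unfolding module_reg_def by blast

text \<open>The columns of \<open>A\<close> are homogeneous generators of \<open>M/N\<close>.\<close>

definition presents :: "var set \<Rightarrow> int list \<Rightarrow> int list \<Rightarrow> (nat \<Rightarrow> nat \<Rightarrow> 'k::field xypoly)
    \<Rightarrow> (nat \<Rightarrow> 'k xypoly) set \<Rightarrow> (nat \<Rightarrow> 'k xypoly) set \<Rightarrow> bool" where
  "presents V ds es A M N \<longleftrightarrow> finite V \<and> graded_matrix V ds es A \<and> graded_submodule V es M \<and> graded_submodule V es N \<and> N \<subseteq> M
     \<and> (\<forall>v\<in>free_on V ds. map_on ds A v \<in> M)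
     \<and> (\<forall>m\<in>M. \<exists>v\<in>free_on V ds. (\<lambda>a. m a - map_on ds A v a) \<in> N)"

definition syzygies :: "var set \<Rightarrow> int list \<Rightarrow> (nat \<Rightarrow> nat \<Rightarrow> 'k::field xypoly)
    \<Rightarrow> (nat \<Rightarrow> 'k xypoly) set \<Rightarrow> (nat \<Rightarrow> 'k xypoly) set" where
  "syzygies V ds A N = {v \<in> free_on V ds. map_on ds A v \<in> N}"

text \<open>If the image of \<open>f\<close> is the boundary of \<open>w\<close> modulo \<open>N\<close>, subtract from \<open>f\<close> the boundary of a lift of \<open>w\<close>.\<close>

lemma presents_lift_chain:
  assumes p: "presents V ds es A M N" and w: "\<And>T. T \<subseteq> V \<Longrightarrow> w T \<in> M" 
    and y: "\<And>T. T \<subseteq> V \<Longrightarrow> f T \<in> free_on V ds"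
    and yw: "\<And>T. T \<subseteq> V \<Longrightarrow> (\<lambda>a. map_on ds A (f T) a - vbd V w T a) \<in> N"
  shows "\<exists>f'. (\<forall>T\<subseteq>V. f' T \<in> free_on V ds) \<and> (\<forall>T\<subseteq>V. (\<lambda>a. f T a - vbd V f' T a) \<in> syzygies V ds A N)"
proof -
  let ?k = "length ds"
  have N: "graded_submodule V es N" using p by (simp add: presents_def)
  have "\<forall>T. T \<subseteq> V \<longrightarrow> (\<exists>v. v \<in> vecs V ?k \<and> (\<lambda>a. w T a - mat_app ?k A v a) \<in> N)"
    using p w unfolding presents_def by blast
  then obtain f' where f': "\<And>T. T \<subseteq> V \<Longrightarrow> f' T \<in> vecs V ?k"
    "\<And>T. T \<subseteq> V \<Longrightarrow> (\<lambda>a. w T a - mat_app ?k A (f' T) a) \<in> N" by metis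
  have "(\<lambda>a. f T a - vbd V f' T a) \<in> syzygies V ds A N" if T: "T \<subseteq> V" for T
  proof -
    have "vbd V f' T \<in> vecs V ?k" by (rule vbd_closed[OF graded_submodule_vecs f'(1) T])
    then have "(\<lambda>a. f T a - vbd V f' T a) \<in> vecs V ?k" using y[OF T] by simp
    moreover have "vbd V (\<lambda>T a. w T a - mat_app ?k A (f' T) a) T \<in> N" by (rule vbd_closed[OF N f'(2) T])
    then have "(\<lambda>a. (mat_app ?k A (f T) a - vbd V w T a) + vbd V (\<lambda>T a. w T a - mat_app ?k A (f' T) a) T a) \<in> N"
      by (rule graded_submoduleD(3)[OF N yw[OF T]])
    then have "mat_app ?k A (\<lambda>a. f T a - vbd V f' T a) \<in> N"
      by (simp add: mat_app_diff mat_app_vbd vbd_diff)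
    ultimately show ?thesis by (simp add: syzygies_def)
  qed
  then show ?thesis using f'(1) by blast
qed

text \<open>The connecting homomorphism for \<open>0 \<rightarrow> Z \<rightarrow> F \<rightarrow> M/N \<rightarrow> 0\<close>: a cycle in \<open>Z\<close> bounds some \<open>f\<close> in the free module
\<open>F\<close>, whose image is a cycle in \<open>M/N\<close> of degree one less.  If that image is a boundary, \<open>f\<close> can be
corrected to a chain in \<open>Z\<close> with the same boundary.\<close>

lemma module_reg_syzygies:
  assumes p: "presents V ds es A M N" and r: "\<And>b. b < length ds \<Longrightarrow> ds ! b \<le> r" and k: "module_reg V es M N r"
  shows "module_reg V ds (syzygies V ds A N) {\<lambda>_. 0} (r + 1)"
  unfolding module_reg_def
proof (intro allI impI)
  fix D and z :: "var set \<Rightarrow> nat \<Rightarrow> 'a xypoly"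
  assume D: "r + 1 < D" and "\<forall>T. z T \<in> syzygies V ds A N \<and> vhomog ds D (z T)"
    and "\<forall>T\<subseteq>V. vbd V z T \<in> {\<lambda>_. 0}"
  then have z: "\<And>T. z T \<in> free_on V ds" "\<And>T. vhomog ds D (z T)" "\<And>T. map_on ds A (z T) \<in> N"
    and bz: "\<And>T. T \<subseteq> V \<Longrightarrow> vbd V z T = (\<lambda>_. 0)" by (auto simp: syzygies_def)
  have V: "finite V" and A: "graded_matrix V ds es A" and AM: "\<And>v. v \<in> free_on V ds \<Longrightarrow> map_on ds A v \<in> M"
    using p by (auto simp: presents_def)
  have dsD: "ds ! a < D" if "a < length ds" for a using r[OF that] D by simp
  obtain f where f: "\<And>T. f T \<in> free_on V ds" "\<And>T. vhomog ds (D - 1) (f T)" "\<And>T. T \<subseteq> V \<Longrightarrow> vbd V f T = z T"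
    using koszul_exact[OF V z(1,2) dsD bz] by blast
  have "\<exists>w. (\<forall>T\<subseteq>V. w T \<in> M) \<and> (\<forall>T\<subseteq>V. (\<lambda>a. map_on ds A (f T) a - vbd V w T a) \<in> N)"
  proof (rule module_regD[OF k])
    show "r < D - 1" using D by simp
    show "vhomog es (D - 1) (map_on ds A (f T))" for T by (rule mat_app_vhomog[OF A f(1,2)])
    show "vbd V (\<lambda>T. map_on ds A (f T)) T \<in> N" if "T \<subseteq> V" for T
      using z(3)[of T] f(3)[OF that] by (simp add: mat_app_vbd[symmetric])
  qed (rule AM[OF f(1)])
  then obtain w where w: "\<And>T. T \<subseteq> V \<Longrightarrow> w T \<in> M"
    "\<And>T. T \<subseteq> V \<Longrightarrow> (\<lambda>a. map_on ds A (f T) a - vbd V w T a) \<in> N" by blast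
  obtain f' where f': "\<And>T. T \<subseteq> V \<Longrightarrow> (\<lambda>a. f T a - vbd V f' T a) \<in> syzygies V ds A N"
    using presents_lift_chain[OF p w(1) f(1) w(2)] by blast
  have "(\<lambda>a. z T a - vbd V (\<lambda>T a. f T a - vbd V f' T a) T a) \<in> {\<lambda>_. 0}" if T: "T \<subseteq> V" for T
    unfolding vbd_diff f(3)[OF T] vbd_vbd[OF V T] by simp
  then show "\<exists>w. (\<forall>T\<subseteq>V. w T \<in> syzygies V ds A N) \<and> (\<forall>T\<subseteq>V. (\<lambda>a. z T a - vbd V w T a) \<in> {\<lambda>_. 0})"
    using f' by (intro exI[of _ "\<lambda>T a. f T a - vbd V f' T a"]) blast
qed

definition const_free :: "(nat \<Rightarrow> 'k::field xypoly) set \<Rightarrow> bool" where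
  "const_free M \<longleftrightarrow> (\<forall>f\<in>M. \<forall>a. lookup (f a) 0 = 0)"

text \<open>A generator of degree above \<open>r\<close> is a cycle in exterior degree zero, hence a boundary, that is, a
combination of elements of \<open>M\<close> with coefficients in the maximal ideal.  This gives a relation in
which the generator itself has coefficient one up to terms without constant part, contrary to minimality.\<close>

lemma minimal_degrees_le:
  assumes p: "presents V ds es A M N" and k: "module_reg V es M N r" and c: "const_free (syzygies V ds A N)"
    and b: "b < length ds"
  shows "ds ! b \<le> r"
proof (rule ccontr)
  assume "\<not> ds ! b \<le> r"
  then have D: "r < ds ! b" by simp
  have A: "graded_matrix V ds es A" and AM: "\<And>v. v \<in> free_on V ds \<Longrightarrow> map_on ds A v \<in> M"
    and N0: "(\<lambda>_. 0) \<in> N"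
    using p graded_submoduleD(2) by (auto simp: presents_def)
  \<comment> \<open>The \<open>b\<close>-th basis vector as a chain in exterior degree zero, where every chain is a cycle.\<close>
  define f where "f T = (if T = {} then basis_vec b else (\<lambda>_. 0) :: nat \<Rightarrow> 'a xypoly)" for T :: "var set"
  have f: "f T \<in> free_on V ds" for T using basis_vec_vecs[OF b] by (auto simp: f_def)
  have fh: "vhomog ds (ds ! b) (f T)" for T
    by (auto simp: f_def vhomog_def basis_vec_def single_one[symmetric] homogeneous_single simp del: single_one)
  have "\<exists>w. (\<forall>T\<subseteq>V. w T \<in> M) \<and> (\<forall>T\<subseteq>V. (\<lambda>a. map_on ds A (f T) a - vbd V w T a) \<in> N)"
  proof (rule module_regD[OF k D])
    show "vhomog es (ds ! b) (map_on ds A (f T))" for T by (rule mat_app_vhomog[OF A f fh])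
    have "vbd V (\<lambda>T. map_on ds A (f T)) T = (\<lambda>_. 0)" for T
      by (rule ext) (simp add: vbd_def bd_def f_def mat_app_zero)
    then show "vbd V (\<lambda>T. map_on ds A (f T)) T \<in> N" for T using N0 by simp
  qed (rule AM[OF f])
  then obtain w where w: "\<And>T. T \<subseteq> V \<Longrightarrow> w T \<in> M"
    "\<And>T. T \<subseteq> V \<Longrightarrow> (\<lambda>a. map_on ds A (f T) a - vbd V w T a) \<in> N" by blast
  obtain f' where "\<And>T. T \<subseteq> V \<Longrightarrow> (\<lambda>a. f T a - vbd V f' T a) \<in> syzygies V ds A N"
    using presents_lift_chain[OF p w(1) f w(2)] by blast
  then have "(\<lambda>a. basis_vec b a - vbd V f' {} a) \<in> syzygies V ds A N" by (metis empty_subsetI f_def)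
  then have "\<forall>a. lookup (basis_vec b a - vbd V f' {} a :: 'a xypoly) 0 = 0"
    using bspec[OF c[unfolded const_free_def]] by fast
  then have "lookup (basis_vec b b - vbd V f' {} b :: 'a xypoly) 0 = 0" ..
  then show False by (simp add: lookup_minus lookup_0_vbd basis_vec_def)
qed

section \<open>Existence of minimal resolutions\<close>

inductive_set vspan :: "var set \<Rightarrow> (nat \<Rightarrow> 'k::field xypoly) set \<Rightarrow> (nat \<Rightarrow> 'k xypoly) set" for V X where
  vspan_0: "(\<lambda>_. 0) \<in> vspan V X"
| vspan_step: "p \<in> polys V \<Longrightarrow> x \<in> X \<Longrightarrow> y \<in> vspan V X \<Longrightarrow> (\<lambda>a. p * x a + y a) \<in> vspan V X"

lemma vspan_base: "x \<in> X \<Longrightarrow> x \<in> vspan V X"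
  using vspan_step[OF polys_closed(2) _ vspan_0, of x X V] by simp

lemma vspan_add: "f \<in> vspan V X \<Longrightarrow> g \<in> vspan V X \<Longrightarrow> (\<lambda>a. f a + g a) \<in> vspan V X"
proof (induction rule: vspan.induct)
  case (vspan_step p x y)
  then have "(\<lambda>a. p * x a + (y a + g a)) \<in> vspan V X" by (intro vspan.vspan_step)
  then show ?case by (simp add: add.assoc)
qed simp

lemma vspan_scale: "f \<in> vspan V X \<Longrightarrow> q \<in> polys V \<Longrightarrow> (\<lambda>a. q * f a) \<in> vspan V X"
proof (induction rule: vspan.induct)
  case (vspan_step p x y)
  then have "(\<lambda>a. (q * p) * x a + q * y a) \<in> vspan V X" by (intro vspan.vspan_step) auto
  then show ?case by (simp add: algebra_simps)
qed (simp add: vspan_0)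

lemma vspan_sum:
  assumes "\<And>i. i \<in> I \<Longrightarrow> F i \<in> vspan V X" shows "(\<lambda>a. \<Sum>i\<in>I. F i a) \<in> vspan V X"
  using assms
proof (induction I rule: infinite_finite_induct)
  case (insert i I)
  then show ?case using vspan_add[of "F i" V X "\<lambda>a. \<Sum>i\<in>I. F i a"] by simp
qed (auto simp: vspan_0)

lemma vspan_subset: 
  assumes "X \<subseteq> vspan V Y" shows "vspan V X \<subseteq> vspan V Y"
proof
  fix f assume "f \<in> vspan V X"
  then show "f \<in> vspan V Y"
  proof (induction rule: vspan.induct)
    case (vspan_step p x y)
    then show ?case using assms vspan_add[OF vspan_scale[of x V Y p], of y] by blast
  qed (rule vspan_0)
qed

lemma vspan_mono: "X \<subseteq> Y \<Longrightarrow> vspan V X \<subseteq> vspan V Y"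
  by (rule vspan_subset) (auto intro: vspan_base)

text \<open>A space of vectors supported in finitely many positions is finite-dimensional.  Induction on the set of
positions, with one step of Gaussian elimination per position.\<close>

lemma finite_support_spanned:
  fixes W :: "(nat \<Rightarrow> 'k::field xypoly) set"
  assumes "finite Q" "\<And>f a m. f \<in> W \<Longrightarrow> lookup (f a) m \<noteq> 0 \<Longrightarrow> (a, m) \<in> Q"
    "\<And>f g c. f \<in> W \<Longrightarrow> g \<in> W \<Longrightarrow> (\<lambda>a. f a - single 0 c * g a) \<in> W"
  shows "\<exists>B. finite B \<and> B \<subseteq> W \<and> W \<subseteq> vspan V B"
  using assms
proof (induction Q arbitrary: W rule: finite_induct)
  case empty
  have "f = (\<lambda>_. 0)" if "f \<in> W" for f
    by (rule ext, rule poly_mapping_eqI) (use empty(1)[OF that] in auto)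
  then have "W \<subseteq> vspan V {}" using vspan_0 by blast
  then show ?case by (intro exI[of _ "{}"]) auto
next
  case (insert q Q)
  obtain b k where q: "q = (b, k)" by (cases q)
  define W' where "W' = {f\<in>W. lookup (f b) k = 0}"
  have sc: "lookup (single 0 c * p) k = c * lookup p k" for c :: 'k and p
  proof -
    have "lookup (single 0 c * p) (0 + k) = c * lookup p k"
      by (induction p rule: poly_additive_induct)
         (auto simp: mult_single lookup_single when_def lookup_add algebra_simps)
    then show ?thesis by simp
  qed
  have "\<exists>B. finite B \<and> B \<subseteq> W' \<and> W' \<subseteq> vspan V B"
  proof (rule insert.IH)
    show "(a, m) \<in> Q" if "f \<in> W'" "lookup (f a) m \<noteq> 0" for f a m
      using that insert.prems(1)[of f a m] by (auto simp: W'_def q)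
    show "(\<lambda>a. f a - single 0 c * g a) \<in> W'" if "f \<in> W'" "g \<in> W'" for f g c
      using that insert.prems(2)[of f g c] by (auto simp: W'_def lookup_minus sc)
  qed
  then obtain B where B: "finite B" "B \<subseteq> W'" "W' \<subseteq> vspan V B" by blast
  show ?case
  proof (cases "W' = W")
    case True then show ?thesis using B by blast
  next
    case False
    then obtain w where w: "w \<in> W" "lookup (w b) k \<noteq> 0" by (auto simp: W'_def)
    have "f \<in> vspan V (insert w B)" if f: "f \<in> W" for f
    proof -
      define c where "c = lookup (f b) k / lookup (w b) k"
      have "(\<lambda>a. f a - single 0 c * w a) \<in> W'"
        using insert.prems(2)[OF f w(1), of c] w(2) by (simp add: W'_def lookup_minus sc c_def)
      then have "(\<lambda>a. f a - single 0 c * w a) \<in> vspan V (insert w B)"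
        using B(3) vspan_mono[of B "insert w B" V] by blast
      then have "(\<lambda>a. single 0 c * w a + (f a - single 0 c * w a)) \<in> vspan V (insert w B)"
        by (intro vspan_step) auto
      then show ?thesis by simp
    qed
    then show ?thesis using B(1,2) w(1) by (intro exI[of _ "insert w B"]) (auto simp: W'_def)
  qed
qed

lemma finite_monoms:
  assumes "finite V" shows "finite {m :: monom. keys m \<subseteq> V \<and> monom_degree m = d}"
proof -
  have "lookup ` {m :: monom. keys m \<subseteq> V \<and> monom_degree m = d}
      \<subseteq> {f. \<forall>v. (v \<in> V \<longrightarrow> f v \<in> {..d}) \<and> (v \<notin> V \<longrightarrow> f v = 0)}"
  proof (clarify, intro conjI impI)
    fix m :: monom and v assume m: "keys m \<subseteq> V"
    show "lookup m v \<in> {..monom_degree m}"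
    proof (cases "v \<in> keys m")
      case True
      then show ?thesis unfolding monom_degree_def by (auto intro: member_le_sum)
    qed (simp add: in_keys_iff)
    show "lookup m v = 0" if "v \<notin> V" using that m by (auto simp: in_keys_iff)
  qed
  moreover have "finite {f. \<forall>v. (v \<in> V \<longrightarrow> f v \<in> {..d}) \<and> (v \<notin> V \<longrightarrow> f v = (0::nat))}"
    by (rule finite_set_of_finite_funs) (use assms in auto)
  ultimately have "finite (lookup ` {m :: monom. keys m \<subseteq> V \<and> monom_degree m = d})"
    by (rule finite_subset)
  then show ?thesis
    by (rule finite_imageD) (auto simp: inj_on_def)
qed

lemma vec_eq_sum_vec_comp:
  assumes "f \<in> free_on V ds"
  shows "\<exists>\<D>. finite \<D> \<and> f = (\<lambda>a. \<Sum>D\<in>\<D>. vec_comp ds D f a)"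
proof -
  define \<D> where "\<D> = (\<Union>a<length ds. (\<lambda>m. int (monom_degree m) + ds ! a) ` keys (f a))"
  have fin: "finite \<D>" by (simp add: \<D>_def)
  have "f a = (\<Sum>D\<in>\<D>. vec_comp ds D f a)" for a
  proof (cases "a < length ds")
    case True
    show ?thesis
    proof (rule poly_mapping_eqI)
      fix m
      have "lookup (\<Sum>D\<in>\<D>. vec_comp ds D f a) m
          = (\<Sum>D\<in>\<D>. if D = int (monom_degree m) + ds ! a then lookup (f a) m else 0)"
        unfolding lookup_sum by (rule sum.cong) (use True in \<open>auto simp: vec_comp_def hom_comp_def lookup_mfilter\<close>)
      also have "\<dots> = lookup (f a) m"
      proof (cases "lookup (f a) m = 0")
        case False
        then have "m \<in> keys (f a)" by (simp add: in_keys_iff)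
        then have "int (monom_degree m) + ds ! a \<in> \<D>" using True unfolding \<D>_def by blast
        then show ?thesis using fin by simp
      qed (auto intro: sum.neutral)
      finally show "lookup (f a) m = lookup (\<Sum>D\<in>\<D>. vec_comp ds D f a) m" by simp
    qed
  next
    case False
    then show ?thesis using assms by (simp add: vec_comp_def vecs_def)
  qed
  then show ?thesis using fin by blast
qed

lemma graded_submodule_degree_spanned:
  assumes V: "finite V" and M: "graded_submodule V es M"
  shows "\<exists>B. finite B \<and> B \<subseteq> {f\<in>M. vhomog es D f} \<and> {f\<in>M. vhomog es D f} \<subseteq> vspan V B"
proof (rule finite_support_spanned)
  let ?Q = "\<Union>a<length es. Pair a ` {m :: monom. keys m \<subseteq> V \<and> monom_degree m = nat (D - es ! a)}"
  show "finite ?Q" using finite_monoms[OF V] by blast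
  show "(a, m) \<in> ?Q" if f: "f \<in> {f\<in>M. vhomog es D f}" and m: "lookup (f a) m \<noteq> 0" for f a m
  proof -
    have fv: "f \<in> free_on V es" using f graded_submoduleD(1)[OF M] by blast
    have a: "a < length es" using fv m by (cases "a < length es") (auto simp: vecs_def)
    have mk: "m \<in> keys (f a)" using m by (simp add: in_keys_iff)
    then have "keys m \<subseteq> V" using vecs_polys[OF fv, of a] by (auto simp: polys_def)
    moreover have "int (monom_degree m) = D - es ! a"
      using f a mk by (auto simp: vhomog_def homogeneous_def)
    then have "monom_degree m = nat (D - es ! a)" by simp
    ultimately show ?thesis using a by auto
  qed
  show "(\<lambda>a. f a - single 0 c * g a) \<in> {f\<in>M. vhomog es D f}"
    if "f \<in> {f\<in>M. vhomog es D f}" "g \<in> {f\<in>M. vhomog es D f}" for f g and c :: 'a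
  proof -
    have "(\<lambda>a. single 0 c * g a) \<in> M" by (rule graded_submoduleD(4)[OF M]) (use that in auto)
    then have "(\<lambda>a. f a - single 0 c * g a) \<in> M" using graded_submoduleD(6)[OF M] that by blast
    moreover have "homogeneous (0 + (D - es ! a)) (single 0 c * g a)" if "a < length es" for a
      by (rule homogeneous_mult) (use that \<open>g \<in> _\<close> in \<open>auto simp: homogeneous_single vhomog_def\<close>)
    ultimately show ?thesis using that by (auto simp: vhomog_def intro: homogeneous_diff)
  qed
qed

text \<open>Elements of degree above \<open>r\<close> are boundaries, hence combinations of elements of \<open>M\<close> of degree one less.\<close>

lemma module_reg_generated:
  assumes V: "finite V" and M: "graded_submodule V es M" and k: "module_reg V es M {\<lambda>_. 0} r"
    and X: "\<And>f D. f \<in> M \<Longrightarrow> vhomog es D f \<Longrightarrow> D \<le> r \<Longrightarrow> f \<in> vspan V X"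
  shows "M \<subseteq> vspan V X"
proof
  have hom: "f \<in> vspan V X" if "D \<le> r + int n" "f \<in> M" "vhomog es D f" for n D f
    using that
  proof (induction n arbitrary: D f)
    case 0
    then show ?case using X by simp
  next
    case (Suc n)
    show ?case
    proof (cases "D \<le> r + int n")
      case True then show ?thesis using Suc by blast
    next
      case False
      then have D: "r < D" "D - 1 \<le> r + int n" using Suc.prems(1) by auto
      define z where "z T = (if T = {} then f else (\<lambda>_. 0))" for T :: "var set"
      have "\<exists>w. (\<forall>T\<subseteq>V. w T \<in> M) \<and> (\<forall>T\<subseteq>V. (\<lambda>a. z T a - vbd V w T a) \<in> {\<lambda>_. 0})"
      proof (rule module_regD[OF k D(1)])
        show "z T \<in> M" for T using Suc.prems graded_submoduleD(2)[OF M] by (auto simp: z_def)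
        show "vhomog es D (z T)" for T using Suc.prems by (auto simp: z_def vhomog_def)
        have "vbd V z T = (\<lambda>_. 0)" for T by (rule ext) (simp add: vbd_def bd_def z_def)
        then show "vbd V z T \<in> {\<lambda>_. 0}" for T by simp
      qed
      then obtain w where w1: "\<forall>T\<subseteq>V. w T \<in> M" and w2: "\<forall>T\<subseteq>V. (\<lambda>a. z T a - vbd V w T a) \<in> {\<lambda>_. 0}"
        by (elim exE conjE)
      have w: "w T \<in> M" if "T \<subseteq> V" for T using w1 that by simp
      have "(\<lambda>a. z {} a - vbd V w {} a) = (\<lambda>_. 0)" using w2 by simp
      then have "z {} a - vbd V w {} a = 0" for a by (rule fun_cong)
      then have "f = vbd V w {}" by (intro ext) (simp add: z_def)
      then have "f = vec_comp es D (vbd V w {})" using vec_comp_vhomog[of f V es D] Suc.prems graded_submoduleD(1)[OF M] by auto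
      then have f: "f = (\<lambda>a. \<Sum>v\<in>V. (ksign v {} * indet v) * vec_comp es (D - 1) (w {v}) a)"
        by (simp add: vec_comp_vbd) (simp add: vbd_def bd_def mult.assoc)
      have "(\<lambda>a. \<Sum>v\<in>V. (ksign v {} * indet v) * vec_comp es (D - 1) (w {v}) a) \<in> vspan V X"
      proof (rule vspan_sum, rule vspan_scale)
        fix v assume v: "v \<in> V"
        show "vec_comp es (D - 1) (w {v}) \<in> vspan V X"
          by (rule Suc.IH[OF D(2) graded_submoduleD(5)[OF M w] vhomog_vec_comp]) (use v in simp)
      qed simp
      then show ?thesis using f by simp
    qed
  qed
  fix f assume f: "f \<in> M"
  have "vec_comp es D f \<in> vspan V X" for D
    by (rule hom[OF _ graded_submoduleD(5)[OF M f] vhomog_vec_comp, of D "nat (D - r)"]) simp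
  then have "(\<lambda>a. \<Sum>D\<in>\<D>. vec_comp es D f a) \<in> vspan V X" for \<D> by (rule vspan_sum)
  moreover obtain \<D> where "f = (\<lambda>a. \<Sum>D\<in>\<D>. vec_comp es D f a)"
    using vec_eq_sum_vec_comp[OF subsetD[OF graded_submoduleD(1)[OF M] f]] by blast
  ultimately show "f \<in> vspan V X" by metis
qed

text \<open>Generators are needed in the finitely many degrees between the least basis degree and \<open>r\<close> only, and each
homogeneous piece is finite-dimensional.\<close>

lemma finitely_generated:
  assumes V: "finite V" and M: "graded_submodule V es M" and k: "module_reg V es M {\<lambda>_. 0} r"
  shows "\<exists>X. finite X \<and> X \<subseteq> M \<and> (\<forall>x\<in>X. \<exists>D. vhomog es D x) \<and> M \<subseteq> vspan V X"
proof -
  obtain B where B: "\<And>D. finite (B D)" "\<And>D. B D \<subseteq> {f\<in>M. vhomog es D f}" "\<And>D. {f\<in>M. vhomog es D f} \<subseteq> vspan V (B D)"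
  proof -
    have "\<exists>B. \<forall>D. finite (B D) \<and> B D \<subseteq> {f\<in>M. vhomog es D f} \<and> {f\<in>M. vhomog es D f} \<subseteq> vspan V (B D)"
      by (rule choice, rule allI, rule graded_submodule_degree_spanned[OF V M])
    then show thesis using that by blast
  qed
  \<comment> \<open>The inserted \<open>0\<close> only keeps the minimum defined when there are no basis elements.\<close>
  define X where "X = (\<Union>D\<in>{Min (insert 0 (set es))..r}. B D)"
  have "M \<subseteq> vspan V X"
  proof (rule module_reg_generated[OF V M k])
    fix f D assume f: "f \<in> M" "vhomog es D f" and D: "D \<le> r"
    show "f \<in> vspan V X"
    proof (cases "Min (insert 0 (set es)) \<le> D")
      case True
      then have "B D \<subseteq> X" using D by (auto simp: X_def)
      then show ?thesis using B(3)[of D] f vspan_mono by blast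
    next
      case False
      have "f a = 0" for a
      proof (cases "a < length es")
        case True
        have "Min (insert 0 (set es)) \<le> es ! a" using True by (intro Min_le) auto
        then have "D - es ! a < 0" using False by linarith
        moreover have "homogeneous (D - es ! a) (f a)" using f(2) True by (simp add: vhomog_def)
        ultimately show ?thesis by (intro homogeneous_negative)
      next
        case False then show ?thesis using f(1) graded_submoduleD(1)[OF M] by (auto simp: vecs_def)
      qed
      then have "f = (\<lambda>_. 0)" by auto
      then show ?thesis by (simp add: vspan_0)
    qed
  qed
  moreover have "finite X" unfolding X_def using B(1) by blast
  moreover have "x \<in> M \<and> (\<exists>D. vhomog es D x)" if x: "x \<in> X" for x
  proof -
    obtain D where "x \<in> B D" using x unfolding X_def by blast
    then show ?thesis using subsetD[OF B(2)[of D]] by auto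
  qed
  ultimately show ?thesis by (intro exI[of _ X]) auto
qed

text \<open>Take a homogeneous generating set with the least number of elements.  A relation in which some
generator has a coefficient with nonzero constant term has a homogeneous component in which that
coefficient is a nonzero constant, and this makes the generator redundant.\<close>

lemma minimal_presentation:
  assumes V: "finite V" and M: "graded_submodule V es M" and k: "module_reg V es M {\<lambda>_. 0} r"
  shows "\<exists>ds A. graded_matrix V ds es A \<and> map_on ds A ` free_on V ds = M \<and> const_free (syzygies V ds A {\<lambda>_. 0})"
proof -
  define gen where "gen X \<longleftrightarrow> finite X \<and> X \<subseteq> M \<and> (\<forall>x\<in>X. \<exists>D. vhomog es D x) \<and> M \<subseteq> vspan V X" for X
  obtain X0 where "gen X0" using finitely_generated[OF V M k] unfolding gen_def by blast
  then obtain X where X: "gen X" and least: "\<And>Y. gen Y \<Longrightarrow> card X \<le> card Y"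
  proof -
    have "\<exists>X. gen X \<and> (\<forall>Y. gen Y \<longrightarrow> card X \<le> card Y)"
      by (rule ex_has_least_nat[of gen X0 card, OF \<open>gen X0\<close>])
    then show thesis using that by blast
  qed
  have finX: "finite X" and XM: "X \<subseteq> M" and "\<forall>x\<in>X. \<exists>D. vhomog es D x" and MX: "M \<subseteq> vspan V X"
    using X by (auto simp: gen_def)
  then obtain deg where deg: "\<And>x. x \<in> X \<Longrightarrow> vhomog es (deg x) x" using bchoice by metis
  obtain xs where xs: "set xs = X" "distinct xs" using finite_distinct_list[OF finX] by blast
  define ds where "ds = map deg xs"
  define A where "A a b = (if b < length xs then (xs ! b) a else 0)" for a b
  have len: "length ds = length xs" by (simp add: ds_def)
  have xM: "xs ! b \<in> M" "xs ! b \<in> X" "xs ! b \<in> free_on V es" "vhomog es (ds ! b) (xs ! b)" if "b < length xs" for b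
    using that xs X deg[of "xs ! b"] graded_submoduleD(1)[OF M] nth_mem[of b xs] unfolding gen_def ds_def by auto
  have A: "graded_matrix V ds es A"
    unfolding graded_matrix_def len
  proof (intro conjI allI impI)
    fix a b assume ab: "a < length es" "b < length xs"
    show "A a b \<in> polys V" using xM(3)[OF ab(2)] ab by (simp add: A_def vecs_polys)
    show "homogeneous (ds ! b - es ! a) (A a b)" using xM(4)[OF ab(2)] ab by (simp add: A_def vhomog_def)
  next
    fix a b assume a: "length es \<le> a"
    show "A a b = 0" using xM(3)[of b] a by (auto simp: A_def vecs_def)
  qed
  have appA: "map_on ds A v = (\<lambda>a. \<Sum>b<length xs. v b * (xs ! b) a)" for v
    by (rule ext) (simp add: mat_app_def len A_def mult.commute)
  have appM: "map_on ds A v \<in> M" if "v \<in> free_on V ds" for v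
    unfolding appA by (rule graded_submodule_sum[OF M], rule graded_submoduleD(4)[OF M]) (use xM that vecs_polys in auto)
  have "f \<in> map_on ds A ` free_on V ds" if "f \<in> vspan V X" for f
    using that
  proof (induction rule: vspan.induct)
    case vspan_0
    have "map_on ds A (\<lambda>_. 0) \<in> map_on ds A ` free_on V ds"
      by (rule imageI[OF vecs_closed(1)])
    then show ?case by (simp only: mat_app_zero)
  next
    case (vspan_step p x y)
    then obtain v where v: "v \<in> free_on V ds" "y = map_on ds A v" by blast
    obtain b where b: "b < length xs" "x = xs ! b" using vspan_step(2) xs by (metis in_set_conv_nth)
    have e: "map_on ds A (\<lambda>a. p * basis_vec b a + v a) = (\<lambda>a. p * x a + y a)"
      using b by (simp add: mat_app_add mat_app_scale mat_app_basis_vec len v(2)) (simp add: A_def)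
    have "(\<lambda>a. p * basis_vec b a + v a) \<in> free_on V ds"
      by (intro vecs_closed(2)[OF vecs_closed(4)[OF basis_vec_vecs vspan_step(1)] v(1)]) (use b len in simp)
    then have "map_on ds A (\<lambda>a. p * basis_vec b a + v a) \<in> map_on ds A ` free_on V ds"
      by (rule imageI)
    then show ?case by (simp only: e)
  qed
  then have img: "map_on ds A ` free_on V ds = M"
    using appM X unfolding gen_def by blast
  have "lookup (v b) 0 = 0" if v: "v \<in> free_on V ds" and Av: "map_on ds A v = (\<lambda>_. 0)" for v b
  proof (rule ccontr)
    assume c: "lookup (v b) 0 \<noteq> 0"
    then have b: "b < length xs" using v len by (cases "b < length xs") (auto simp: vecs_def)
    define u where "u = vec_comp ds (ds ! b) v"
    have uv: "u \<in> free_on V ds" unfolding u_def by (rule vec_comp_vecs[OF v])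
    have "map_on ds A u = vec_comp es (ds ! b) (\<lambda>_. 0)" unfolding u_def mat_app_vec_comp[OF A] Av ..
    also have "\<dots> = (\<lambda>_. 0)" by (rule ext) (simp add: vec_comp_def)
    finally have Au: "(\<Sum>b<length xs. u b * (xs ! b) a) = 0" for a using appA by metis
    have "u b = hom_comp 0 (v b)" using b len by (simp add: u_def vec_comp_def)
    also have "\<dots> = single 0 (lookup (hom_comp 0 (v b)) 0)"
      by (rule homogeneous_degree_0_eq_constant) simp
    also have "\<dots> = single 0 (lookup (v b) 0)" by (simp add: hom_comp_def lookup_mfilter)
    finally have ub: "u b = single 0 (lookup (v b) 0)" .
    \<comment> \<open>The factor that solves the relation \<open>u\<close> for its \<open>b\<close>-th generator.\<close>
    let ?e = "single 0 (- 1 / lookup (v b) 0) :: 'a xypoly"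
    have xb: "xs ! b = (\<lambda>a. \<Sum>b'\<in>{..<length xs} - {b}. (?e * u b') * (xs ! b') a)"
    proof (rule ext)
      fix a
      have "u b * (xs ! b) a = - (\<Sum>b'\<in>{..<length xs} - {b}. u b' * (xs ! b') a)"
        using Au[of a] b by (simp add: sum.remove[of _ b] eq_neg_iff_add_eq_0)
      then have "?e * (u b * (xs ! b) a) = - (\<Sum>b'\<in>{..<length xs} - {b}. (?e * u b') * (xs ! b') a)"
        by (simp add: sum_distrib_left mult.assoc)
      moreover have "?e * u b = - 1"
        using c by (simp add: ub mult_single single_uminus)
      then have "?e * (u b * (xs ! b) a) = - (xs ! b) a" by (simp add: mult.assoc[symmetric])
      ultimately show "(xs ! b) a = (\<Sum>b'\<in>{..<length xs} - {b}. (?e * u b') * (xs ! b') a)" by simp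
    qed
    have "(\<lambda>a. \<Sum>b'\<in>{..<length xs} - {b}. (?e * u b') * (xs ! b') a) \<in> vspan V (X - {xs ! b})"
    proof (rule vspan_sum, rule vspan_scale)
      fix b' assume b': "b' \<in> {..<length xs} - {b}"
      then have "xs ! b' \<noteq> xs ! b" using xs(2) b by (auto simp: nth_eq_iff_index_eq)
      then show "xs ! b' \<in> vspan V (X - {xs ! b})" using xM(2) b' by (intro vspan_base) auto
      show "?e * u b' \<in> polys V" using vecs_polys[OF uv] by simp
    qed
    then have "xs ! b \<in> vspan V (X - {xs ! b})" by (simp only: xb[symmetric])
    then have "X \<subseteq> vspan V (X - {xs ! b})" using vspan_base[of _ "X - {xs ! b}" V] by blast
    then have "vspan V X \<subseteq> vspan V (X - {xs ! b})" by (rule vspan_subset)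
    then have "gen (X - {xs ! b})" using X unfolding gen_def by blast
    then have "card X \<le> card (X - {xs ! b})" by (rule least)
    moreover have "card (X - {xs ! b}) < card X"
      using X xM(2)[OF b] unfolding gen_def by (intro psubset_card_mono) auto
    ultimately show False by simp
  qed
  then have "const_free (syzygies V ds A {\<lambda>_. 0})" by (simp add: const_free_def syzygies_def)
  then show ?thesis using A img by blast
qed

lemma presents_image:
  assumes "finite V" "graded_matrix V ds es A" "graded_submodule V es M" "map_on ds A ` free_on V ds = M"
  shows "presents V ds es A M {\<lambda>_. 0}"
  unfolding presents_def
proof (intro conjI ballI)
  fix m assume "m \<in> M"
  then obtain v where "v \<in> free_on V ds" "m = map_on ds A v" using assms(4) by blast
  then show "\<exists>v\<in>free_on V ds. (\<lambda>a. m a - map_on ds A v a) \<in> {\<lambda>_. 0}"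
    by (intro bexI[of _ v]) auto
qed (use assms graded_submodule_zero graded_submoduleD(2)[OF assms(3)] in auto)

text \<open>The invariant of the construction of a minimal resolution: \<open>Z\<close> is the syzygy module that the next step
has to generate, and const-freeness records the minimality of the previous step.\<close>

definition syzygy_invariant :: "var set \<Rightarrow> int \<Rightarrow> int list \<Rightarrow> (nat \<Rightarrow> 'k::field xypoly) set \<Rightarrow> bool" where
  "syzygy_invariant V r ds Z \<longleftrightarrow> graded_submodule V ds Z \<and> module_reg V ds Z {\<lambda>_. 0} r \<and> const_free Z"

lemma syzygy_invariant_step:
  assumes V: "finite V" and g: "syzygy_invariant V r es M"
  shows "\<exists>ds A. graded_matrix V ds es A \<and> map_on ds A ` free_on V ds = M
    \<and> syzygy_invariant V (r + 1) ds (syzygies V ds A {\<lambda>_. 0})"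
proof -
  have M: "graded_submodule V es M" and k: "module_reg V es M {\<lambda>_. 0} r" using g by (auto simp: syzygy_invariant_def)
  obtain ds A where A: "graded_matrix V ds es A" "map_on ds A ` free_on V ds = M"
    "const_free (syzygies V ds A {\<lambda>_. 0})" using minimal_presentation[OF V M k] by blast
  have p: "presents V ds es A M {\<lambda>_. 0}" by (rule presents_image[OF V A(1) M A(2)])
  have "module_reg V ds (syzygies V ds A {\<lambda>_. 0}) {\<lambda>_. 0} (r + 1)"
    by (rule module_reg_syzygies[OF p minimal_degrees_le[OF p k A(3)] k])
  moreover have "graded_submodule V ds (syzygies V ds A {\<lambda>_. 0})"
    unfolding syzygies_def by (rule graded_submodule_preimage[OF A(1) graded_submodule_zero])
  ultimately show ?thesis using A by (auto simp: syzygy_invariant_def)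
qed

section \<open>Matrices, residue classes and the regularity\<close>

definition vars :: "nat \<Rightarrow> var set" where
  "vars n = VarX ` {1..n} \<union> VarY ` {1..n}"

lemma carrier_poly_ring: "carrier (poly_ring n) = polys (vars n)"
  by (simp add: poly_ring_def polys_def vars_def)

lemma poly_ring_simps [simp]:
  "monoid.mult (poly_ring n) = (*)" "monoid.one (poly_ring n) = 1"
  "ring.zero (poly_ring n) = 0" "ring.add (poly_ring n) = (+)"
  by (simp_all add: poly_ring_def)

lemma ring_poly_ring: "ring (poly_ring n :: 'k::field xypoly ring)"
proof (rule ringI)
  show "abelian_group (poly_ring n :: 'k xypoly ring)"
  proof (rule abelian_groupI)
    fix x :: "'k xypoly" assume "x \<in> carrier (poly_ring n)"
    then show "\<exists>y\<in>carrier (poly_ring n). y \<oplus>\<^bsub>poly_ring n\<^esub> x = \<zero>\<^bsub>poly_ring n\<^esub>"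
      by (intro bexI[of _ "- x"]) (auto simp: carrier_poly_ring)
  qed (auto simp: carrier_poly_ring add.assoc add.commute)
  show "monoid (poly_ring n :: 'k xypoly ring)"
    by (rule monoidI) (auto simp: carrier_poly_ring mult.assoc)
qed (auto simp: carrier_poly_ring algebra_simps)

lemma uminus_poly_ring: "x \<in> polys (vars n) \<Longrightarrow> \<ominus>\<^bsub>poly_ring n\<^esub> x = - x"
proof -
  interpret ring "poly_ring n" by (rule ring_poly_ring)
  assume "x \<in> polys (vars n)"
  then show ?thesis by (intro minus_equality) (auto simp: carrier_poly_ring)
qed

lemma gen_ideal_ideal:
  assumes "G \<subseteq> polys (vars n)" shows "ideal (gen_ideal (vars n) G) (poly_ring n)"
proof (rule idealI[OF ring_poly_ring])
  have p: "gen_ideal (vars n) G \<subseteq> polys (vars n)" by (rule gen_ideal_polys[OF assms])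
  interpret ring "poly_ring n" by (rule ring_poly_ring)
  have r: "a * x \<in> gen_ideal (vars n) G" if "a \<in> gen_ideal (vars n) G" "x \<in> polys (vars n)" for a x
    using gen_ideal_mult[OF that] by (simp add: mult.commute)
  show "subgroup (gen_ideal (vars n) G) (add_monoid (poly_ring n))"
  proof (rule add.subgroupI)
    show "gen_ideal (vars n) G \<subseteq> carrier (poly_ring n)" using p by (simp add: carrier_poly_ring)
    show "gen_ideal (vars n) G \<noteq> {}" using gen_ideal_0 by blast
    show "\<ominus>\<^bsub>poly_ring n\<^esub> a \<in> gen_ideal (vars n) G" if "a \<in> gen_ideal (vars n) G" for a
      using that p by (auto simp: uminus_poly_ring gen_ideal_uminus)
  qed (auto intro: gen_ideal_add)
  show "x \<otimes>\<^bsub>poly_ring n\<^esub> a \<in> gen_ideal (vars n) G" "a \<otimes>\<^bsub>poly_ring n\<^esub> x \<in> gen_ideal (vars n) G"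
    if "a \<in> gen_ideal (vars n) G" "x \<in> carrier (poly_ring n)" for a x
    using that r gen_ideal_mult by (auto simp: carrier_poly_ring)
qed

lemma genideal_eq_gen_ideal:
  assumes "G \<subseteq> polys (vars n)" shows "genideal (poly_ring n) G = gen_ideal (vars n) G"
proof
  show "genideal (poly_ring n) G \<subseteq> gen_ideal (vars n) G"
    unfolding genideal_def using gen_ideal_ideal[OF assms] gen_ideal_gen by blast
  show "gen_ideal (vars n) G \<subseteq> genideal (poly_ring n) G"
  proof
    fix f assume "f \<in> gen_ideal (vars n) G"
    then show "f \<in> genideal (poly_ring n) G"
    proof (induction rule: gen_ideal.induct)
      case gen_ideal_0
      show ?case unfolding genideal_def
        using additive_subgroup.zero_closed[OF ideal.axioms(1)] by fastforce
    next
      case (gen_ideal_step p g q)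
      show ?case unfolding genideal_def
      proof (clarify)
        fix I assume I: "ideal I (poly_ring n)" "G \<subseteq> I"
        have "p * g \<in> I" using ideal.I_l_closed[OF I(1), of g p] I(2) gen_ideal_step by (auto simp: carrier_poly_ring)
        moreover have "q \<in> I" using gen_ideal_step(4) I unfolding genideal_def by blast
        ultimately show "p * g + q \<in> I" using additive_subgroup.a_closed[OF ideal.axioms(1)[OF I(1)]] by fastforce
      qed
    qed
  qed
qed

lemma binomial_edge_ideal_eq:
  assumes "simple_graph {1..n} E"
  shows "binomial_edge_ideal n E = edge_ideal (vars n) {} E" "admissible (vars n) {} E"
proof -
  have E: "i \<in> {1..n} \<and> j \<in> {1..n} \<and> i \<noteq> j" if "{i, j} \<in> E" for i j
    using assms that unfolding simple_graph_def by force
  show adm: "admissible (vars n) {} E"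
    using assms unfolding simple_graph_def admissible_def vars_def by auto
  let ?G = "{xvar i * yvar j - xvar j * yvar i | i j. i < j \<and> {i, j} \<in> E} :: 'a xypoly set"
  have P: "edge_gens {} E \<subseteq> (polys (vars n) :: 'a xypoly set)"
    by (rule edge_gens_polys) (use admissibleD(4)[OF adm] in auto)
  have G: "?G \<subseteq> edge_gens {} E" by (auto simp: edge_gens_def edge_binom_def)
  have "edge_gens {} E \<subseteq> gen_ideal (vars n) ?G"
  proof
    fix g :: "'a xypoly" assume "g \<in> edge_gens {} E"
    then obtain i j where ij: "{i, j} \<in> E" "g = edge_binom i j" unfolding edge_gens_def by auto
    consider "i < j" | "j < i" using E[OF ij(1)] by linarith
    then show "g \<in> gen_ideal (vars n) ?G"
    proof cases
      case 1
      then show ?thesis using ij by (intro gen_ideal_gen) (auto simp: edge_binom_def)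
    next
      case 2
      have "{j, i} \<in> E" using ij(1) by (simp add: insert_commute)
      then have "edge_binom j i \<in> gen_ideal (vars n) ?G"
        unfolding edge_binom_def using 2 by (intro gen_ideal_gen CollectI exI[of _ j] exI[of _ i]) simp
      then show ?thesis unfolding ij(2) edge_binom_swap[of i j] by (rule gen_ideal_uminus)
    qed
  qed
  then have "gen_ideal (vars n) ?G = edge_ideal (vars n) {} E"
    by (intro equalityI gen_ideal_mono[OF G]) (rule gen_ideal_least)
  then show "binomial_edge_ideal n E = (edge_ideal (vars n) {} E :: 'a xypoly set)"
    unfolding binomial_edge_ideal_def using genideal_eq_gen_ideal[of ?G n] G P by simp
qed

subsection \<open>Vectors as functions\<close>

definition fvec :: "'k::field xypoly vec \<Rightarrow> nat \<Rightarrow> 'k xypoly" where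
  "fvec v = (\<lambda>a. if a < dim_vec v then v $ a else 0)"

definition fmat :: "'k::field xypoly mat \<Rightarrow> nat \<Rightarrow> nat \<Rightarrow> 'k xypoly" where
  "fmat A = (\<lambda>a b. if a < dim_row A \<and> b < dim_col A then A $$ (a, b) else 0)"

lemma fvec_inj: "dim_vec v = dim_vec w \<Longrightarrow> fvec v = fvec w \<Longrightarrow> v = w"
proof (rule eq_vecI)
  fix i assume "dim_vec v = dim_vec w" "fvec v = fvec w" "i < dim_vec w"
  have "fvec v i = fvec w i" using \<open>fvec v = fvec w\<close> by (rule fun_cong)
  then show "v $ i = w $ i" using \<open>i < dim_vec w\<close> \<open>dim_vec v = dim_vec w\<close> by (simp add: fvec_def)
qed

lemma fvec_vec: "f \<in> vecs V k \<Longrightarrow> fvec (vec k f) = f"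
  by (rule ext) (auto simp: fvec_def vecs_def)

lemma free_module_iff: "v \<in> free_module n ds \<longleftrightarrow> dim_vec v = length ds \<and> fvec v \<in> free_on (vars n) ds"
  by (auto simp: free_module_def fvec_def vecs_def carrier_poly_ring)

lemma fvec_free_module: "fvec ` free_module n ds = free_on (vars n) ds" (is "?L = ?R")
proof (rule equalityI; rule subsetI)
  fix f assume "f \<in> ?R"
  then show "f \<in> ?L"
    by (intro image_eqI[of _ _ "vec (length ds) f"]) (auto simp: free_module_iff fvec_vec)
qed (auto simp: free_module_iff)

lemma fvec_zero: "fvec (0\<^sub>v k) = (\<lambda>_. 0)"
  by (auto simp: fvec_def)

lemma fvec_mult_mat_vec:
  assumes "A \<in> carrier_mat k l" "dim_vec v = l"
  shows "fvec (A *\<^sub>v v) = mat_app l (fmat A) (fvec v)"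
proof (rule ext)
  fix a
  show "fvec (A *\<^sub>v v) a = mat_app l (fmat A) (fvec v) a"
    using assms by (auto simp: fvec_def fmat_def mat_app_def scalar_prod_def atLeast0LessThan)
qed

lemma graded_map_iff: "graded_map n ds es A \<longleftrightarrow>
    A \<in> carrier_mat (length es) (length ds) \<and> graded_matrix (vars n) ds es (fmat A)"
  by (auto simp: graded_map_def graded_matrix_def fmat_def carrier_poly_ring)

lemma fmat_mat:
  assumes "graded_matrix V ds es A" "b < length ds"
  shows "fmat (mat (length es) (length ds) (\<lambda>(a, b). A a b)) a b = A a b"
  using assms by (auto simp: fmat_def graded_matrix_def)

text \<open>Comparing sets of vectors through \<open>fvec\<close> is faithful only among vectors of one length.\<close>

lemma free_module_eq_iff:
  assumes "S \<subseteq> free_module n ds" "\<And>v. v \<in> S' \<Longrightarrow> dim_vec v = length ds"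
  shows "S = S' \<longleftrightarrow> fvec ` S = fvec ` S'"
proof -
  have "inj_on fvec (S \<union> S')"
  proof (rule inj_onI)
    have "dim_vec v = length ds" if "v \<in> S \<union> S'" for v
      using that assms by (auto simp: free_module_def)
    then show "v = w" if "v \<in> S \<union> S'" "w \<in> S \<union> S'" "fvec v = fvec w" for v w
      using that by (intro fvec_inj) simp_all
  qed
  then show ?thesis using inj_on_Un_image_eq_iff by metis
qed

lemma fvec_image_mult:
  assumes "A \<in> carrier_mat k (length ds)"
  shows "fvec ` (\<lambda>w. A *\<^sub>v w) ` free_module n ds
    = map_on ds (fmat A) ` free_on (vars n) ds"
proof -
  have "fvec (A *\<^sub>v w) = map_on ds (fmat A) (fvec w)" if "w \<in> free_module n ds" for w
    using fvec_mult_mat_vec[OF assms] that by (simp add: free_module_iff)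
  then show ?thesis unfolding fvec_free_module[symmetric] image_image by (rule image_cong[OF refl])
qed

lemma fvec_image_kernel:
  assumes "\<And>v. v \<in> free_module n ds \<Longrightarrow> P v \<longleftrightarrow> map_on ds A (fvec v) \<in> N"
  shows "fvec ` {v \<in> free_module n ds. P v} = syzygies (vars n) ds A N"
proof -
  have "fvec ` {v \<in> free_module n ds. P v} = {f \<in> fvec ` free_module n ds. map_on ds A f \<in> N}"
    using assms by auto
  then show ?thesis by (simp add: fvec_free_module syzygies_def)
qed

lemma coset_eq: "I +>\<^bsub>poly_ring n\<^esub> a = (\<lambda>h. h + a) ` I"
  by (auto simp: a_r_coset_def')

lemma coset_eq_iff:
  assumes I: "graded_ideal V I" shows "(\<lambda>h. h + a) ` I = (\<lambda>h. h + b) ` I \<longleftrightarrow> a - b \<in> I"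
proof
  assume e: "(\<lambda>h. h + a) ` I = (\<lambda>h. h + b) ` I"
  have "0 + a \<in> (\<lambda>h. h + a) ` I" using graded_idealD(2)[OF I] by blast
  then obtain h where "h \<in> I" "0 + a = h + b" unfolding e by blast
  then show "a - b \<in> I" by simp
next
  have *: "(\<lambda>h. h + a) ` I \<subseteq> (\<lambda>h. h + b) ` I" if "a - b \<in> I" for a b
  proof
    fix x assume "x \<in> (\<lambda>h. h + a) ` I"
    then obtain h where "h \<in> I" "x = (h + (a - b)) + b" by auto
    then show "x \<in> (\<lambda>h. h + b) ` I" using graded_idealD(3)[OF I _ that] by blast
  qed
  assume "a - b \<in> I"
  moreover from this have "b - a \<in> I" using graded_idealD(6)[OF I, of "a - b"] by simp
  ultimately show "(\<lambda>h. h + a) ` I = (\<lambda>h. h + b) ` I" using * by blast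
qed

text \<open>The ideal as a submodule of the free module of rank one.\<close>

definition ideal_vecs :: "var set \<Rightarrow> 'k::field xypoly set \<Rightarrow> (nat \<Rightarrow> 'k xypoly) set" where
  "ideal_vecs V I = {f \<in> vecs V 1. f 0 \<in> I}"

text \<open>Minimal graded free resolutions of \<open>S/I\<close> in terms of functions instead of matrices; cosets of \<open>I\<close> are
replaced by congruence modulo \<open>I\<close>.\<close>

definition function_resolution :: "var set \<Rightarrow> 'k::field xypoly set \<Rightarrow> (nat \<Rightarrow> int list)
    \<Rightarrow> (nat \<Rightarrow> nat \<Rightarrow> nat \<Rightarrow> 'k xypoly) \<Rightarrow> bool" where
  "function_resolution V I gens A \<longleftrightarrow>
    presents V (gens 0) [0] (A 0) (vecs V 1) (ideal_vecs V I) \<and>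
    (\<forall>i. graded_matrix V (gens (Suc i)) (gens i) (A (Suc i))) \<and>
    syzygies V (gens 0) (A 0) (ideal_vecs V I) = map_on (gens 1) (A 1) ` free_on V (gens 1) \<and>
    (\<forall>i. syzygies V (gens (Suc i)) (A (Suc i)) {\<lambda>_. 0}
      = map_on (gens (Suc (Suc i))) (A (Suc (Suc i))) ` free_on V (gens (Suc (Suc i)))) \<and>
    (\<forall>i. const_free (map_on (gens (Suc i)) (A (Suc i)) ` free_on V (gens (Suc i))))"

lemma graded_submodule_ideal_vecs:
  assumes "graded_ideal V I" shows "graded_submodule V [0] (ideal_vecs V I)"
  using vec_comp_vecs[of _ V "[0]"] graded_idealD(2-5)[OF assms]
  by (auto simp: graded_submodule_def ideal_vecs_def) (auto simp: vec_comp_def)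

lemma const_free_image_iff:
  assumes A: "graded_matrix V ds es A"
  shows "const_free (map_on ds A ` free_on V ds)
    \<longleftrightarrow> (\<forall>a<length es. \<forall>b<length ds. lookup (A a b) 0 = 0)"
proof
  assume c: "const_free (map_on ds A ` free_on V ds)"
  show "\<forall>a<length es. \<forall>b<length ds. lookup (A a b) 0 = 0"
  proof (intro allI impI)
    fix a b assume "b < length ds"
    then have "map_on ds A (basis_vec b) \<in> map_on ds A ` free_on V ds"
      by (intro imageI basis_vec_vecs)
    then have "(\<lambda>a. A a b) \<in> map_on ds A ` free_on V ds"
      using mat_app_basis_vec[OF \<open>b < length ds\<close>, of A] by (simp only:)
    then show "lookup (A a b) 0 = 0" using c unfolding const_free_def by fast
  qed
next
  assume c: "\<forall>a<length es. \<forall>b<length ds. lookup (A a b) 0 = 0"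
  have "lookup (A a b * v b) 0 = 0" if "b < length ds" for a b v
    using c that A by (cases "a < length es") (auto simp: lookup_0_mult graded_matrix_def)
  then show "const_free (map_on ds A ` free_on V ds)"
    by (auto simp: const_free_def mat_app_def lookup_sum)
qed

lemma presents_cyclic_iff:
  assumes V: "finite V" and I: "graded_ideal V I"
  shows "presents V ds [0] A (vecs V 1) (ideal_vecs V I) \<longleftrightarrow> graded_matrix V ds [0] A \<and>
    (\<forall>p\<in>polys V. \<exists>v\<in>free_on V ds. p - map_on ds A v 0 \<in> I)"
proof -
  have M: "graded_submodule V [0] (vecs V 1)" using graded_submodule_vecs[of V "[0]"] by simp
  have N: "graded_submodule V [0] (ideal_vecs V I)" "ideal_vecs V I \<subseteq> vecs V 1"
    using graded_submodule_ideal_vecs[OF I] by (auto simp: ideal_vecs_def)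
  have mat_app1: "map_on ds A v \<in> vecs V 1" if "graded_matrix V ds [0] A" "v \<in> free_on V ds" for v
    using mat_app_vecs[OF that] by simp
  have diff: "(\<lambda>a. m a - map_on ds A v a) \<in> ideal_vecs V I \<longleftrightarrow> m 0 - map_on ds A v 0 \<in> I"
    if "graded_matrix V ds [0] A" "v \<in> free_on V ds" "m \<in> vecs V 1" for v m
    using vecs_closed(3)[OF that(3) mat_app1[OF that(1,2)]] by (simp add: ideal_vecs_def)
  have ex: "(\<lambda>a. if a = 0 then p else 0) \<in> vecs V 1" if "p \<in> polys V" for p
    using that by (auto simp: vecs_def)
  have pol: "m 0 \<in> polys V" if "m \<in> vecs V 1" for m using that by (rule vecs_polys)
  have "(\<forall>m\<in>vecs V 1. \<exists>v\<in>free_on V ds. (\<lambda>a. m a - map_on ds A v a) \<in> ideal_vecs V I)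
      \<longleftrightarrow> (\<forall>p\<in>polys V. \<exists>v\<in>free_on V ds. p - map_on ds A v 0 \<in> I)" (is "?L \<longleftrightarrow> ?R")
    if A: "graded_matrix V ds [0] A"
  proof
    assume L: ?L
    show ?R
    proof
      fix p :: "'a xypoly" assume p: "p \<in> polys V"
      then obtain v where "v \<in> free_on V ds"
        "(\<lambda>a. (if a = 0 then p else 0) - map_on ds A v a) \<in> ideal_vecs V I"
        using bspec[OF L ex[OF p]] by blast
      then show "\<exists>v\<in>free_on V ds. p - map_on ds A v 0 \<in> I"
        using diff[OF A _ ex[OF p], of v] by auto
    qed
  next
    assume R: ?R
    show ?L
    proof
      fix m :: "nat \<Rightarrow> 'a xypoly" assume m: "m \<in> vecs V 1"
      then obtain v where "v \<in> free_on V ds" "m 0 - map_on ds A v 0 \<in> I"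
        using bspec[OF R pol[OF m]] by blast
      then show "\<exists>v\<in>free_on V ds. (\<lambda>a. m a - map_on ds A v a) \<in> ideal_vecs V I"
        using diff[OF A _ m, of v] by auto
    qed
  qed
  then show ?thesis unfolding presents_def using V M N mat_app1 by blast
qed

lemma finite_vars: "finite (vars n)"
  by (simp add: vars_def)

lemma minimal_graded_free_resolution_iff:
  assumes I: "graded_ideal (vars n) I"
  shows "minimal_graded_free_resolution n I gens d \<longleftrightarrow>
    d 0 \<in> carrier_mat 1 (length (gens 0)) \<and>
    (\<forall>i. d (Suc i) \<in> carrier_mat (length (gens i)) (length (gens (Suc i)))) \<and>
    function_resolution (vars n) I gens (\<lambda>i. fmat (d i))"
proof (cases "d 0 \<in> carrier_mat 1 (length (gens 0)) \<and>
    (\<forall>i. d (Suc i) \<in> carrier_mat (length (gens i)) (length (gens (Suc i))))")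
  case False
  then show ?thesis unfolding minimal_graded_free_resolution_def graded_map_iff by auto
next
  case True
  then have d0: "d 0 \<in> carrier_mat 1 (length (gens 0))"
    and d: "\<And>i. d (Suc i) \<in> carrier_mat (length (gens i)) (length (gens (Suc i)))" by auto
  let ?V = "vars n" and ?A = "\<lambda>i. fmat (d i)"
  let ?f = "\<lambda>i. map_on (gens i) (?A i)" and ?F = "\<lambda>i. free_on ?V (gens i)"
  have g0: "graded_map n (gens 0) [0] (d 0) \<longleftrightarrow> graded_matrix ?V (gens 0) [0] (?A 0)"
    using d0 by (simp add: graded_map_iff)
  have g: "graded_map n (gens (Suc i)) (gens i) (d (Suc i)) \<longleftrightarrow> graded_matrix ?V (gens (Suc i)) (gens i) (?A (Suc i))" for i
    using d by (simp add: graded_map_iff)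
  have aug: "augmentation n I (d 0) v = (\<lambda>h. h + ?f 0 (fvec v) 0) ` I"
    if "v \<in> free_module n (gens 0)" for v
  proof -
    have "fvec (d 0 *\<^sub>v v) 0 = (d 0 *\<^sub>v v) $ 0" using d0 by (simp add: fvec_def)
    then show ?thesis using fvec_mult_mat_vec[OF d0, of v] that
      by (simp add: augmentation_def coset_eq free_module_iff)
  qed
  have carr: "carrier (poly_ring n Quot I) = (\<lambda>p. (\<lambda>h. h + p) ` I) ` polys ?V"
    by (auto simp: FactRing_def A_RCOSETS_def' carrier_poly_ring coset_eq)
  have zero: "\<zero>\<^bsub>poly_ring n Quot I\<^esub> = (\<lambda>h. h + 0) ` I"
    by (simp add: FactRing_def)
  have pA: "?f 0 f 0 \<in> polys ?V"
    if "graded_matrix ?V (gens 0) [0] (?A 0)" "f \<in> ?F 0" for f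
    using vecs_polys[OF mat_app_vecs[OF that]] .
  have surj: "augmentation n I (d 0) ` free_module n (gens 0) = carrier (poly_ring n Quot I)
      \<longleftrightarrow> (\<forall>p\<in>polys ?V. \<exists>v\<in>?F 0. p - ?f 0 v 0 \<in> I)"
    if A: "graded_matrix ?V (gens 0) [0] (?A 0)"
  proof -
    have "augmentation n I (d 0) ` free_module n (gens 0)
        = (\<lambda>f. (\<lambda>h. h + ?f 0 f 0) ` I) ` ?F 0"
      unfolding fvec_free_module[symmetric] image_image by (rule image_cong[OF refl aug])
    moreover have "\<dots> \<subseteq> carrier (poly_ring n Quot I)"
      unfolding carr using pA[OF A] by blast
    ultimately have "augmentation n I (d 0) ` free_module n (gens 0) = carrier (poly_ring n Quot I)
      \<longleftrightarrow> (\<forall>p\<in>polys ?V. (\<lambda>h. h + p) ` I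
            \<in> (\<lambda>f. (\<lambda>h. h + ?f 0 f 0) ` I) ` ?F 0)"
      unfolding carr by auto
    also have "\<dots> \<longleftrightarrow> (\<forall>p\<in>polys ?V. \<exists>v\<in>?F 0. p - ?f 0 v 0 \<in> I)"
      by (simp add: image_iff coset_eq_iff[OF I])
    finally show ?thesis .
  qed
  have pres: "graded_map n (gens 0) [0] (d 0) \<and>
      augmentation n I (d 0) ` free_module n (gens 0) = carrier (poly_ring n Quot I)
      \<longleftrightarrow> presents ?V (gens 0) [0] (?A 0) (vecs ?V 1) (ideal_vecs ?V I)"
    unfolding presents_cyclic_iff[OF finite_vars I] g0 using surj by blast
  have ker0: "{v \<in> free_module n (gens 0). augmentation n I (d 0) v = \<zero>\<^bsub>poly_ring n Quot I\<^esub>}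
        = (\<lambda>w. d 1 *\<^sub>v w) ` free_module n (gens 1)
      \<longleftrightarrow> syzygies ?V (gens 0) (?A 0) (ideal_vecs ?V I) = ?f 1 ` ?F 1"
    if A: "graded_matrix ?V (gens 0) [0] (?A 0)"
  proof -
    have d1: "d 1 \<in> carrier_mat (length (gens 0)) (length (gens 1))" using d[of 0] by simp
    have k: "augmentation n I (d 0) v = \<zero>\<^bsub>poly_ring n Quot I\<^esub>
        \<longleftrightarrow> ?f 0 (fvec v) \<in> ideal_vecs ?V I" if v: "v \<in> free_module n (gens 0)" for v
    proof -
      have "?f 0 (fvec v) \<in> vecs ?V 1"
        using mat_app_vecs[OF A] v by (simp add: free_module_iff)
      then show ?thesis unfolding aug[OF v] zero coset_eq_iff[OF I] by (simp add: ideal_vecs_def)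
    qed
    have "{v \<in> free_module n (gens 0). augmentation n I (d 0) v = \<zero>\<^bsub>poly_ring n Quot I\<^esub>}
        = (\<lambda>w. d 1 *\<^sub>v w) ` free_module n (gens 1)
      \<longleftrightarrow> fvec ` {v \<in> free_module n (gens 0). augmentation n I (d 0) v = \<zero>\<^bsub>poly_ring n Quot I\<^esub>}
        = fvec ` (\<lambda>w. d 1 *\<^sub>v w) ` free_module n (gens 1)"
      by (rule free_module_eq_iff) (use d1 in auto)
    moreover have "fvec ` {v \<in> free_module n (gens 0). augmentation n I (d 0) v = \<zero>\<^bsub>poly_ring n Quot I\<^esub>}
        = syzygies ?V (gens 0) (?A 0) (ideal_vecs ?V I)"
      by (rule fvec_image_kernel) (rule k)
    ultimately show ?thesis unfolding fvec_image_mult[OF d1] by (simp only:)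
  qed
  have ker: "{v \<in> free_module n (gens (Suc i)). d (Suc i) *\<^sub>v v = 0\<^sub>v (length (gens i))}
        = (\<lambda>w. d (Suc (Suc i)) *\<^sub>v w) ` free_module n (gens (Suc (Suc i)))
      \<longleftrightarrow> syzygies ?V (gens (Suc i)) (?A (Suc i)) {\<lambda>_. 0}
        = ?f (Suc (Suc i)) ` ?F (Suc (Suc i))" for i
  proof -
    have k: "d (Suc i) *\<^sub>v v = 0\<^sub>v (length (gens i))
        \<longleftrightarrow> ?f (Suc i) (fvec v) \<in> {\<lambda>_. 0}" if v: "v \<in> free_module n (gens (Suc i))" for v
    proof -
      have "d (Suc i) *\<^sub>v v = 0\<^sub>v (length (gens i)) \<longleftrightarrow> fvec (d (Suc i) *\<^sub>v v) = fvec (0\<^sub>v (length (gens i)) :: 'a xypoly vec)"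
        using fvec_inj[of "d (Suc i) *\<^sub>v v" "0\<^sub>v (length (gens i))"] d[of i] by auto
      then show ?thesis using fvec_mult_mat_vec[OF d[of i], of v] v
        by (simp add: fvec_zero free_module_iff)
    qed
    have "{v \<in> free_module n (gens (Suc i)). d (Suc i) *\<^sub>v v = 0\<^sub>v (length (gens i))}
        = (\<lambda>w. d (Suc (Suc i)) *\<^sub>v w) ` free_module n (gens (Suc (Suc i)))
      \<longleftrightarrow> fvec ` {v \<in> free_module n (gens (Suc i)). d (Suc i) *\<^sub>v v = 0\<^sub>v (length (gens i))}
        = fvec ` (\<lambda>w. d (Suc (Suc i)) *\<^sub>v w) ` free_module n (gens (Suc (Suc i)))"
      by (rule free_module_eq_iff) (use d[of "Suc i"] in auto)
    moreover have "fvec ` {v \<in> free_module n (gens (Suc i)). d (Suc i) *\<^sub>v v = 0\<^sub>v (length (gens i))}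
        = syzygies ?V (gens (Suc i)) (?A (Suc i)) {\<lambda>_. 0}"
      by (rule fvec_image_kernel) (rule k)
    ultimately show ?thesis unfolding fvec_image_mult[OF d[of "Suc i"]] by (simp only:)
  qed
  have cf: "(\<forall>a<length (gens i). \<forall>b<length (gens (Suc i)). lookup (d (Suc i) $$ (a, b)) 0 = 0)
      \<longleftrightarrow> const_free (?f (Suc i) ` ?F (Suc i))"
    if "graded_matrix ?V (gens (Suc i)) (gens i) (?A (Suc i))" for i
    unfolding const_free_image_iff[OF that] using d[of i] by (auto simp: fmat_def)
  show ?thesis
  proof (cases "graded_map n (gens 0) [0] (d 0) \<and> (\<forall>i. graded_map n (gens (Suc i)) (gens i) (d (Suc i)))")
    case False
    then show ?thesis
      unfolding minimal_graded_free_resolution_def function_resolution_def presents_def g0 g by blast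
  next
    case gr: True
    then have G0: "graded_matrix ?V (gens 0) [0] (?A 0)" and G: "\<And>i. graded_matrix ?V (gens (Suc i)) (gens i) (?A (Suc i))"
      unfolding g0 g by auto
    show ?thesis
      unfolding minimal_graded_free_resolution_def function_resolution_def
        ker0[OF G0] ker cf[OF G] pres[symmetric]
      using True gr G by blast
  qed
qed

section \<open>The regularity bound\<close>

lemma module_reg_ideal_vecs:
  assumes I: "graded_ideal V I" and k: "koszul_reg V I r"
  shows "module_reg V [0] (vecs V 1) (ideal_vecs V I) r"
  unfolding module_reg_def
proof (intro allI impI)
  fix D and z :: "var set \<Rightarrow> nat \<Rightarrow> 'a xypoly"
  assume D: "r < D" and z: "\<forall>T. z T \<in> vecs V 1 \<and> vhomog [0] D (z T)"
    and b: "\<forall>T\<subseteq>V. vbd V z T \<in> ideal_vecs V I"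
  have "\<exists>w. (\<forall>T. w T \<in> polys V) \<and> (\<forall>T. homogeneous (D - 1) (w T)) \<and> (\<forall>T\<subseteq>V. z T 0 - bd V w T \<in> I)"
  proof (rule koszul_regE[OF k D])
    show "z T 0 \<in> polys V" for T using z vecs_polys by blast
    show "homogeneous D (z T 0)" for T using z by (auto simp: vhomog_def)
    show "bd V (\<lambda>T. z T 0) T \<in> I" if "T \<subseteq> V" for T
      using b that by (auto simp: ideal_vecs_def vbd_def)
  qed
  then obtain w where w: "\<And>T. w T \<in> polys V" "\<And>T. T \<subseteq> V \<Longrightarrow> z T 0 - bd V w T \<in> I" by blast
  define w' where "w' T = (\<lambda>a::nat. if a = 0 then w T else 0)" for T
  have w': "w' T \<in> vecs V 1" for T using w(1) by (auto simp: w'_def vecs_def)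
  have "(\<lambda>a. z T a - vbd V w' T a) \<in> ideal_vecs V I" if T: "T \<subseteq> V" for T
  proof -
    have "vbd V w' T \<in> vecs V 1"
      using vbd_closed[OF graded_submodule_vecs[of V "[0]"], of w' T] w' T by simp
    then have "(\<lambda>a. z T a - vbd V w' T a) \<in> vecs V 1" using z by simp
    then show ?thesis using w(2)[OF T] by (simp add: ideal_vecs_def) (simp add: vbd_def w'_def)
  qed
  then show "\<exists>w. (\<forall>T\<subseteq>V. w T \<in> vecs V 1) \<and> (\<forall>T\<subseteq>V. (\<lambda>a. z T a - vbd V w T a) \<in> ideal_vecs V I)"
    using w' by blast
qed

lemma resolution_degrees_le:
  assumes I: "graded_ideal V I" and k: "koszul_reg V I r" and res: "function_resolution V I gens A"
  shows "\<forall>b<length (gens i). gens i ! b \<le> r + int i"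
proof -
  have V: "finite V" and p0: "presents V (gens 0) [0] (A 0) (vecs V 1) (ideal_vecs V I)"
    using res by (auto simp: function_resolution_def presents_def)
  \<comment> \<open>The kernel of the map out of the \<open>i\<close>-th module; for \<open>i = 0\<close> the target is \<open>S/I\<close>.\<close>
  define Z where "Z i = (case i of 0 \<Rightarrow> syzygies V (gens 0) (A 0) (ideal_vecs V I)
    | Suc j \<Rightarrow> syzygies V (gens i) (A i) {\<lambda>_. 0})" for i
  have img: "map_on (gens (Suc i)) (A (Suc i)) ` free_on V (gens (Suc i)) = Z i" for i
    using res by (cases i) (auto simp: function_resolution_def Z_def)
  have cf: "const_free (Z i)" for i
    using res unfolding img[symmetric] function_resolution_def by blast
  have A: "graded_matrix V (gens (Suc i)) (gens i) (A (Suc i))" for i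
    using res by (simp add: function_resolution_def)
  have gZ: "graded_submodule V (gens i) (Z i)" for i
  proof (cases i)
    case 0
    have "graded_matrix V (gens 0) [0] (A 0)" "graded_submodule V [0] (ideal_vecs V I)" using p0 by (auto simp: presents_def)
    then show ?thesis using 0 graded_submodule_preimage by (simp add: Z_def syzygies_def)
  next
    case (Suc j)
    then show ?thesis using graded_submodule_preimage[OF A graded_submodule_zero] by (simp add: Z_def syzygies_def)
  qed
  have "(\<forall>b<length (gens i). gens i ! b \<le> r + int i) \<and> module_reg V (gens i) (Z i) {\<lambda>_. 0} (r + int i + 1)"
  proof (induction i)
    case 0
    note k0 = module_reg_ideal_vecs[OF I k]
    have "gens 0 ! b \<le> r" if "b < length (gens 0)" for b
      by (rule minimal_degrees_le[OF p0 k0 _ that]) (use cf[of 0] in \<open>simp add: Z_def\<close>)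
    then show ?case using module_reg_syzygies[OF p0 _ k0] by (simp add: Z_def)
  next
    case (Suc i)
    then have ki: "module_reg V (gens i) (Z i) {\<lambda>_. 0} (r + int (Suc i))" by (simp add: algebra_simps)
    have p: "presents V (gens (Suc i)) (gens i) (A (Suc i)) (Z i) {\<lambda>_. 0}"
      by (rule presents_image[OF V A gZ img])
    have "gens (Suc i) ! b \<le> r + int (Suc i)" if "b < length (gens (Suc i))" for b
      by (rule minimal_degrees_le[OF p ki _ that]) (use cf[of "Suc i"] in \<open>simp add: Z_def\<close>)
    then show ?case using module_reg_syzygies[OF p _ ki] by (simp add: Z_def)
  qed
  then show ?thesis by blast
qed

text \<open>The construction starts from the identity \<open>S \<rightarrow> S\<close>, with \<open>I\<close> as its syzygy module modulo \<open>I\<close>; this is where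
\<open>0 \<le> r\<close> is used, the generator of \<open>S\<close> having degree zero.\<close>

lemma function_resolution_exists:
  assumes V: "finite V" and I: "graded_ideal V I" and k: "koszul_reg V I r" and r: "0 \<le> r"
    and c: "\<And>f. f \<in> I \<Longrightarrow> lookup f 0 = 0"
  shows "\<exists>gens A. function_resolution V I gens A"
proof -
  define A0 :: "nat \<Rightarrow> nat \<Rightarrow> 'a xypoly" where "A0 a b = (if a = 0 \<and> b = 0 then 1 else 0)" for a b
  have mat_app0: "mat_app (length [0::int]) A0 v = v" if "v \<in> vecs V 1" for v
    by (rule ext) (use that in \<open>auto simp: mat_app_def A0_def vecs_def\<close>)
  have A0: "graded_matrix V [0] [0] A0"
    by (auto simp: graded_matrix_def A0_def single_one[symmetric] homogeneous_single simp del: single_one)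
  have p: "presents V [0] [0] A0 (vecs V 1) (ideal_vecs V I)"
    unfolding presents_cyclic_iff[OF V I]
  proof (intro conjI A0 ballI)
    fix p :: "'a xypoly" assume "p \<in> polys V"
    then have v: "(\<lambda>a. if a = 0 then p else 0) \<in> vecs V 1" by (auto simp: vecs_def)
    then show "\<exists>v\<in>vecs V (length [0::int]). p - mat_app (length [0::int]) A0 v 0 \<in> I"
      using mat_app0[OF v] graded_idealD(2)[OF I]
      by (intro bexI[of _ "\<lambda>a. if a = 0 then p else 0"]) simp_all
  qed
  define Z0 where "Z0 = syzygies V [0] A0 (ideal_vecs V I)"
  have Z0: "Z0 = ideal_vecs V I" using mat_app0 by (auto simp: Z0_def syzygies_def ideal_vecs_def)
  have "const_free Z0" unfolding Z0 const_free_def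
  proof (intro ballI allI)
    fix f a assume f: "f \<in> ideal_vecs V I"
    show "lookup (f a) 0 = 0" by (cases a) (use f c in \<open>auto simp: ideal_vecs_def vecs_def\<close>)
  qed
  moreover have "module_reg V [0] Z0 {\<lambda>_. 0} (r + 1)"
    unfolding Z0_def by (rule module_reg_syzygies[OF p _ module_reg_ideal_vecs[OF I k]]) (use r in simp)
  ultimately have syzygy_invariant0: "syzygy_invariant V (r + 1) [0] Z0"
    using graded_submodule_ideal_vecs[OF I] by (simp add: syzygy_invariant_def Z0)
  \<comment> \<open>A state consists of the basis degrees, the matrix of the incoming map and the next syzygy module.\<close>
  define P where "P n = (\<lambda>(ds, A, Z). syzygy_invariant V (r + 1 + int n) ds Z \<and> (n = 0 \<longrightarrow> ds = [0] \<and> A = A0 \<and> Z = Z0))" for n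
  define Q where "Q = (\<lambda>(n::nat) (ds, A :: nat \<Rightarrow> nat \<Rightarrow> 'a xypoly, Z)
    (ds', A' :: nat \<Rightarrow> nat \<Rightarrow> 'a xypoly, Z'). graded_matrix V ds' ds A'
    \<and> map_on ds' A' ` free_on V ds' = Z \<and> Z' = syzygies V ds' A' {\<lambda>_. 0})"
  have "\<exists>f. \<forall>n. P n (f n) \<and> Q n (f n) (f (Suc n))"
  proof (rule dependent_nat_choice)
    show "\<exists>x. P 0 x" using syzygy_invariant0 by (intro exI[of _ "([0], A0, Z0)"]) (simp add: P_def)
    fix x n assume "P n x"
    moreover obtain ds A Z where x: "x = (ds, A, Z)" by (cases x)
    ultimately have "syzygy_invariant V (r + 1 + int n) ds Z" by (simp add: P_def)
    then obtain ds' A' where "graded_matrix V ds' ds A'" "map_on ds' A' ` free_on V ds' = Z"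
      "syzygy_invariant V (r + 1 + int n + 1) ds' (syzygies V ds' A' {\<lambda>_. 0})" using syzygy_invariant_step[OF V] by blast
    then show "\<exists>y. P (Suc n) y \<and> Q n x y"
      by (intro exI[of _ "(ds', A', syzygies V ds' A' {\<lambda>_. 0})"]) (simp add: P_def Q_def x algebra_simps)
  qed
  then obtain f where f: "\<And>n. P n (f n)" "\<And>n. Q n (f n) (f (Suc n))" by blast
  define gens A Z where "gens n = fst (f n)" and "A n = fst (snd (f n))" and "Z n = snd (snd (f n))" for n
  have fn: "f n = (gens n, A n, Z n)" for n by (simp add: gens_def A_def Z_def)
  have start: "gens 0 = [0]" "A 0 = A0" "Z 0 = Z0" using f(1)[of 0] by (simp_all add: P_def fn)
  have cf: "const_free (Z n)" for n using f(1)[of n] by (simp add: P_def fn syzygy_invariant_def)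
  have step: "graded_matrix V (gens (Suc n)) (gens n) (A (Suc n))"
    "map_on (gens (Suc n)) (A (Suc n)) ` free_on V (gens (Suc n)) = Z n"
    "Z (Suc n) = syzygies V (gens (Suc n)) (A (Suc n)) {\<lambda>_. 0}" for n
    using f(2)[of n] by (simp_all add: Q_def fn)
  have "function_resolution V I gens A"
    unfolding function_resolution_def
    using p step cf by (simp add: start Z0_def[symmetric] step(3)[symmetric])
  then show ?thesis by blast
qed

lemma mat_app_cong: "(\<And>a b. b < k \<Longrightarrow> A a b = B a b) \<Longrightarrow> mat_app k A = mat_app k B"
  by (intro ext) (auto simp: mat_app_def intro!: sum.cong)

text \<open>The functions \<open>A i\<close> may have junk values beyond their last column, which are cut off by passing to a
matrix and back.\<close>

lemma minimal_graded_free_resolution_exists: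
  assumes I: "graded_ideal (vars n) I" and res: "function_resolution (vars n) I gens A"
  shows "\<exists>d. minimal_graded_free_resolution n I gens d"
proof -
  define es where "es i = (case i of 0 \<Rightarrow> [0] | Suc j \<Rightarrow> gens j)" for i
  define d where "d i = mat (length (es i)) (length (gens i)) (\<lambda>(a, b). A i a b)" for i
  have A: "graded_matrix (vars n) (gens i) (es i) (A i)" for i
    using res by (cases i) (auto simp: function_resolution_def presents_def es_def)
  have eq: "fmat (d i) a b = A i a b" if "b < length (gens i)" for i a b
    unfolding d_def by (rule fmat_mat[OF A that])
  have mat_app: "map_on (gens i) (fmat (d i)) = map_on (gens i) (A i)" for i
    by (rule mat_app_cong) (rule eq)
  have g: "graded_matrix (vars n) (gens i) (es i) (fmat (d i))" for i
    using A[of i] eq[of _ i] by (auto simp: graded_matrix_def) (auto simp: d_def fmat_def)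
  have "function_resolution (vars n) I gens (\<lambda>i. fmat (d i))"
    using res g[of 0] g[of "Suc _"] mat_app
    unfolding function_resolution_def presents_def syzygies_def by (simp add: es_def)
  then have "minimal_graded_free_resolution n I gens d"
    unfolding minimal_graded_free_resolution_iff[OF I] by (auto simp: d_def es_def)
  then show ?thesis by blast
qed

lemma edge_gens_no_constant: "f \<in> edge_ideal V W E \<Longrightarrow> lookup f 0 = 0"
proof (induction rule: gen_ideal.induct)
  case (gen_ideal_step p g q)
  have "lookup g 0 = 0"
    using gen_ideal_step(2) by (cases rule: edge_gens_cases) (auto simp: edge_binom_def xvar_indet yvar_indet lookup_minus lookup_0_mult)
  then show ?case using gen_ideal_step by (simp add: lookup_add lookup_0_mult)
qed simp

theorem corollary2p6:
  fixes n :: nat and E :: "nat set set"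
  assumes "simple_graph {1..n} E"
  shows "regularity n (binomial_edge_ideal n E :: 'k::field xypoly set) \<le> ereal (real (eta {1..n} E))"
proof -
  define I where "I = (edge_ideal (vars n) {} E :: 'k xypoly set)"
  have adm: "admissible (vars n) {} E" by (rule binomial_edge_ideal_eq(2)[OF assms])
  have bei: "(binomial_edge_ideal n E :: 'k xypoly set) = I"
    unfolding I_def by (rule binomial_edge_ideal_eq(1)[OF assms])
  have gI: "graded_ideal (vars n) I" unfolding I_def by (rule graded_ideal_edge_gens[OF adm]) simp
  have "\<Union>E \<subseteq> {1..n}" using assms unfolding simple_graph_def by blast
  then have k: "koszul_reg (vars n) I (int (eta {1..n} E))" unfolding I_def by (rule koszul_reg_le_eta[OF adm])
  have const: "lookup f 0 = 0" if "f \<in> I" for f using that unfolding I_def by (rule edge_gens_no_constant)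
  obtain gens A where "function_resolution (vars n) I gens A"
    using function_resolution_exists[OF finite_vars gI k _ const] by auto
  then obtain gens d where res: "minimal_graded_free_resolution n I gens d"
    using minimal_graded_free_resolution_exists[OF gI] by blast
  have bound: "j - int i \<le> int (eta {1..n} E)" if b: "graded_betti n I i j \<noteq> 0" for i j
  proof -
    have "\<exists>b gens d. minimal_graded_free_resolution n I gens d \<and> b = count_list (gens i) j"
      using res by blast
    from someI_ex[OF this] obtain gens' d' where res': "minimal_graded_free_resolution n I gens' d'"
      and "graded_betti n I i j = count_list (gens' i) j"
      unfolding graded_betti_def by blast
    then have "j \<in> set (gens' i)" using b count_notin by force
    then obtain b where b: "b < length (gens' i)" "gens' i ! b = j" by (auto simp: in_set_conv_nth)
    have "function_resolution (vars n) I gens' (\<lambda>i. fmat (d' i))"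
      using res' unfolding minimal_graded_free_resolution_iff[OF gI] by blast
    from resolution_degrees_le[OF gI k this, of i] show ?thesis using b by auto
  qed
  show ?thesis unfolding bei regularity_def
  proof (rule Sup_least)
    fix x assume "x \<in> {ereal (of_int (j - int i)) | i j. graded_betti n I i j \<noteq> 0}"
    then obtain i j where "x = ereal (of_int (j - int i))" "graded_betti n I i j \<noteq> 0" by blast
    moreover from bound[OF this(2)] have "real_of_int (j - int i) \<le> real_of_int (int (eta {1..n} E))"
      by (simp only: of_int_le_iff)
    ultimately show "x \<le> ereal (real (eta {1..n} E))" by simp
  qed
qed

end
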